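(* (a) Fix a positive integer $p$ and $\mathbf n=(n_1,\dots,n_p)\in[N]^p$ such that $$\max_{q_1\in[n_1],\dots,q_p\in[n_p]}\Big(\min_{i\in[p]}\rho_{n_i}(q_i)-(q_1+\cdots+q_p)\Big)\le d_G.$$ Then for a generic $\mathbf w\in\mathcal V^p$ with respect to the Zariski topology the following holds: for every $S\subset[N]\times[p]$ such that $|S_i|\ge n_i$ for all $i\in[p]$, the map $\hat\Phi_{\mathbf w,S}$ is injective. (b) In the special case $n_1=\dots=n_p=n$, choose the positive integer $p$ so that $$p>\max_{q\in[n]}\frac1q\big(\rho_n(q)-d_G-1\big).$$ Then for a generic $\mathbf w\in\mathcal V^p$ with respect to the Zariski topology, and for every $S\subset[N]\times[p]$ such that $|S_i|\ge n$ for all $i\in[p]$, the map $\hat\Phi_{\mathbf w,S}$ is injective.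
   Context: $(\mathcal V,\langle\cdot,\cdot\rangle)$ is a real inner product space of finite dimension $d\ge 2$, and $G$ is a finite group of order $|G|=N$ acting unitarily on $\mathcal V$: each $g\in G$ acts by a linear isometry $U_g$ of $\mathcal V$. Write $x\sim y$ if $y=U_gx$ for some $g\in G$, $[x]=\{U_gx:g\in G\}$, and $\hat{\mathcal V}=\mathcal V/\sim$. Write $[r]=\{1,\dots,r\}$. $V_G=\{x\in\mathcal V:U_gx=x\ \forall g\in G\}$ and $d_G=\dim V_G$. For $w,x\in\mathcal V$ and $j\in[N]$, $\Phi_{w,j}(x)$ is the $j$-th entry of the vector obtained by sorting the $N$ numbers $(\langle U_gw,x\rangle)_{g\in G}$ (with repetitions) in decreasing order. For $\mathbf w=(w_1,\dots,w_p)\in\mathcal V^p$ and $S\subset[N]\times[p]$, let $S_i=\{k\in[N]:(k,i)\in S\}$ for $i\in[p]$, and $$\Phi_{\mathbf w,S}:\mathcal V\to\mathbb R^{|S|},\qquad \Phi_{\mathbf w,S}(x)=\big[\{\Phi_{w_1,j}(x)\}_{j\in S_1},\dots,\{\Phi_{w_p,j}(x)\}_{j\in S_p}\big].$$ This map is $G$-invariant and so induces $\hat\Phi_{\mathbf w,S}:\hat{\mathcal V}\to\mathbb R^{|S|}$, $\hat\Phi_{\mathbf w,S}([x])=\Phi_{\mathbf w,S}(x)$. For $n\in[N]$ let $H_n$ be the set of $n$-tuples $g=(g(1),\dots,g(n))\in G^n$ with pairwise distinct entries. For $g,h\in H_n$ and an integer $q\ge0$, $$\Gamma_{g,h}^q=\{(x,y)\in\mathcal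 V\times\mathcal V:\dim\operatorname{span}(U_{g(1)}x-U_{h(1)}y,\dots,U_{g(n)}x-U_{h(n)}y)=q\},$$ a semi-algebraic set; $\gamma_{g,h}^q=\dim\Gamma_{g,h}^q$ is its semi-algebraic dimension, with the convention $\dim\emptyset=-1$; and $\rho_n(q)=\max_{g,h\in H_n}\gamma_{g,h}^q$. A property holds for generic $\mathbf w\in\mathcal V^p$ with respect to the Zariski topology if it holds for all $\mathbf w$ in some nonempty Zariski-open subset of $\mathcal V^p\cong\mathbb R^{dp}$. *)

theory Defs
  imports
    "HOL-Analysis.Analysis"
    "HOL-Algebra.Group_Action"
    "HOL-Algebra.Ideal"
begin

section \<open>Zariski topology on a Euclidean space\<close>

text \<open>On a Euclidean space, \<^const>\<open>real_polynomial_function\<close> describes exactly the polynomial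
  functions in the coordinates with respect to some (equivalently, any) basis.\<close>

definition zariski_closed :: "'a::euclidean_space set \<Rightarrow> bool" where
  "zariski_closed Z \<longleftrightarrow>
     (\<exists>F. (\<forall>f\<in>F. real_polynomial_function f) \<and> Z = {x. \<forall>f\<in>F. f x = 0})"

definition zariski_open :: "'a::euclidean_space set \<Rightarrow> bool" where
  "zariski_open A \<longleftrightarrow> zariski_closed (- A)"

definition zariski_generic :: "('a::euclidean_space \<Rightarrow> bool) \<Rightarrow> bool" where
  "zariski_generic P \<longleftrightarrow> (\<exists>A. zariski_open A \<and> A \<noteq> {} \<and> (\<forall>w\<in>A. P w))"


section \<open>Dimension of semi-algebraic sets\<close>

text \<open>The dimension of a semi-algebraic set \<open>A\<close> is taken as in Bochnak, Coste and Roy,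
  Real Algebraic Geometry, Section 2.8: it is the Krull dimension of the ring of polynomial
  functions on \<open>A\<close>, that is, of \<open>\<real>[X\<^sub>1, \<dots>, X\<^sub>m] / I(A)\<close> where \<open>I(A)\<close> consists of the polynomials
  vanishing on \<open>A\<close>. This quotient is represented by the restrictions to \<open>A\<close> of the polynomial
  functions; functions are made undefined off \<open>A\<close>, so that two of them are equal iff they
  agree on \<open>A\<close>.\<close>

definition poly_ring_on :: "'a::euclidean_space set \<Rightarrow> ('a \<Rightarrow> real) ring" where
  "poly_ring_on A =
     \<lparr>carrier = {restrict f A | f. real_polynomial_function f},
      monoid.mult = (\<lambda>f g. \<lambda>x\<in>A. f x * g x),
      one = (\<lambda>x\<in>A. 1),
      zero = (\<lambda>x\<in>A. 0),
      add = (\<lambda>f g. \<lambda>x\<in>A. f x + g x)\<rparr>"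

definition prime_chain :: "('r, 'm) ring_scheme \<Rightarrow> (nat \<Rightarrow> 'r set) \<Rightarrow> nat \<Rightarrow> bool" where
  "prime_chain R P k \<longleftrightarrow> (\<forall>i\<le>k. primeideal (P i) R) \<and> (\<forall>i<k. P i \<subset> P (Suc i))"

text \<open>The value \<open>-1\<close> is attained only if \<open>R\<close> has no prime ideals. In particular the empty set,
  whose ring of polynomial functions is the zero ring, has dimension \<open>-1\<close>.\<close>

definition krull_dim :: "('r, 'm) ring_scheme \<Rightarrow> ereal" where
  "krull_dim R = Sup (insert (-1) {ereal (real k) | k. \<exists>P. prime_chain R P k})"

definition semialg_dim :: "'a::euclidean_space set \<Rightarrow> ereal" where
  "semialg_dim A = krull_dim (poly_ring_on A)"

lemma cring_poly_ring_on: "cring (poly_ring_on A)"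
proof (rule cringI)
  show "abelian_group (poly_ring_on A)"
  proof (rule abelian_groupI)
    fix f assume "f \<in> carrier (poly_ring_on A)"
    then obtain f' where f': "real_polynomial_function f'" "f = restrict f' A"
      by (auto simp: poly_ring_on_def)
    have "real_polynomial_function (\<lambda>x. (-1) * f' x)"
      by (rule real_polynomial_function.intros(4)[OF real_polynomial_function.intros(2) f'(1)])
    then have "restrict (\<lambda>x. (-1) * f' x) A \<in> carrier (poly_ring_on A)"
      unfolding poly_ring_on_def by auto
    moreover have "restrict (\<lambda>x. (-1) * f' x) A \<oplus>\<^bsub>poly_ring_on A\<^esub> f = \<zero>\<^bsub>poly_ring_on A\<^esub>"
      by (auto simp: poly_ring_on_def f'(2) fun_eq_iff)
    ultimately show "\<exists>g\<in>carrier (poly_ring_on A). g \<oplus>\<^bsub>poly_ring_on A\<^esub> f = \<zero>\<^bsub>poly_ring_on A\<^esub>"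
      by blast
  next
    fix f g assume "f \<in> carrier (poly_ring_on A)" "g \<in> carrier (poly_ring_on A)"
    then obtain f' g' where *: "real_polynomial_function f'" "f = restrict f' A"
        "real_polynomial_function g'" "g = restrict g' A"
      by (auto simp: poly_ring_on_def)
    then have "real_polynomial_function (\<lambda>x. f' x + g' x)"
      by blast
    moreover have "f \<oplus>\<^bsub>poly_ring_on A\<^esub> g = restrict (\<lambda>x. f' x + g' x) A"
      by (auto simp: poly_ring_on_def * fun_eq_iff)
    ultimately show "f \<oplus>\<^bsub>poly_ring_on A\<^esub> g \<in> carrier (poly_ring_on A)"
      unfolding poly_ring_on_def by auto
  qed (auto simp: poly_ring_on_def fun_eq_iff)
next
  show "comm_monoid (poly_ring_on A)"
  proof (rule comm_monoidI)
    fix f g assume "f \<in> carrier (poly_ring_on A)" "g \<in> carrier (poly_ring_on A)"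
    then obtain f' g' where *: "real_polynomial_function f'" "f = restrict f' A"
        "real_polynomial_function g'" "g = restrict g' A"
      by (auto simp: poly_ring_on_def)
    then have "real_polynomial_function (\<lambda>x. f' x * g' x)"
      by blast
    moreover have "f \<otimes>\<^bsub>poly_ring_on A\<^esub> g = restrict (\<lambda>x. f' x * g' x) A"
      by (auto simp: poly_ring_on_def * fun_eq_iff)
    ultimately show "f \<otimes>\<^bsub>poly_ring_on A\<^esub> g \<in> carrier (poly_ring_on A)"
      unfolding poly_ring_on_def by auto
  qed (auto simp: poly_ring_on_def fun_eq_iff)
qed (auto simp: poly_ring_on_def fun_eq_iff algebra_simps)

lemma semialg_dim_empty: "semialg_dim ({} :: 'a::euclidean_space set) = -1"
proof -
  have "carrier (poly_ring_on ({} :: 'a set)) = {\<zero>\<^bsub>poly_ring_on {}\<^esub>}"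
    by (auto simp: poly_ring_on_def fun_eq_iff)
  then have *: "\<not> primeideal I (poly_ring_on {})" for I :: "('a \<Rightarrow> real) set"
    using additive_subgroup.a_subset additive_subgroup.zero_closed ideal.axioms(1)
      primeideal.axioms(1) primeideal.I_notcarr
    by (metis empty_iff subset_singletonD)
  have "\<not> prime_chain (poly_ring_on {}) P k" for P :: "nat \<Rightarrow> ('a \<Rightarrow> real) set" and k
    using * by (auto simp: prime_chain_def)
  then show ?thesis
    by (simp add: semialg_dim_def krull_dim_def)
qed


section \<open>Sorted coorbits\<close>

text \<open>The group acts through \<open>U\<close>, with \<open>U g\<close> the isometry of the element \<open>g\<close>. Sorting is in
  decreasing order, and the index \<open>j\<close> runs over \<open>{1..order G}\<close>.\<close>

definition coorbit_entry ::
  "('g, 'm) monoid_scheme \<Rightarrow> ('g \<Rightarrow> 'v::euclidean_space \<Rightarrow> 'v) \<Rightarrow> 'v \<Rightarrow> nat \<Rightarrow> 'v \<Rightarrow> real" where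
  "coorbit_entry G U w j x =
     rev (sorted_list_of_multiset (image_mset (\<lambda>g. inner (U g w) x) (mset_set (carrier G)))) ! (j - 1)"

definition section_at :: "(nat \<times> 'p) set \<Rightarrow> 'p \<Rightarrow> nat set" where
  "section_at S i = {k. (k, i) \<in> S}"

text \<open>Elements of \<open>\<real>\<^bsup>|S|\<^esup>\<close> are represented as real functions on \<open>S\<close>, undefined off \<open>S\<close>.\<close>

definition coorbit_map ::
  "('g, 'm) monoid_scheme \<Rightarrow> ('g \<Rightarrow> 'v::euclidean_space \<Rightarrow> 'v) \<Rightarrow> 'v ^ 'p \<Rightarrow> (nat \<times> 'p) set
     \<Rightarrow> 'v \<Rightarrow> (nat \<times> 'p \<Rightarrow> real)" where
  "coorbit_map G U w S x = (\<lambda>(j, i)\<in>S. coorbit_entry G U (w $ i) j x)"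

text \<open>The map induced on the quotient, whose elements are the orbits.\<close>

definition coorbit_map_quot ::
  "('g, 'm) monoid_scheme \<Rightarrow> ('g \<Rightarrow> 'v::euclidean_space \<Rightarrow> 'v) \<Rightarrow> 'v ^ 'p \<Rightarrow> (nat \<times> 'p) set
     \<Rightarrow> 'v set \<Rightarrow> (nat \<times> 'p \<Rightarrow> real)" where
  "coorbit_map_quot G U w S X = the_elem (coorbit_map G U w S ` X)"

lemma coorbit_entry_invariant:
  assumes "group_action G UNIV U" and "\<forall>g\<in>carrier G. orthogonal_transformation (U g)"
    and h: "h \<in> carrier G"
  shows "coorbit_entry G U w j (U h x) = coorbit_entry G U w j x"
proof -
  interpret group_action G UNIV U by fact
  interpret group G by (rule group_hom.axioms(1)[OF group_hom])
  have inj: "inj_on (\<lambda>g. h \<otimes>\<^bsub>G\<^esub> g) (carrier G)"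
    using h by (simp add: inj_on_cmult)
  have surj: "(\<lambda>g. h \<otimes>\<^bsub>G\<^esub> g) ` carrier G = carrier G"
    using h by (simp add: surj_const_mult)
  have "image_mset (\<lambda>g. inner (U g w) (U h x)) (mset_set (carrier G))
      = image_mset (\<lambda>g. inner (U g w) (U h x))
          (image_mset (\<lambda>g. h \<otimes>\<^bsub>G\<^esub> g) (mset_set (carrier G)))"
    using image_mset_mset_set[OF inj] surj by simp
  also have "\<dots> = image_mset (\<lambda>g. inner (U (h \<otimes>\<^bsub>G\<^esub> g) w) (U h x)) (mset_set (carrier G))"
    by (simp add: multiset.map_comp comp_def)
  also have "\<dots> = image_mset (\<lambda>g. inner (U g w) x) (mset_set (carrier G))"
  proof (rule image_mset_cong)
    fix g assume "g \<in># mset_set (carrier G)"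
    then have g: "g \<in> carrier G"
      by (metis elem_mset_set empty_iff mset_set.infinite set_mset_empty)
    have "U (h \<otimes>\<^bsub>G\<^esub> g) w = U h (U g w)"
      using composition_rule[OF UNIV_I h g] by simp
    then show "inner (U (h \<otimes>\<^bsub>G\<^esub> g) w) (U h x) = inner (U g w) x"
      using assms(2) h by (simp add: orthogonal_transformation_def)
  qed
  finally show ?thesis
    by (simp add: coorbit_entry_def)
qed

lemma coorbit_map_quot_orbit:
  assumes "group_action G UNIV U" and "\<forall>g\<in>carrier G. orthogonal_transformation (U g)"
  shows "coorbit_map_quot G U w S (orbit G U x) = coorbit_map G U w S x"
proof -
  interpret group_action G UNIV U by fact
  interpret group G by (rule group_hom.axioms(1)[OF group_hom])
  have "coorbit_map G U w S (U g x) = coorbit_map G U w S x" if "g \<in> carrier G" for g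
    using coorbit_entry_invariant[OF assms that] by (simp add: coorbit_map_def)
  moreover have "x \<in> orbit G U x"
    by (rule orbit_refl[OF UNIV_I])
  ultimately have "coorbit_map G U w S ` orbit G U x = {coorbit_map G U w S x}"
    unfolding orbit_def by blast
  then show ?thesis
    by (simp add: coorbit_map_quot_def)
qed


section \<open>The dimensions \<open>d\<^sub>G\<close> and \<open>\<rho>\<^sub>n(q)\<close>\<close>

definition fixed_space ::
  "('g, 'm) monoid_scheme \<Rightarrow> ('g \<Rightarrow> 'v::euclidean_space \<Rightarrow> 'v) \<Rightarrow> 'v set" where
  "fixed_space G U = {x. \<forall>g\<in>carrier G. U g x = x}"

definition distinct_tuples :: "('g, 'm) monoid_scheme \<Rightarrow> nat \<Rightarrow> 'g list set" where
  "distinct_tuples G n = {g. length g = n \<and> set g \<subseteq> carrier G \<and> distinct g}"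

definition Gamma_set ::
  "('g \<Rightarrow> 'v::euclidean_space \<Rightarrow> 'v) \<Rightarrow> nat \<Rightarrow> 'g list \<Rightarrow> 'g list \<Rightarrow> nat \<Rightarrow> ('v \<times> 'v) set" where
  "Gamma_set U n g h q =
     {(x, y). dim (span {U (g ! k) x - U (h ! k) y | k. k < n}) = q}"

definition rho ::
  "('g, 'm) monoid_scheme \<Rightarrow> ('g \<Rightarrow> 'v::euclidean_space \<Rightarrow> 'v) \<Rightarrow> nat \<Rightarrow> nat \<Rightarrow> ereal" where
  "rho G U n q =
     (MAX (g, h) \<in> distinct_tuples G n \<times> distinct_tuples G n. semialg_dim (Gamma_set U n g h q))"

end

theory Submission
  imports Defs
begin

text \<open>If two inequivalent points \<open>x\<close> and \<open>y\<close> have the same image, then each \<open>w\<^sub>i\<close> is orthogonal to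
  \<open>n\<^sub>i\<close> differences \<open>U\<^sub>g x - U\<^sub>h y\<close>, which span a space of some dimension \<open>q\<^sub>i \<ge> 1\<close>. For fixed tuples
  and dimensions this is a bundle with fibres of codimension \<open>\<Sum>q\<^sub>i\<close> over a set of pairs \<open>(x, y)\<close>
  contained in all \<open>\<Gamma>\<^bsup>q\<^sub>i\<^esup>\<close>. Replacing \<open>(x, y)\<close> by \<open>(t x + v, t y + v)\<close> with \<open>v\<close> fixed by \<open>G\<close> does
  not change the fibre, so if the \<open>w\<close> that occur are Zariski dense, then these pairs form a set
  of dimension at least \<open>\<Sum>q\<^sub>i + d\<^sub>G + 1\<close>, against the hypothesis.

  Neither Tarski--Seidenberg nor a general dimension theory is needed. Density yields a prime ideal
  of polynomials modulo which sufficiently many functions are algebraically independent. A count of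
  monomials transfers the independence to coordinates of \<open>(x, y)\<close>, and the uncountability
  of \<open>\<real>\<close> turns algebraically independent functions into a chain of prime ideals, which bounds
  the Krull dimension from below.\<close>

section \<open>Prime ideals and generated subalgebras\<close>

text \<open>The counting takes place on \<open>A \<times> 'e\<close>, with \<open>A\<close> a set of
  pairs (x, y) and \<open>'e\<close> the space of the \<open>w\<close>. There a vector
  \<open>z\<close> splits into a part \<open>w\<close> orthogonal to the Q = \<Sum>q_i differences
  and its Q coefficients along them. Together with the d_G + 1 parameters of translation and scaling
  this makes DIM('e) + Q + d_G + 1 quantities. They are algebraically independent, because the
  \<open>w\<close> that occur are dense and the pair can be moved while \<open>w\<close> stays
  fixed. Since \<open>z\<close> accounts for only DIM('e) of them, at least Q + d_G + 1 independent
  functions come from the pairs. The 1 contributed by scaling is what admits equality in the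
  hypothesis of (a).

  The obstacle is that \<open>A\<close> need not be irreducible, so independence on \<open>A\<close>
  has no meaning before a prime over its vanishing ideal is chosen. The prime has to keep out every
  function that, up to a denominator, is a nonzero polynomial in the quantities above. Fraction
  fields are avoided: relations have coefficients in subalgebras, and denominators are cleared at
  each stage.\<close>

definition ring_ideal :: "'r::comm_ring_1 set \<Rightarrow> bool" where
  "ring_ideal I \<longleftrightarrow> 0 \<in> I \<and> (\<forall>a\<in>I. \<forall>b\<in>I. a + b \<in> I) \<and> (\<forall>a\<in>I. \<forall>r. r * a \<in> I)"

definition ring_prime :: "'r::comm_ring_1 set \<Rightarrow> bool" where
  "ring_prime P \<longleftrightarrow> ring_ideal P \<and> 1 \<notin> P \<and> (\<forall>a b. a * b \<in> P \<longrightarrow> a \<in> P \<or> b \<in> P)"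

lemma ring_idealD:
  assumes "ring_ideal I"
  shows "0 \<in> I" "a \<in> I \<Longrightarrow> b \<in> I \<Longrightarrow> a + b \<in> I" "a \<in> I \<Longrightarrow> r * a \<in> I" "a \<in> I \<Longrightarrow> a * r \<in> I"
    "a \<in> I \<Longrightarrow> - a \<in> I" "a \<in> I \<Longrightarrow> b \<in> I \<Longrightarrow> a - b \<in> I"
proof -
  show "0 \<in> I" and add: "\<And>a b. a \<in> I \<Longrightarrow> b \<in> I \<Longrightarrow> a + b \<in> I"
    and mult: "\<And>a r. a \<in> I \<Longrightarrow> r * a \<in> I"
    using assms by (auto simp: ring_ideal_def)
  show "a \<in> I \<Longrightarrow> a * r \<in> I"
    using mult[of a r] by (simp add: mult.commute)
  show neg: "- a \<in> I" if "a \<in> I" for a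
    using mult[OF that, of "-1"] by simp
  show "a \<in> I \<Longrightarrow> b \<in> I \<Longrightarrow> a - b \<in> I"
    using add[of a "- b"] neg[of b] by simp
qed

lemma ring_ideal_sum: "ring_ideal I \<Longrightarrow> (\<And>i. i \<in> A \<Longrightarrow> f i \<in> I) \<Longrightarrow> (\<Sum>i\<in>A. f i) \<in> I"
  by (induction A rule: infinite_finite_induct) (auto simp: ring_idealD)

lemma ring_ideal_cong: "ring_ideal I \<Longrightarrow> a - b \<in> I \<Longrightarrow> a \<in> I \<longleftrightarrow> b \<in> I"
  using ring_idealD(2)[of I "a - b" b] ring_idealD(6)[of I a "a - b"] by auto

lemma ring_primeD:
  assumes "ring_prime P"
  shows "ring_ideal P" "1 \<notin> P" "a * b \<in> P \<longleftrightarrow> a \<in> P \<or> b \<in> P"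
  using assms ring_idealD by (auto simp: ring_prime_def)

lemma ring_prime_power: "ring_prime P \<Longrightarrow> a ^ n \<in> P \<Longrightarrow> a \<in> P"
  by (induction n) (auto simp: ring_primeD)

lemma ring_prime_of_real:
  fixes P :: "'r::{comm_ring_1,real_algebra_1} set"
  assumes "ring_prime P" "of_real c \<in> P"
  shows "c = 0"
proof (rule ccontr)
  assume "c \<noteq> 0"
  then have "of_real (1 / c) * of_real c = (1 :: 'r)"
    unfolding of_real_mult[symmetric] by simp
  then show False
    using ring_idealD(3)[OF ring_primeD(1)[OF assms(1)] assms(2)] ring_primeD(2)[OF assms(1)]
    by metis
qed

lemma ring_ideal_extend:
  assumes "ring_ideal I"
  shows "ring_ideal {x + r * b | x r. x \<in> I}" (is "ring_ideal ?J")
  unfolding ring_ideal_def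
proof (intro conjI ballI allI)
  show "0 \<in> ?J"
    using ring_idealD(1)[OF assms] by (intro CollectI exI[of _ 0]) auto
next
  fix u v assume "u \<in> ?J" "v \<in> ?J"
  then obtain x r y s where "u = x + r * b" "x \<in> I" "v = y + s * b" "y \<in> I" by blast
  then have "u + v = (x + y) + (r + s) * b" "x + y \<in> I"
    using ring_idealD(2)[OF assms] by (auto simp: algebra_simps)
  then show "u + v \<in> ?J" by blast
next
  fix u t assume "u \<in> ?J"
  then obtain x r where "u = x + r * b" "x \<in> I" by blast
  then have "t * u = t * x + (t * r) * b" "t * x \<in> I"
    by (auto simp: algebra_simps intro: ring_idealD(3)[OF assms])
  then show "t * u \<in> ?J" by blast
qed

text \<open>Krull's argument: an ideal P that is maximal among those containing I and disjoint from
  S is prime. If neither a nor b lies in P, then P + (a) and P + (b) both meet S; the product of the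
  two common elements lies in S and, when ab is in P, also in P.\<close>

lemma prime_avoiding_exists:
  fixes I S :: "'r::comm_ring_1 set"
  assumes I: "ring_ideal I" and disj: "I \<inter> S = {}"
    and one: "1 \<in> S" and mult: "\<And>a b. a \<in> S \<Longrightarrow> b \<in> S \<Longrightarrow> a * b \<in> S"
  obtains P where "ring_prime P" "I \<subseteq> P" "P \<inter> S = {}"
proof -
  define \<A> where "\<A> = {J. ring_ideal J \<and> I \<subseteq> J \<and> J \<inter> S = {}}"
  have "\<Union>C \<in> \<A>" if C: "C \<noteq> {}" "subset.chain \<A> C" for C
  proof -
    have sub: "C \<subseteq> \<A>" and lin: "\<And>J K. J \<in> C \<Longrightarrow> K \<in> C \<Longrightarrow> J \<subseteq> K \<or> K \<subseteq> J"
      using C(2) by (auto simp: subset.chain_def)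
    have "ring_ideal (\<Union>C)"
      unfolding ring_ideal_def
    proof (intro conjI ballI allI)
      show "0 \<in> \<Union>C" using C(1) sub ring_idealD(1) by (fastforce simp: \<A>_def)
    next
      fix a b assume "a \<in> \<Union>C" "b \<in> \<Union>C"
      then obtain J K where JK: "J \<in> C" "K \<in> C" "a \<in> J" "b \<in> K" by blast
      then obtain L where "L \<in> C" "a \<in> L" "b \<in> L" using lin[OF JK(1,2)] by blast
      then show "a + b \<in> \<Union>C" using sub ring_idealD(2)[of L a b] unfolding \<A>_def by blast
    next
      fix a r assume "a \<in> \<Union>C"
      then show "r * a \<in> \<Union>C" using sub ring_idealD(3) by (fastforce simp: \<A>_def)
    qed
    then show ?thesis using C(1) sub by (auto simp: \<A>_def)
  qed
  moreover have "I \<in> \<A>" using I disj by (simp add: \<A>_def)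
  ultimately obtain P where P: "P \<in> \<A>" and max: "\<And>J. J \<in> \<A> \<Longrightarrow> P \<subseteq> J \<Longrightarrow> J = P"
    using subset_Zorn_nonempty[of \<A>] by blast
  have id: "ring_ideal P" "I \<subseteq> P" "P \<inter> S = {}" using P by (auto simp: \<A>_def)
  have meet: "\<exists>x r. x \<in> P \<and> x + r * b \<in> S" if "b \<notin> P" for b
  proof (rule ccontr)
    assume "\<not> ?thesis"
    then have "{x + r * b | x r. x \<in> P} \<inter> S = {}" by blast
    moreover have "P \<subseteq> {x + r * b | x r. x \<in> P}"
    proof
      fix x assume "x \<in> P"
      then show "x \<in> {x + r * b | x r. x \<in> P}" by (intro CollectI exI[of _ x] exI[of _ 0]) simp
    qed
    ultimately have "{x + r * b | x r. x \<in> P} = P"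
      using max[of "{x + r * b | x r. x \<in> P}"] ring_ideal_extend[OF id(1), of b] id(2)
      by (auto simp: \<A>_def)
    moreover have "b \<in> {x + r * b | x r. x \<in> P}"
      using ring_idealD(1)[OF id(1)] by (intro CollectI exI[of _ 0] exI[of _ 1]) simp
    ultimately show False using that by simp
  qed
  have "a \<in> P \<or> b \<in> P" if ab: "a * b \<in> P" for a b
  proof (rule ccontr)
    assume "\<not> (a \<in> P \<or> b \<in> P)"
    then obtain x r y s where *: "x \<in> P" "x + r * a \<in> S" "y \<in> P" "y + s * b \<in> S"
      using meet by metis
    have "(x + r * a) * (y + s * b) = (y + s * b) * x + (r * a) * y + (r * s) * (a * b)"
      by (simp add: algebra_simps)
    also have "\<dots> \<in> P"
      by (rule ring_idealD(2)[OF id(1) ring_idealD(2)[OF id(1)]]; rule ring_idealD(3)[OF id(1)]; fact)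
    finally show False using mult[OF *(2,4)] id(3) by blast
  qed
  then have "ring_prime P"
    using id one by (auto simp: ring_prime_def)
  then show ?thesis using that id by blast
qed

section \<open>Finitely generated subalgebras and their filtration by degree\<close>

definition bounded_monomials :: "'r::comm_ring_1 set \<Rightarrow> nat \<Rightarrow> 'r set" where
  "bounded_monomials X D = {\<Prod>x\<in>X. x ^ e x | e. \<forall>x\<in>X. e x \<le> D}"

definition bounded_hull :: "'r::{comm_ring_1,real_algebra_1} set \<Rightarrow> nat \<Rightarrow> 'r set" where
  "bounded_hull X D = span (bounded_monomials X D)"

definition algebra_hull :: "'r::{comm_ring_1,real_algebra_1} set \<Rightarrow> 'r set" where
  "algebra_hull X = (\<Union>D. bounded_hull X D)"

text \<open>Each exponent is bounded separately, which makes the exponents a box with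
  \<open>(D + 1) ^ card X\<close> points. Different exponents may yield the same ring element, hence
  only an upper bound.\<close>

lemma bounded_monomials_card:
  assumes "finite X"
  shows "finite (bounded_monomials X D)" "card (bounded_monomials X D) \<le> (D + 1) ^ card X"
proof -
  have eq: "bounded_monomials X D = (\<lambda>e. \<Prod>x\<in>X. x ^ e x) ` (X \<rightarrow>\<^sub>E {..D})"
  proof
    show "bounded_monomials X D \<subseteq> (\<lambda>e. \<Prod>x\<in>X. x ^ e x) ` (X \<rightarrow>\<^sub>E {..D})"
    proof
      fix m assume "m \<in> bounded_monomials X D"
      then obtain e where e: "\<forall>x\<in>X. e x \<le> D" "m = (\<Prod>x\<in>X. x ^ e x)"
        by (auto simp: bounded_monomials_def)
      then have "m = (\<Prod>x\<in>X. x ^ restrict e X x)" by (auto intro: prod.cong)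
      moreover have "restrict e X \<in> X \<rightarrow>\<^sub>E {..D}" using e by auto
      ultimately show "m \<in> (\<lambda>e. \<Prod>x\<in>X. x ^ e x) ` (X \<rightarrow>\<^sub>E {..D})" by blast
    qed
  qed (auto simp: bounded_monomials_def PiE_iff)
  have fin: "finite (X \<rightarrow>\<^sub>E {..D})" using assms by (intro finite_PiE) auto
  show "finite (bounded_monomials X D)" using fin by (simp add: eq)
  have "card (bounded_monomials X D) \<le> card (X \<rightarrow>\<^sub>E {..D})" unfolding eq by (rule card_image_le[OF fin])
  then show "card (bounded_monomials X D) \<le> (D + 1) ^ card X"
    using assms by (simp add: card_PiE)
qed

lemma bounded_monomials_mult:
  "a \<in> bounded_monomials X D \<Longrightarrow> b \<in> bounded_monomials X E \<Longrightarrow> a * b \<in> bounded_monomials X (D + E)"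
proof -
  assume "a \<in> bounded_monomials X D" "b \<in> bounded_monomials X E"
  then obtain e f where "\<forall>x\<in>X. e x \<le> D" "a = (\<Prod>x\<in>X. x ^ e x)" "\<forall>x\<in>X. f x \<le> E" "b = (\<Prod>x\<in>X. x ^ f x)"
    by (auto simp: bounded_monomials_def)
  then show ?thesis
    unfolding bounded_monomials_def
    by (intro CollectI exI[of _ "\<lambda>x. e x + f x"]) (auto simp: power_add prod.distrib intro: add_mono)
qed

lemma bounded_monomials_mono: "D \<le> E \<Longrightarrow> bounded_monomials X D \<subseteq> bounded_monomials X E"
  unfolding bounded_monomials_def by (auto intro: order_trans)

lemma bounded_monomials_mono_set:
  assumes "X \<subseteq> Y" "finite Y"
  shows "bounded_monomials X D \<subseteq> bounded_monomials Y D"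
proof
  fix m assume "m \<in> bounded_monomials X D"
  then obtain e where e: "\<forall>x\<in>X. e x \<le> D" "m = (\<Prod>x\<in>X. x ^ e x)"
    by (auto simp: bounded_monomials_def)
  have "m = (\<Prod>x\<in>Y. x ^ (if x \<in> X then e x else 0))"
    unfolding e(2) using assms by (intro prod.mono_neutral_cong_left) auto
  then show "m \<in> bounded_monomials Y D"
    unfolding bounded_monomials_def using e
    by (intro CollectI exI[of _ "\<lambda>x. if x \<in> X then e x else 0"]) auto
qed

lemma bounded_hull_mono: "D \<le> E \<Longrightarrow> bounded_hull X D \<subseteq> bounded_hull X E"
  unfolding bounded_hull_def by (intro span_mono bounded_monomials_mono)

lemma bounded_hull_mono_set: "X \<subseteq> Y \<Longrightarrow> finite Y \<Longrightarrow> bounded_hull X D \<subseteq> bounded_hull Y D"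
  unfolding bounded_hull_def by (intro span_mono bounded_monomials_mono_set)

lemma span_mult:
  fixes a b :: "'r::real_algebra"
  assumes "a \<in> span A" "b \<in> span B" "\<And>x y. x \<in> A \<Longrightarrow> y \<in> B \<Longrightarrow> x * y \<in> span C"
  shows "a * b \<in> span C"
  using assms(1)
proof (induction a rule: span_induct_alt)
  case (step c x y)
  have "x * b \<in> span C"
    using assms(2)
  proof (induction b rule: span_induct_alt)
    case (step d u v)
    then show ?case using assms(3)[OF \<open>x \<in> A\<close>]
      by (simp add: distrib_left span_add span_scale)
  qed (simp add: span_zero)
  then show ?case using step by (simp add: distrib_right span_add span_scale)
qed (simp add: span_zero)

lemma bounded_hull_mult:
  "a \<in> bounded_hull X D \<Longrightarrow> b \<in> bounded_hull X E \<Longrightarrow> a * b \<in> bounded_hull X (D + E)"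
  unfolding bounded_hull_def
  by (erule span_mult, assumption) (intro span_base bounded_monomials_mult)

lemma bounded_hull_closed:
  "0 \<in> bounded_hull X D"
  "a \<in> bounded_hull X D \<Longrightarrow> b \<in> bounded_hull X D \<Longrightarrow> a + b \<in> bounded_hull X D"
  "a \<in> bounded_hull X D \<Longrightarrow> c *\<^sub>R a \<in> bounded_hull X D"
  unfolding bounded_hull_def by (auto intro: span_add span_scale span_zero)

lemma one_in_bounded_hull: "1 \<in> bounded_hull X D"
proof -
  have "(\<Prod>x\<in>X. x ^ 0) \<in> bounded_monomials X D" unfolding bounded_monomials_def by force
  then show ?thesis by (simp add: bounded_hull_def span_base)
qed

lemma generator_in_bounded_hull:
  assumes "finite X" "x \<in> X" "k \<le> D"
  shows "x ^ k \<in> bounded_hull X D"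
proof -
  have "x ^ k = (\<Prod>y\<in>X. y ^ (if y = x then k else 0))"
    using assms by (subst prod.remove[of _ x]) auto
  then have "x ^ k \<in> bounded_monomials X D" unfolding bounded_monomials_def using assms
    by (intro CollectI exI[of _ "\<lambda>y. if y = x then k else 0"]) auto
  then show ?thesis by (simp add: bounded_hull_def span_base)
qed

lemma bounded_hull_power: "a \<in> bounded_hull X D \<Longrightarrow> a ^ n \<in> bounded_hull X (n * D)"
proof (induction n)
  case (Suc n)
  then show ?case using bounded_hull_mult[of a X D "a ^ n" "n * D"] by simp
qed (simp add: one_in_bounded_hull)

lemma bounded_hull_prod:
  "finite A \<Longrightarrow> (\<And>i. i \<in> A \<Longrightarrow> f i \<in> bounded_hull X D) \<Longrightarrow> (\<Prod>i\<in>A. f i) \<in> bounded_hull X (card A * D)"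
proof (induction A rule: finite_induct)
  case (insert i A)
  then have "f i * (\<Prod>j\<in>A. f j) \<in> bounded_hull X (D + card A * D)"
    by (intro bounded_hull_mult) auto
  then show ?case using insert by simp
qed (simp add: one_in_bounded_hull)

lemma algebra_hullE2:
  assumes "a \<in> algebra_hull X" "b \<in> algebra_hull X"
  obtains D where "a \<in> bounded_hull X D" "b \<in> bounded_hull X D"
proof -
  obtain D E where "a \<in> bounded_hull X D" "b \<in> bounded_hull X E"
    using assms by (auto simp: algebra_hull_def)
  then show ?thesis
    using that[of "max D E"] bounded_hull_mono[of D "max D E" X] bounded_hull_mono[of E "max D E" X]
    by auto
qed

lemma algebra_hull_closed:
  "0 \<in> algebra_hull X"
  "1 \<in> algebra_hull X"
  "a \<in> algebra_hull X \<Longrightarrow> b \<in> algebra_hull X \<Longrightarrow> a + b \<in> algebra_hull X"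
  "a \<in> algebra_hull X \<Longrightarrow> b \<in> algebra_hull X \<Longrightarrow> a * b \<in> algebra_hull X"
  "a \<in> algebra_hull X \<Longrightarrow> c *\<^sub>R a \<in> algebra_hull X"
  "of_real c \<in> algebra_hull X"
  "a \<in> algebra_hull X \<Longrightarrow> - a \<in> algebra_hull X"
  "a \<in> algebra_hull X \<Longrightarrow> b \<in> algebra_hull X \<Longrightarrow> a - b \<in> algebra_hull X"
  "a \<in> algebra_hull X \<Longrightarrow> a ^ n \<in> algebra_hull X"
proof -
  show "0 \<in> algebra_hull X" and one: "1 \<in> algebra_hull X"
    by (auto simp: algebra_hull_def bounded_hull_closed one_in_bounded_hull)
  show add: "a + b \<in> algebra_hull X" if ab: "a \<in> algebra_hull X" "b \<in> algebra_hull X" for a b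
  proof -
    obtain D where "a \<in> bounded_hull X D" "b \<in> bounded_hull X D" using algebra_hullE2[OF ab] .
    then show ?thesis using bounded_hull_closed(2)[of a X D b] by (auto simp: algebra_hull_def)
  qed
  show mult: "a * b \<in> algebra_hull X" if ab: "a \<in> algebra_hull X" "b \<in> algebra_hull X" for a b
  proof -
    obtain D where "a \<in> bounded_hull X D" "b \<in> bounded_hull X D" using algebra_hullE2[OF ab] .
    then show ?thesis using bounded_hull_mult[of a X D b D] by (auto simp: algebra_hull_def)
  qed
  show scale: "c *\<^sub>R a \<in> algebra_hull X" if "a \<in> algebra_hull X" for a c
    using that by (auto simp: algebra_hull_def intro: bounded_hull_closed)
  show "of_real c \<in> algebra_hull X" using scale[OF one] by (simp add: of_real_def)
  show neg: "- a \<in> algebra_hull X" if "a \<in> algebra_hull X" for a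
    using scale[OF that, of "-1"] by simp
  show "a - b \<in> algebra_hull X" if "a \<in> algebra_hull X" "b \<in> algebra_hull X" for a b
    using add[OF that(1) neg[OF that(2)]] by simp
  show "a ^ n \<in> algebra_hull X" if "a \<in> algebra_hull X"
    by (induction n) (auto simp: one mult that)
qed

lemma algebra_hull_sum: "(\<And>i. i \<in> A \<Longrightarrow> f i \<in> algebra_hull X) \<Longrightarrow> (\<Sum>i\<in>A. f i) \<in> algebra_hull X"
  by (induction A rule: infinite_finite_induct) (auto intro: algebra_hull_closed)

lemma algebra_hull_prod: "(\<And>i. i \<in> A \<Longrightarrow> f i \<in> algebra_hull X) \<Longrightarrow> (\<Prod>i\<in>A. f i) \<in> algebra_hull X"
  by (induction A rule: infinite_finite_induct) (auto intro: algebra_hull_closed)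

lemma algebra_hull_base: "finite X \<Longrightarrow> x \<in> X \<Longrightarrow> x \<in> algebra_hull X"
  using generator_in_bounded_hull[of X x 1 1] by (auto simp: algebra_hull_def)

lemma algebra_hull_mono: "X \<subseteq> Y \<Longrightarrow> finite Y \<Longrightarrow> algebra_hull X \<subseteq> algebra_hull Y"
  unfolding algebra_hull_def using bounded_hull_mono_set by blast

text \<open>The relation is between indices. A family that repeats a vector has the relation
  \<open>v i - v j = 0\<close>; an injective family has a dependent image, by comparison of
  cardinalities.\<close>

lemma linear_relation_exists:
  fixes v :: "'i \<Rightarrow> 'b::real_vector"
  assumes "finite I" "finite B" "card B < card I" "\<And>i. i \<in> I \<Longrightarrow> v i \<in> span B"
  obtains c where "\<exists>i\<in>I. c i \<noteq> 0" "(\<Sum>i\<in>I. c i *\<^sub>R v i) = 0"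
proof (cases "inj_on v I")
  case True
  then have "card (v ` I) = card I" by (simp add: card_image)
  then have "dependent (v ` I)"
    using independent_span_bound[OF assms(2), of "v ` I"] assms(3,4) by (metis image_subset_iff not_less)
  then obtain u where u: "\<exists>x\<in>v ` I. u x \<noteq> 0" "(\<Sum>x\<in>v ` I. u x *\<^sub>R x) = 0"
    using dependent_finite[of "v ` I"] assms(1) by auto
  have "(\<Sum>i\<in>I. u (v i) *\<^sub>R v i) = 0"
    using u(2) True by (simp add: sum.reindex o_def)
  then show ?thesis using that[of "\<lambda>i. u (v i)"] u(1) by blast
next
  case False
  then obtain i j where ij: "i \<in> I" "j \<in> I" "v i = v j" "i \<noteq> j" by (auto simp: inj_on_def)
  have "(\<Sum>k\<in>I. (if k = i then 1 else if k = j then - 1 else 0 :: real) *\<^sub>R v k)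
      = (\<Sum>k\<in>I. (if k = i then v i else 0) - (if k = j then v i else 0))"
    using ij by (intro sum.cong) auto
  also have "\<dots> = 0" using ij assms(1) by (simp add: sum_subtractf)
  finally show ?thesis
    using ij(1) by (intro that[of "\<lambda>k. if k = i then 1 else if k = j then - 1 else 0"] bexI[of _ i]) auto
qed

section \<open>Prime chains from algebraically independent elements\<close>

text \<open>For a prime P and a subalgebra A this says that the class of f modulo P is
  transcendental over the fraction field of the image of A.\<close>

definition transcendental_over :: "'r::comm_ring_1 set \<Rightarrow> 'r set \<Rightarrow> 'r \<Rightarrow> bool" where
  "transcendental_over A P f \<longleftrightarrow>
     (\<forall>n c. (\<forall>i\<le>n. c i \<in> A) \<and> (\<Sum>i\<le>n. c i * f ^ i) \<in> P \<longrightarrow> (\<forall>i\<le>n. c i \<in> P))"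

text \<open>Each element is transcendental over the algebra of the later ones, so that the head can
  be removed in an induction without affecting the tail.\<close>

fun independent_mod :: "'r::{comm_ring_1,real_algebra_1} set \<Rightarrow> 'r list \<Rightarrow> bool" where
  "independent_mod P [] \<longleftrightarrow> True"
| "independent_mod P (f # fs) \<longleftrightarrow>
     transcendental_over (algebra_hull (set fs)) P f \<and> independent_mod P fs"

lemma transcendental_overD:
  "transcendental_over A P f \<Longrightarrow> (\<And>i. i \<le> n \<Longrightarrow> c i \<in> A) \<Longrightarrow> (\<Sum>i\<le>n. c i * f ^ i) \<in> P
    \<Longrightarrow> i \<le> n \<Longrightarrow> c i \<in> P"
  unfolding transcendental_over_def by metis

text \<open>A relation for f over A is itself an element of A', and on A' the ideals Q and P agree.
  So a relation modulo Q is already one modulo P.\<close>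

lemma transcendental_over_enlarge:
  assumes "transcendental_over A P f" "f \<in> A'" "A \<subseteq> A'" "P \<subseteq> Q" "Q \<inter> A' \<subseteq> P"
    and "\<And>x y. x \<in> A' \<Longrightarrow> y \<in> A' \<Longrightarrow> x + y \<in> A'" "\<And>x y. x \<in> A' \<Longrightarrow> y \<in> A' \<Longrightarrow> x * y \<in> A'" "1 \<in> A'"
  shows "transcendental_over A Q f"
  unfolding transcendental_over_def
proof (intro allI impI; elim conjE)
  fix n c i assume c: "\<forall>i\<le>n. c i \<in> A" "(\<Sum>i\<le>n. c i * f ^ i) \<in> Q" and i: "i \<le> n"
  have pow: "f ^ k \<in> A'" for k by (induction k) (simp_all add: assms(2,7,8))
  have "(\<Sum>i\<le>m. c i * f ^ i) \<in> A'" if "m \<le> n" for m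
    using that
  proof (induction m)
    case 0
    then have "c 0 \<in> A'" using assms(3) c(1) by blast
    then show ?case by simp
  next
    case (Suc m)
    then have "c (Suc m) * f ^ Suc m \<in> A'" using assms(3) c(1) by (intro assms(7) pow) blast
    then show ?case using Suc by (simp add: assms(6) del: power_Suc)
  qed
  then have "(\<Sum>i\<le>n. c i * f ^ i) \<in> P" using c(2) assms(5) by blast
  then have "c i \<in> P" using transcendental_overD[OF assms(1), where c = c and n = n] c(1) i by simp
  then show "c i \<in> Q" using assms(4) by blast
qed

lemma independent_mod_enlarge:
  "independent_mod P fs \<Longrightarrow> P \<subseteq> Q \<Longrightarrow> Q \<inter> algebra_hull (set fs) \<subseteq> P \<Longrightarrow> independent_mod Q fs"
proof (induction fs)
  case (Cons f fs)
  have sub: "algebra_hull (set fs) \<subseteq> algebra_hull (set (f # fs))"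
    by (rule algebra_hull_mono) auto
  then have "Q \<inter> algebra_hull (set fs) \<subseteq> P" using Cons.prems(3) by blast
  moreover have "independent_mod P fs" and tr: "transcendental_over (algebra_hull (set fs)) P f"
    using Cons.prems(1) by auto
  ultimately have "independent_mod Q fs" using Cons.IH Cons.prems(2) by blast
  moreover have "transcendental_over (algebra_hull (set fs)) Q f"
  proof (rule transcendental_over_enlarge[OF tr _ sub Cons.prems(2,3)])
    show "f \<in> algebra_hull (set (f # fs))" by (rule algebra_hull_base) auto
  qed (fact algebra_hull_closed)+
  ultimately show ?case by simp
qed simp

text \<open>All coefficients of p lie in P. This turns a relation at f into information about the
  value at any other point, which can be chosen to isolate one term.\<close>

lemma transcendental_over_poly:
  assumes "transcendental_over A P f" "ring_ideal P" "\<And>i. coeff p i \<in> A" "poly p f \<in> P"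
  shows "poly p x \<in> P"
proof -
  have "(\<Sum>i\<le>degree p. coeff p i * f ^ i) \<in> P" using assms(4) by (simp add: poly_altdef)
  then have "coeff p i \<in> P" if "i \<le> degree p" for i
    using transcendental_overD[OF assms(1), where c = "coeff p" and n = "degree p"] assms(3) that
    by blast
  then show ?thesis
    unfolding poly_altdef by (intro ring_ideal_sum[OF assms(2)] ring_idealD(4)[OF assms(2)]) auto
qed

lemma coeff_mult_in_hull:
  assumes "\<And>i. coeff p i \<in> algebra_hull X" "\<And>i. coeff q i \<in> algebra_hull X"
  shows "coeff (p * q) i \<in> algebra_hull X"
  unfolding coeff_mult using assms by (intro algebra_hull_sum algebra_hull_closed)

lemma coeff_prod_in_hull:
  assumes "\<And>j i. coeff (p j) i \<in> algebra_hull X"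
  shows "coeff (\<Prod>j\<in>J. p j) i \<in> algebra_hull X"
proof (induction J arbitrary: i rule: infinite_finite_induct)
  case (insert j J)
  then show ?case using assms by (simp add: coeff_mult_in_hull)
qed (auto simp: coeff_1 algebra_hull_closed)

text \<open>If no such \<open>Q\<close> existed, every \<open>f - c\<close> with \<open>c\<close> real would divide, modulo \<open>P\<close>, some \<open>s\<^sub>c\<close>
  in \<open>A - P\<close>, where \<open>A = algebra_hull X\<close>. Uncountably many quotients cannot be linearly independent
  in a ring of countable dimension, and a linear relation among them, with denominators cleared,
  is an algebraic relation for \<open>f\<close> over \<open>A\<close>.\<close>

lemma larger_prime_exists:
  fixes P X0 :: "'r::{comm_ring_1,real_algebra_1} set"
  assumes P: "ring_prime P" and X0: "finite X0" "algebra_hull X0 = UNIV"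
    and transc: "transcendental_over (algebra_hull X) P f"
  obtains Q where "ring_prime Q" "P \<subset> Q" "Q \<inter> algebra_hull X \<subseteq> P"
proof (rule ccontr)
  assume "\<not> thesis"
  then have no: "\<not> (Q \<inter> algebra_hull X \<subseteq> P)" if "ring_prime Q" "P \<subset> Q" for Q
    using that \<open>\<And>Q. ring_prime Q \<Longrightarrow> P \<subset> Q \<Longrightarrow> Q \<inter> algebra_hull X \<subseteq> P \<Longrightarrow> thesis\<close> by blast
  define A where "A = algebra_hull X"
  have id: "ring_ideal P" using P by (rule ring_primeD)
  \<comment> \<open>Otherwise the ideal P + (b) misses the multiplicative set A - P, and a prime
    over it that still misses A - P is a larger prime of the excluded kind.\<close>
  have divides: "\<exists>r s. s \<in> A - P \<and> s - r * b \<in> P" if b: "b \<notin> P" for b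
  proof (rule ccontr)
    assume "\<not> ?thesis"
    then have *: "\<forall>s r. \<not> (s \<in> A - P \<and> s - r * b \<in> P)" by blast
    define J where "J = {x + r * b | x r. x \<in> P}"
    have disj: "J \<inter> (A - P) = {}"
    proof (rule ccontr)
      assume "J \<inter> (A - P) \<noteq> {}"
      then obtain x r where "x \<in> P" "x + r * b \<in> A - P" by (auto simp: J_def)
      then show False using *[rule_format, of "x + r * b" r] by simp
    qed
    have Jid: "ring_ideal J" unfolding J_def by (rule ring_ideal_extend[OF id])
    have "1 \<in> A - P" "\<And>x y. x \<in> A - P \<Longrightarrow> y \<in> A - P \<Longrightarrow> x * y \<in> A - P"
      using ring_primeD(2,3)[OF P] by (auto simp: A_def algebra_hull_closed)
    from prime_avoiding_exists[OF Jid disj this]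
    obtain Q where Q: "ring_prime Q" "J \<subseteq> Q" "Q \<inter> (A - P) = {}" .
    have "P \<subseteq> J"
    proof
      fix x assume "x \<in> P"
      then show "x \<in> J" unfolding J_def by (intro CollectI exI[of _ x] exI[of _ 0]) simp
    qed
    moreover have "b \<in> J"
      unfolding J_def using ring_idealD(1)[OF id] by (intro CollectI exI[of _ 0] exI[of _ 1]) simp
    ultimately have "P \<subset> Q" using Q(2) b by blast
    moreover have "Q \<inter> algebra_hull X \<subseteq> P" using Q(3) by (auto simp: A_def)
    ultimately show False using no[OF Q(1)] by blast
  qed
  \<comment> \<open>If it did lie in P, the polynomial X - c would be a relation for f; its value at
    \<open>1 + c\<close> is 1, which would then lie in P.\<close>
  have "f - of_real c \<notin> P" for c
  proof
    assume "f - of_real c \<in> P"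
    then have "poly [:- of_real c, 1:] f \<in> P" by simp
    then have "poly [:- of_real c, 1:] (1 + of_real c) \<in> P"
      by (rule transcendental_over_poly[OF transc id, rotated])
        (auto simp: coeff_pCons split: nat.split intro: algebra_hull_closed)
    then show False using ring_primeD(2)[OF P] by simp
  qed
  then have "\<forall>c. \<exists>r s. s \<in> A - P \<and> s - r * (f - of_real c) \<in> P" using divides by blast
  then obtain r s where rs: "\<And>c. s c \<in> A" "\<And>c. s c \<notin> P" "\<And>c. s c - r c * (f - of_real c) \<in> P"
    unfolding choice_iff by blast
  \<comment> \<open>The whole ring is a countable union of the spaces
    \<open>bounded_hull X0 D\<close>, and there are uncountably many c. So one finite-dimensional
    space contains \<open>r c\<close> for infinitely many c.\<close>
  have "\<exists>D. infinite {c :: real. r c \<in> bounded_hull X0 D}"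
  proof (rule ccontr)
    assume "\<not> ?thesis"
    then have "countable (\<Union>D. {c :: real. r c \<in> bounded_hull X0 D})"
      by (intro countable_UN[OF countableI_type] countable_finite) auto
    moreover have "(\<Union>D. {c :: real. r c \<in> bounded_hull X0 D}) = UNIV"
      using X0(2) unfolding algebra_hull_def by blast
    ultimately show False using uncountable_UNIV_real by simp
  qed
  then obtain D where "infinite {c :: real. r c \<in> bounded_hull X0 D}" by blast
  then obtain C where C: "C \<subseteq> {c :: real. r c \<in> bounded_hull X0 D}" "finite C"
      "card C = Suc (card (bounded_monomials X0 D))"
    using infinite_arbitrarily_large by blast
  then have "card (bounded_monomials X0 D) < card C"
    "\<And>c. c \<in> C \<Longrightarrow> r c \<in> span (bounded_monomials X0 D)"
    by (auto simp: bounded_hull_def)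
  from linear_relation_exists[OF C(2) bounded_monomials_card(1)[OF X0(1)] this]
  obtain \<alpha> where \<alpha>: "\<exists>c\<in>C. \<alpha> c \<noteq> 0" "(\<Sum>c\<in>C. \<alpha> c *\<^sub>R r c) = 0" .
  obtain c0 where c0: "c0 \<in> C" "\<alpha> c0 \<noteq> 0" using \<alpha>(1) by blast
  \<comment> \<open>Modulo P, \<open>r c\<close> is the quotient of \<open>s c\<close> by f - c. F
    is the linear relation among these quotients, multiplied by the product of all X - j and with f
    replaced by a variable X.\<close>
  define F where "F = (\<Sum>c\<in>C. smult (\<alpha> c *\<^sub>R s c) (\<Prod>j\<in>C - {c}. [:- of_real j, 1:]))"
  have polyF: "poly F x = (\<Sum>c\<in>C. (\<alpha> c *\<^sub>R s c) * (\<Prod>j\<in>C - {c}. x - of_real j))" for x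
    by (simp add: F_def poly_sum poly_prod)
  have "poly F f - (\<Sum>c\<in>C. \<alpha> c *\<^sub>R r c) * (\<Prod>j\<in>C. f - of_real j)
      = (\<Sum>c\<in>C. (\<alpha> c *\<^sub>R (s c - r c * (f - of_real c))) * (\<Prod>j\<in>C - {c}. f - of_real j))"
  proof -
    have "(\<Prod>j\<in>C. f - of_real j) = (f - of_real c) * (\<Prod>j\<in>C - {c}. f - of_real j)" if "c \<in> C" for c
      using that C(2) by (simp add: prod.remove)
    then have "(\<Sum>c\<in>C. \<alpha> c *\<^sub>R r c) * (\<Prod>j\<in>C. f - of_real j)
        = (\<Sum>c\<in>C. (\<alpha> c *\<^sub>R (r c * (f - of_real c))) * (\<Prod>j\<in>C - {c}. f - of_real j))"
      unfolding sum_distrib_right by (intro sum.cong) (auto simp: mult.assoc)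
    then show ?thesis
      unfolding polyF by (simp add: sum_subtractf[symmetric] left_diff_distrib[symmetric]
          scaleR_diff_right[symmetric] del: mult_scaleR_left)
  qed
  also have "\<dots> \<in> P"
  proof (intro ring_ideal_sum[OF id] ring_idealD(4)[OF id])
    fix c
    have "of_real (\<alpha> c) * (s c - r c * (f - of_real c)) \<in> P" by (intro ring_idealD(3)[OF id] rs)
    then show "\<alpha> c *\<^sub>R (s c - r c * (f - of_real c)) \<in> P" by (simp add: scaleR_conv_of_real)
  qed
  finally have "poly F f \<in> P" using \<alpha>(2) by simp
  moreover have "coeff F i \<in> algebra_hull X" for i
  proof -
    have "coeff [:- of_real j, 1:] k \<in> algebra_hull X" for j k
      by (auto simp: coeff_pCons split: nat.split intro: algebra_hull_closed)
    then show ?thesis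
      unfolding F_def coeff_sum coeff_smult using rs(1)
      by (intro algebra_hull_sum algebra_hull_closed coeff_prod_in_hull) (auto simp: A_def)
  qed
  \<comment> \<open>At the node \<open>c0\<close> every summand of F except the one for
    \<open>c0\<close> contains a zero factor. The remaining one is a product of \<open>s c0\<close>
    and nonzero constants, none of which lies in P.\<close>
  ultimately have "poly F (of_real c0) \<in> P"
    using transcendental_over_poly[OF transc id, of F] by blast
  also have "poly F (of_real c0)
      = (\<Sum>c\<in>C. if c = c0 then (\<alpha> c0 *\<^sub>R s c0) * (\<Prod>j\<in>C - {c0}. of_real c0 - of_real j) else 0)"
    unfolding polyF
  proof (intro sum.cong refl)
    fix c assume "c \<in> C"
    show "(\<alpha> c *\<^sub>R s c) * (\<Prod>j\<in>C - {c}. of_real c0 - of_real j)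
        = (if c = c0 then (\<alpha> c0 *\<^sub>R s c0) * (\<Prod>j\<in>C - {c0}. of_real c0 - of_real j) else 0)"
    proof (cases "c = c0")
      case False
      then have "(\<Prod>j\<in>C - {c}. of_real c0 - of_real j) = (0 :: 'r)"
        using c0(1) C(2) by (intro prod_zero) auto
      then show ?thesis using False by simp
    qed simp
  qed
  also have "\<dots> = of_real (\<alpha> c0) * s c0 * of_real (\<Prod>j\<in>C - {c0}. c0 - j)"
    using C(2) c0(1) by (simp add: scaleR_conv_of_real)
  finally have "of_real (\<alpha> c0) \<in> P \<or> s c0 \<in> P \<or> of_real (\<Prod>j\<in>C - {c0}. c0 - j) \<in> P"
    by (simp only: ring_primeD(3)[OF P] disj_assoc)
  moreover have "(\<Prod>j\<in>C - {c0}. c0 - j) \<noteq> 0" using C(2) by simp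
  ultimately show False
    using ring_prime_of_real[OF P] rs(2) c0(2) by blast
qed

text \<open>Each independent element pays for one strict inclusion. The larger prime Q acquires no
  new element of the algebra generated by the remaining ones, so these stay independent modulo
  Q.\<close>

theorem prime_chain_of_independent:
  fixes P X :: "'r::{comm_ring_1,real_algebra_1} set"
  assumes "ring_prime P" "finite X" "algebra_hull X = UNIV" "independent_mod P fs"
  shows "\<exists>\<P>. \<P> 0 = P \<and> (\<forall>i\<le>length fs. ring_prime (\<P> i)) \<and> (\<forall>i<length fs. \<P> i \<subset> \<P> (Suc i))"
  using assms(1,4)
proof (induction fs arbitrary: P)
  case Nil
  then show ?case by (intro exI[of _ "\<lambda>_. P"]) auto
next
  case (Cons f fs)
  have "transcendental_over (algebra_hull (set fs)) P f" and ind: "independent_mod P fs"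
    using Cons.prems(2) by auto
  from larger_prime_exists[OF Cons.prems(1) assms(2,3) this(1)]
  obtain Q where Q: "ring_prime Q" "P \<subset> Q" "Q \<inter> algebra_hull (set fs) \<subseteq> P" .
  have "independent_mod Q fs"
    using independent_mod_enlarge[OF ind _ Q(3)] Q(2) by blast
  then obtain \<P> where \<P>: "\<P> 0 = Q" "\<forall>i\<le>length fs. ring_prime (\<P> i)"
      "\<forall>i<length fs. \<P> i \<subset> \<P> (Suc i)"
    using Cons.IH[OF Q(1)] by blast
  have "ring_prime (case_nat P \<P> i)" if "i \<le> length (f # fs)" for i
    using that \<P>(2) Cons.prems(1) by (cases i) auto
  moreover have "case_nat P \<P> i \<subset> case_nat P \<P> (Suc i)" if "i < length (f # fs)" for i
    using that \<P>(1,3) Q(2) by (cases i) auto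
  ultimately show ?case by (intro exI[of _ "case_nat P \<P>"]) simp
qed

section \<open>Counting independent elements\<close>

text \<open>Top coefficients in P are discarded, so that the leading one is nonzero modulo P and can
  serve as a denominator. The degree is then positive, since a constant relation would put its own
  coefficient into P. A common \<open>d\<close> bounds the degrees of all coefficients.\<close>

lemma algebraic_relation:
  fixes P B :: "'r::{comm_ring_1,real_algebra_1} set"
  assumes P: "ring_prime P" and "\<not> transcendental_over (algebra_hull B) P y"
  obtains m c d where "0 < m" "c m \<notin> P" "\<And>i. i \<le> m \<Longrightarrow> c i \<in> bounded_hull B d"
    "(\<Sum>i\<le>m. c i * y ^ i) \<in> P"
proof -
  have id: "ring_ideal P" using P by (rule ring_primeD)
  obtain n c where c: "\<And>i. i \<le> n \<Longrightarrow> c i \<in> algebra_hull B" "(\<Sum>i\<le>n. c i * y ^ i) \<in> P"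
    and ex: "\<exists>i\<le>n. c i \<notin> P"
    using assms(2) unfolding transcendental_over_def by blast
  define m where "m = Max {i. i \<le> n \<and> c i \<notin> P}"
  have fin: "finite {i. i \<le> n \<and> c i \<notin> P}" by simp
  have m: "m \<le> n" "c m \<notin> P"
    using Max_in[OF fin] ex unfolding m_def by blast+
  have above: "c i \<in> P" if "m < i" "i \<le> n" for i
  proof (rule ccontr)
    assume "c i \<notin> P"
    then have "i \<le> m" unfolding m_def using that by (intro Max_ge[OF fin]) simp
    then show False using that by simp
  qed
  have "(\<Sum>i\<le>n. c i * y ^ i) = (\<Sum>i\<le>m. c i * y ^ i) + (\<Sum>i\<in>{m<..n}. c i * y ^ i)"
    unfolding ivl_disj_un_one(3)[OF m(1), symmetric] by (intro sum.union_disjoint) auto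
  moreover have "(\<Sum>i\<in>{m<..n}. c i * y ^ i) \<in> P"
    using above by (intro ring_ideal_sum[OF id] ring_idealD(4)[OF id]) auto
  ultimately have rel: "(\<Sum>i\<le>m. c i * y ^ i) \<in> P"
    using c(2) ring_ideal_cong[OF id] by (metis add_diff_cancel_left')
  have "m \<noteq> 0" using rel m(2) by (intro notI) simp
  have "\<exists>d. c i \<in> bounded_hull B d" if "i \<le> m" for i
    using c(1)[of i] m(1) that by (auto simp: algebra_hull_def)
  then obtain d where d: "\<And>i. i \<le> m \<Longrightarrow> c i \<in> bounded_hull B (d i)" by metis
  have "c i \<in> bounded_hull B (\<Sum>i\<le>m. d i)" if "i \<le> m" for i
  proof -
    have "d i \<le> (\<Sum>i\<le>m. d i)" using that by (intro member_le_sum) auto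
    then show ?thesis using d[OF that] bounded_hull_mono by blast
  qed
  then show thesis using that[OF _ m(2) _ rel] \<open>m \<noteq> 0\<close> by blast
qed

text \<open>Division by the relation when its leading coefficient is not invertible: every step
  multiplies by \<open>c m\<close> once, which raises the degree of the coefficients by
  \<open>d\<close>.\<close>

lemma power_reduction:
  fixes P B :: "'r::{comm_ring_1,real_algebra_1} set"
  assumes id: "ring_ideal P" and m: "0 < m" and c: "\<And>i. i \<le> m \<Longrightarrow> c i \<in> bounded_hull B d"
    and rel: "(\<Sum>i\<le>m. c i * y ^ i) \<in> P"
  shows "\<exists>r. (\<forall>i<m. r i \<in> bounded_hull B (j * d)) \<and> c m ^ j * y ^ j - (\<Sum>i<m. r i * y ^ i) \<in> P"
proof (induction j)
  case 0
  have "(\<Sum>i<m. (if i = 0 then 1 else 0) * y ^ i) = (\<Sum>i<m. if i = 0 then 1 else 0)"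
    by (intro sum.cong) auto
  also have "\<dots> = 1" using m by simp
  finally show ?case
    using ring_idealD(1)[OF id]
    by (intro exI[of _ "\<lambda>i. if i = 0 then 1 else 0"]) (auto simp: one_in_bounded_hull bounded_hull_closed)
next
  case (Suc j)
  then obtain r where r: "\<And>i. i < m \<Longrightarrow> r i \<in> bounded_hull B (j * d)"
    "c m ^ j * y ^ j - (\<Sum>i<m. r i * y ^ i) \<in> P" by blast
  obtain k where k: "m = Suc k" using m by (cases m) auto
  \<comment> \<open>Multiplication by \<open>c m * y\<close> shifts the coefficients by one. The
    overflow \<open>r k * c m * y ^ m\<close> is then replaced, by the relation, with
    \<open>- r k\<close> times the lower terms.\<close>
  define r' where "r' = (\<lambda>i. (if i = 0 then 0 else c m * r (i - 1)) + (- 1) *\<^sub>R (r k * c i))"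
  have "r' i \<in> bounded_hull B (Suc j * d)" if "i < m" for i
  proof -
    have "r k * c i \<in> bounded_hull B (Suc j * d)"
      using bounded_hull_mult[OF r(1)[of k] c[of i]] that k by (simp add: add.commute)
    moreover have "c m * r (i - 1) \<in> bounded_hull B (Suc j * d)" if "i \<noteq> 0"
      using bounded_hull_mult[OF c[of m] r(1)[of "i - 1"]] \<open>i < m\<close> by simp
    ultimately show ?thesis
      unfolding r'_def
      by (intro bounded_hull_closed(2) bounded_hull_closed(3)) (simp del: mult_Suc add: bounded_hull_closed(1))
  qed
  moreover have "c m ^ Suc j * y ^ Suc j - (\<Sum>i<m. r' i * y ^ i) \<in> P"
  proof -
    have "(\<Sum>i<m. r' i * y ^ i)
        = (\<Sum>i<m. (if i = 0 then 0 else c m * r (i - 1)) * y ^ i) - r k * (\<Sum>i<m. c i * y ^ i)"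
      by (simp add: r'_def distrib_right sum_distrib_left sum_subtractf algebra_simps)
    also have "(\<Sum>i<m. (if i = 0 then 0 else c m * r (i - 1)) * y ^ i) = (\<Sum>i<k. c m * r i * y ^ Suc i)"
      unfolding k by (subst sum.lessThan_Suc_shift) simp
    also have "\<dots> = c m * y * (\<Sum>i<m. r i * y ^ i) - r k * (c m * y ^ m)"
      unfolding k by (simp add: sum_distrib_left algebra_simps)
    also have "(\<Sum>i<m. c i * y ^ i) = (\<Sum>i\<le>m. c i * y ^ i) - c m * y ^ m"
      by (simp add: lessThan_Suc_atMost[symmetric])
    finally have "c m ^ Suc j * y ^ Suc j - (\<Sum>i<m. r' i * y ^ i)
        = (c m * y) * (c m ^ j * y ^ j - (\<Sum>i<m. r i * y ^ i)) + r k * (\<Sum>i\<le>m. c i * y ^ i)"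
      by (simp add: algebra_simps)
    also have "\<dots> \<in> P"
      by (intro ring_idealD(2)[OF id] ring_idealD(3)[OF id] r(2) rel)
    finally show ?thesis .
  qed
  ultimately show ?case by blast
qed

text \<open>Modulo P the element m belongs to the span of G divided by \<sigma>, written without
  fractions.\<close>

definition reducible_to :: "'r::{comm_ring_1,real_algebra_1} set \<Rightarrow> 'r \<Rightarrow> 'r set \<Rightarrow> 'r \<Rightarrow> bool" where
  "reducible_to P \<sigma> G m \<longleftrightarrow> (\<exists>u\<in>span G. \<sigma> * m - u \<in> P)"

lemma reducible_to_span:
  assumes id: "ring_ideal P" and M: "\<And>x. x \<in> M \<Longrightarrow> reducible_to P \<sigma> G x" and m: "m \<in> span M"
  shows "reducible_to P \<sigma> G m"
  using m
proof (induction m rule: span_induct_alt)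
  case base
  show ?case using ring_idealD(1)[OF id] by (auto simp: reducible_to_def span_zero intro!: bexI[of _ 0])
next
  case (step c x y)
  obtain u v where uv: "u \<in> span G" "\<sigma> * x - u \<in> P" "v \<in> span G" "\<sigma> * y - v \<in> P"
    using M[OF step(1)] step(2) by (auto simp: reducible_to_def)
  have "\<sigma> * (c *\<^sub>R x + y) - (c *\<^sub>R u + v) = of_real c * (\<sigma> * x - u) + (\<sigma> * y - v)"
    by (simp add: algebra_simps scaleR_conv_of_real)
  also have "\<dots> \<in> P" by (intro ring_idealD(2)[OF id] ring_idealD(3)[OF id] uv)
  finally show ?case using uv by (auto simp: reducible_to_def intro: span_add span_scale)
qed

text \<open>Elements algebraic over B do not change the order of growth: after a common denominator
  is cleared, every y in Y occurs only with boundedly many powers. The denominator and G may depend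
  on D, but K and \<kappa> may not.\<close>

lemma algebraic_reduction:
  fixes P B Y :: "'r::{comm_ring_1,real_algebra_1} set"
  assumes P: "ring_prime P" and B: "finite B" and Y: "finite Y"
    and alg: "\<And>y. y \<in> Y \<Longrightarrow> \<not> transcendental_over (algebra_hull B) P y"
  shows "\<exists>K \<kappa>. \<forall>D. \<exists>\<sigma> G. \<sigma> \<notin> P \<and> finite G \<and> card G \<le> K * (\<kappa> * D + 1) ^ card B \<and>
    (\<forall>m\<in>bounded_monomials (B \<union> Y) D. reducible_to P \<sigma> G m)"
  using Y alg
proof (induction Y rule: finite_induct)
  case empty
  show ?case
  proof (rule exI[of _ 1], rule exI[of _ 1], rule allI)
    fix D
    have "reducible_to P 1 (bounded_monomials B D) m" if "m \<in> bounded_monomials B D" for m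
      using that ring_idealD(1)[OF ring_primeD(1)[OF P]]
      by (auto simp: reducible_to_def intro!: bexI[of _ m] span_base)
    then show "\<exists>\<sigma> G. \<sigma> \<notin> P \<and> finite G \<and> card G \<le> 1 * (1 * D + 1) ^ card B \<and>
      (\<forall>m\<in>bounded_monomials (B \<union> {}) D. reducible_to P \<sigma> G m)"
      using bounded_monomials_card[OF B] ring_primeD(2)[OF P]
      by (intro exI[of _ 1] exI[of _ "bounded_monomials B D"]) simp
  qed
next
  case (insert y Y)
  have id: "ring_ideal P" using P by (rule ring_primeD)
  from insert.IH insert.prems obtain K \<kappa> where
    IH: "\<And>D. \<exists>\<sigma> G. \<sigma> \<notin> P \<and> finite G \<and> card G \<le> K * (\<kappa> * D + 1) ^ card B \<and>
    (\<forall>m\<in>bounded_monomials (B \<union> Y) D. reducible_to P \<sigma> G m)" by blast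
  show ?case
  proof (cases "y \<in> B \<union> Y")
    case True
    then have "B \<union> insert y Y = B \<union> Y" by blast
    then show ?thesis using IH by metis
  next
    case False
    obtain n c d where n: "0 < n" "c n \<notin> P" and c: "\<And>i. i \<le> n \<Longrightarrow> c i \<in> bounded_hull B d"
      and rel: "(\<Sum>i\<le>n. c i * y ^ i) \<in> P"
      using algebraic_relation[OF P, of B y] insert.prems by blast
    define s where "s = c n"
    show ?thesis
    \<comment> \<open>The n powers of y that survive give n copies of G. Clearing y multiplies by
      coefficients of total degree \<open>D * d\<close>, so the induction hypothesis is used at D +
      D * d = (d + 1) * D.\<close>
    proof (rule exI[of _ "K * n"], rule exI[of _ "\<kappa> * (d + 1)"], rule allI)
      fix D
      obtain \<sigma> G where G: "\<sigma> \<notin> P" "finite G" "card G \<le> K * (\<kappa> * (D + D * d) + 1) ^ card B"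
        "\<And>m. m \<in> bounded_monomials (B \<union> Y) (D + D * d) \<Longrightarrow> reducible_to P \<sigma> G m"
        using IH[of "D + D * d"] by blast
      define G' where "G' = (\<lambda>(g, i). g * y ^ i) ` (G \<times> {..<n})"
      have "card G' \<le> card (G \<times> {..<n})" unfolding G'_def using G(2) by (intro card_image_le) simp
      also have "\<dots> \<le> (K * (\<kappa> * (D + D * d) + 1) ^ card B) * n"
        using G(3) by (simp add: card_cartesian_product)
      finally have card: "card G' \<le> K * n * (\<kappa> * (d + 1) * D + 1) ^ card B"
        by (simp add: algebra_simps)
      have "reducible_to P (\<sigma> * s ^ D) G' m"
        if mon: "m \<in> bounded_monomials (B \<union> insert y Y) D" for m
      proof -
        obtain e where e: "\<forall>x\<in>B \<union> insert y Y. e x \<le> D" "m = (\<Prod>x\<in>B \<union> insert y Y. x ^ e x)"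
          using mon unfolding bounded_monomials_def by blast
        define m' where "m' = (\<Prod>x\<in>B \<union> Y. x ^ e x)"
        define j where "j = e y"
        have j: "j \<le> D" using e(1) by (simp add: j_def)
        have m: "m = m' * y ^ j"
          using False B insert.hyps(1) unfolding e(2) m'_def j_def by (simp add: mult.commute)
        have m': "m' \<in> bounded_hull (B \<union> Y) D"
          unfolding bounded_hull_def bounded_monomials_def m'_def using e(1)
          by (intro span_base CollectI exI[of _ e]) auto
        obtain r where r: "\<And>i. i < n \<Longrightarrow> r i \<in> bounded_hull B (j * d)"
          "s ^ j * y ^ j - (\<Sum>i<n. r i * y ^ i) \<in> P"
          using power_reduction[OF id n(1) c rel, of j] unfolding s_def by blast
        \<comment> \<open>Reducing \<open>y ^ j\<close> needs only the denominator
          \<open>s ^ j\<close>; the missing factor \<open>s ^ (D - j)\<close> makes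
          \<open>s ^ D\<close> a denominator common to all monomials.\<close>
        have "reducible_to P \<sigma> G (s ^ (D - j) * r i * m')" if i: "i < n" for i
        proof -
          have "s ^ (D - j) \<in> bounded_hull B ((D - j) * d)"
            unfolding s_def by (intro bounded_hull_power c) simp
          from bounded_hull_mult[OF this r(1)[OF i]]
          have "s ^ (D - j) * r i \<in> bounded_hull B (D * d)"
            using j by (simp add: add_mult_distrib[symmetric])
          then have "s ^ (D - j) * r i \<in> bounded_hull (B \<union> Y) (D * d)"
            using bounded_hull_mono_set[of B "B \<union> Y"] B insert.hyps(1) by blast
          from bounded_hull_mult[OF this m']
          have "s ^ (D - j) * r i * m' \<in> bounded_hull (B \<union> Y) (D + D * d)" by (simp add: add.commute)
          then show ?thesis
            using reducible_to_span[OF id G(4)] unfolding bounded_hull_def by blast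
        qed
        then obtain u where u: "\<And>i. i < n \<Longrightarrow> u i \<in> span G"
          "\<And>i. i < n \<Longrightarrow> \<sigma> * (s ^ (D - j) * r i * m') - u i \<in> P"
          unfolding reducible_to_def by metis
        have "(\<sigma> * s ^ D) * m - (\<Sum>i<n. u i * y ^ i)
          = (\<sigma> * s ^ (D - j) * m') * (s ^ j * y ^ j - (\<Sum>i<n. r i * y ^ i))
            + (\<Sum>i<n. (\<sigma> * (s ^ (D - j) * r i * m') - u i) * y ^ i)"
        proof -
          have "s ^ D = s ^ (D - j) * s ^ j" using j by (simp add: power_add[symmetric])
          then show ?thesis
            unfolding m by (simp add: algebra_simps sum_subtractf sum_distrib_left)
        qed
        also have "\<dots> \<in> P"
          using u(2) r(2)
          by (intro ring_idealD(2)[OF id] ring_ideal_sum[OF id])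
            (auto intro: ring_idealD(3)[OF id] ring_idealD(4)[OF id])
        finally have "(\<sigma> * s ^ D) * m - (\<Sum>i<n. u i * y ^ i) \<in> P" .
        moreover have "u i * y ^ i \<in> span G'" if i: "i < n" for i
        proof -
          have "y ^ i \<in> span {y ^ i}" by (simp add: span_base)
          then show ?thesis
            using i by (intro span_mult[OF u(1)[OF i]]) (auto simp: G'_def intro!: span_base)
        qed
        ultimately show ?thesis
          unfolding reducible_to_def by (intro bexI[of _ "\<Sum>i<n. u i * y ^ i"] span_sum) auto
      qed
      moreover have "\<sigma> * s ^ D \<notin> P"
        using G(1) n(2) ring_prime_power[OF P] by (auto simp: ring_primeD(3)[OF P] s_def)
      moreover have "finite G'" using G(2) by (simp add: G'_def)
      ultimately show "\<exists>\<sigma> G. \<sigma> \<notin> P \<and> finite G \<and> card G \<le> K * n * (\<kappa> * (d + 1) * D + 1) ^ card B \<and>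
          (\<forall>m\<in>bounded_monomials (B \<union> insert y Y) D. reducible_to P \<sigma> G m)"
        using card by blast
    qed
  qed
qed

text \<open>Compares the growth of the number of independent elements of degree \<open>D\<close>
  with that of the number of monomials in \<open>B\<close>.\<close>

theorem independent_count:
  fixes P B Y :: "'r::{comm_ring_1,real_algebra_1} set"
  assumes P: "ring_prime P" and B: "finite B" and Y: "finite Y"
    and alg: "\<And>y. y \<in> Y \<Longrightarrow> \<not> transcendental_over (algebra_hull B) P y"
    and I: "\<And>D. finite (I D)" "\<And>D. (D + 1) ^ n \<le> card (I D)"
    and g: "\<And>D i. i \<in> I D \<Longrightarrow> g D i \<in> bounded_hull (B \<union> Y) (k * D)"
    and indep: "\<And>D c. (\<Sum>i\<in>I D. c i *\<^sub>R g D i) \<in> P \<Longrightarrow> \<forall>i\<in>I D. c i = 0"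
  shows "n \<le> card B"
proof (rule ccontr)
  assume "\<not> n \<le> card B"
  then obtain l where l: "n = card B + Suc l" using less_imp_Suc_add by fastforce
  have id: "ring_ideal P" using P by (rule ring_primeD)
  obtain K \<kappa> where red: "\<And>D. \<exists>\<sigma> G. \<sigma> \<notin> P \<and> finite G \<and> card G \<le> K * (\<kappa> * D + 1) ^ card B \<and>
    (\<forall>m\<in>bounded_monomials (B \<union> Y) D. reducible_to P \<sigma> G m)"
    using algebraic_reduction[OF P B Y alg] by blast
  have bound: "(D + 1) ^ n \<le> K * (\<kappa> * (k * D) + 1) ^ card B" for D
  proof (rule ccontr)
    assume large: "\<not> ?thesis"
    obtain \<sigma> G where G: "\<sigma> \<notin> P" "finite G" "card G \<le> K * (\<kappa> * (k * D) + 1) ^ card B"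
      "\<And>m. m \<in> bounded_monomials (B \<union> Y) (k * D) \<Longrightarrow> reducible_to P \<sigma> G m"
      using red[of "k * D"] by blast
    have "reducible_to P \<sigma> G (g D i)" if "i \<in> I D" for i
      using reducible_to_span[OF id G(4)] g[OF that] unfolding bounded_hull_def by blast
    then obtain u where u: "\<And>i. i \<in> I D \<Longrightarrow> u i \<in> span G" "\<And>i. i \<in> I D \<Longrightarrow> \<sigma> * g D i - u i \<in> P"
      unfolding reducible_to_def by metis
    have "card G < card (I D)" using large G(3) I(2)[of D] by linarith
    from linear_relation_exists[where v = u, OF I(1) G(2) this u(1)]
    obtain c where c: "\<exists>i\<in>I D. c i \<noteq> 0" "(\<Sum>i\<in>I D. c i *\<^sub>R u i) = 0" by blast
    \<comment> \<open>A relation among the reductions \<open>u i\<close> becomes one among the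
      \<open>g D i\<close> multiplied by \<sigma>, and primality of P cancels \<sigma>.\<close>
    have "(\<Sum>i\<in>I D. of_real (c i) * (\<sigma> * g D i - u i)) \<in> P"
      by (intro ring_ideal_sum[OF id] ring_idealD(3)[OF id] u(2))
    also have "(\<Sum>i\<in>I D. of_real (c i) * (\<sigma> * g D i - u i))
        = \<sigma> * (\<Sum>i\<in>I D. c i *\<^sub>R g D i) - (\<Sum>i\<in>I D. c i *\<^sub>R u i)"
      by (simp add: sum_distrib_left sum_subtractf scaleR_conv_of_real algebra_simps)
    finally have "\<sigma> * (\<Sum>i\<in>I D. c i *\<^sub>R g D i) \<in> P" by (simp add: c(2))
    then have "(\<Sum>i\<in>I D. c i *\<^sub>R g D i) \<in> P" using G(1) ring_primeD(3)[OF P] by blast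
    then show False using indep c(1) by blast
  qed
  \<comment> \<open>C absorbs the scaling, as
    \<open>\<kappa> * (k * D) + 1 \<le> C * (D + 1)\<close>. Taking D to be the resulting constant
    factor itself turns the bound into \<open>(D + 1) ^ n \<le> D * (D + 1) ^ card B\<close>, which
    fails for n above \<open>card B\<close>.\<close>
  define C where "C = \<kappa> * k + 1"
  define D where "D = K * C ^ card B"
  have "(D + 1) ^ n \<le> K * (C * (D + 1)) ^ card B"
  proof -
    have "\<kappa> * (k * D) + 1 \<le> C * (D + 1)" by (simp add: C_def algebra_simps)
    then have "K * (\<kappa> * (k * D) + 1) ^ card B \<le> K * (C * (D + 1)) ^ card B"
      by (intro mult_le_mono2 power_mono) auto
    then show ?thesis using bound[of D] by linarith
  qed
  also have "\<dots> = D * (D + 1) ^ card B" unfolding D_def power_mult_distrib by (simp add: mult.assoc)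
  finally have "(D + 1) ^ n \<le> D * (D + 1) ^ card B" .
  moreover have "(D + 1) ^ n = (D + 1) ^ Suc l * (D + 1) ^ card B"
    unfolding l power_add by (rule mult.commute)
  ultimately have "(D + 1) ^ Suc l * (D + 1) ^ card B \<le> D * (D + 1) ^ card B" by simp
  then have "(D + 1) ^ Suc l \<le> D" by (rule mult_right_le_imp_le) simp
  moreover have "(D + 1) ^ 1 \<le> (D + 1) ^ Suc l" by (intro power_increasing) auto
  ultimately show False by simp
qed

section \<open>The ring of polynomial functions\<close>

text \<open>Polynomial functions as a type of their own form an instance of the ring classes in
  which prime ideals and independence were treated.\<close>

typedef (overloaded) 'a::euclidean_space rpoly = "{f :: 'a \<Rightarrow> real. real_polynomial_function f}"
  morphisms rpoly_eval Abs_rpoly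
  by auto

setup_lifting type_definition_rpoly

instantiation rpoly :: (euclidean_space) "{comm_ring_1,real_algebra_1}"
begin

lift_definition zero_rpoly :: "'a rpoly" is "\<lambda>x. 0" by auto
lift_definition one_rpoly :: "'a rpoly" is "\<lambda>x. 1" by auto
lift_definition plus_rpoly :: "'a rpoly \<Rightarrow> 'a rpoly \<Rightarrow> 'a rpoly" is "\<lambda>f g x. f x + g x" by auto
lift_definition minus_rpoly :: "'a rpoly \<Rightarrow> 'a rpoly \<Rightarrow> 'a rpoly" is "\<lambda>f g x. f x - g x" by auto
lift_definition uminus_rpoly :: "'a rpoly \<Rightarrow> 'a rpoly" is "\<lambda>f x. - f x" by auto
lift_definition times_rpoly :: "'a rpoly \<Rightarrow> 'a rpoly \<Rightarrow> 'a rpoly" is "\<lambda>f g x. f x * g x" by auto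
lift_definition scaleR_rpoly :: "real \<Rightarrow> 'a rpoly \<Rightarrow> 'a rpoly" is "\<lambda>c f x. c * f x" by auto

instance
  by standard (transfer; simp add: algebra_simps fun_eq_iff)+

end

lemma rpoly_eval_simps [simp]:
  "rpoly_eval 0 x = 0" "rpoly_eval 1 x = 1"
  "rpoly_eval (f + g) x = rpoly_eval f x + rpoly_eval g x"
  "rpoly_eval (f - g) x = rpoly_eval f x - rpoly_eval g x"
  "rpoly_eval (- f) x = - rpoly_eval f x"
  "rpoly_eval (f * g) x = rpoly_eval f x * rpoly_eval g x"
  "rpoly_eval (c *\<^sub>R f) x = c * rpoly_eval f x"
  by (transfer; simp)+

lemma rpoly_eval_power [simp]: "rpoly_eval (f ^ n) x = rpoly_eval f x ^ n"
  by (induction n) auto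

lemma rpoly_eval_sum [simp]: "rpoly_eval (\<Sum>i\<in>A. f i) x = (\<Sum>i\<in>A. rpoly_eval (f i) x)"
  by (induction A rule: infinite_finite_induct) auto

lemma rpoly_eval_prod [simp]: "rpoly_eval (\<Prod>i\<in>A. f i) x = (\<Prod>i\<in>A. rpoly_eval (f i) x)"
  by (induction A rule: infinite_finite_induct) auto

lemma rpoly_eqI: "(\<And>x. rpoly_eval f x = rpoly_eval g x) \<Longrightarrow> f = g"
  by (metis ext rpoly_eval_inject)

lemma rpoly_eval_polynomial [intro]: "real_polynomial_function (rpoly_eval f)"
  using rpoly_eval by auto

lemma rpoly_eval_Abs [simp]: "real_polynomial_function f \<Longrightarrow> rpoly_eval (Abs_rpoly f) = f"
  by (simp add: Abs_rpoly_inverse)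

definition coordinates :: "'a::euclidean_space rpoly set" where
  "coordinates = (\<lambda>b. Abs_rpoly (\<lambda>x. x \<bullet> b)) ` Basis"

lemma finite_coordinates: "finite coordinates"
  by (simp add: coordinates_def)

lemma real_polynomial_function_inner_const: "real_polynomial_function (\<lambda>x. x \<bullet> b)"
  by (intro real_polynomial_function.intros(1) bounded_linear_inner_left)

text \<open>Supplies the finite generation on which the countability argument of
  \<open>larger_prime_exists\<close> rests. Only linear functions need work: they are expanded in
  the basis.\<close>

lemma algebra_hull_coordinates: "algebra_hull coordinates = (UNIV :: 'a::euclidean_space rpoly set)"
proof -
  have "Abs_rpoly f \<in> algebra_hull coordinates" if "real_polynomial_function f" for f :: "'a \<Rightarrow> real"
    using that
  proof (induction f rule: real_polynomial_function.induct)
    case lin: (linear f)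
    interpret bounded_linear f by fact
    have "Abs_rpoly f = (\<Sum>b\<in>Basis. f b *\<^sub>R Abs_rpoly (\<lambda>x. x \<bullet> b))"
    proof (rule rpoly_eqI)
      fix x
      have "f x = f (\<Sum>b\<in>Basis. (x \<bullet> b) *\<^sub>R b)" by (simp add: euclidean_representation)
      also have "\<dots> = (\<Sum>b\<in>Basis. (x \<bullet> b) * f b)" by (simp add: sum scaleR)
      finally show "rpoly_eval (Abs_rpoly f) x = rpoly_eval (\<Sum>b\<in>Basis. f b *\<^sub>R Abs_rpoly (\<lambda>x. x \<bullet> b)) x"
        using lin by (simp add: real_polynomial_function.intros(1) real_polynomial_function_inner_const mult.commute)
    qed
    also have "\<dots> \<in> algebra_hull coordinates"
      by (intro algebra_hull_sum algebra_hull_closed algebra_hull_base finite_coordinates)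
        (auto simp: coordinates_def)
    finally show ?case .
  next
    case (const c)
    have "Abs_rpoly (\<lambda>x :: 'a. c) = of_real c"
      by (rule rpoly_eqI) (simp add: of_real_def real_polynomial_function.intros(2))
    then show ?case by (simp add: algebra_hull_closed)
  next
    case (add f g)
    then have "Abs_rpoly (\<lambda>x. f x + g x) = Abs_rpoly f + Abs_rpoly g"
      by (intro rpoly_eqI) (simp add: real_polynomial_function.intros(3))
    then show ?case using add by (simp add: algebra_hull_closed)
  next
    case (mult f g)
    then have "Abs_rpoly (\<lambda>x. f x * g x) = Abs_rpoly f * Abs_rpoly g"
      by (intro rpoly_eqI) (simp add: real_polynomial_function.intros(4))
    then show ?case using mult by (simp add: algebra_hull_closed)
  qed
  then show ?thesis
    by (metis UNIV_eq_I rpoly_eval_inverse rpoly_eval_polynomial)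
qed

section \<open>Pullbacks, algebra homomorphisms and transcendence bases\<close>

definition pullback :: "('b::euclidean_space \<Rightarrow> 'a::euclidean_space) \<Rightarrow> 'a rpoly \<Rightarrow> 'b rpoly" where
  "pullback \<phi> f = Abs_rpoly (\<lambda>x. rpoly_eval f (\<phi> x))"

lemma rpoly_eval_pullback [simp]:
  assumes "polynomial_function \<phi>"
  shows "rpoly_eval (pullback \<phi> f) x = rpoly_eval f (\<phi> x)"
  using real_polynomial_function_compose[OF assms rpoly_eval_polynomial[of f]]
  by (simp add: pullback_def o_def)

lemma pullback_hom:
  assumes "polynomial_function \<phi>"
  shows "pullback \<phi> 0 = 0" "pullback \<phi> 1 = 1" "pullback \<phi> (f + g) = pullback \<phi> f + pullback \<phi> g"
    "pullback \<phi> (f * g) = pullback \<phi> f * pullback \<phi> g" "pullback \<phi> (c *\<^sub>R f) = c *\<^sub>R pullback \<phi> f"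
  using assms by (auto intro!: rpoly_eqI)

locale algebra_hom =
  fixes h :: "'r::{comm_ring_1,real_algebra_1} \<Rightarrow> 's::{comm_ring_1,real_algebra_1}"
  assumes zero: "h 0 = 0" and one: "h 1 = 1" and add: "h (a + b) = h a + h b"
    and mult: "h (a * b) = h a * h b" and scale: "h (c *\<^sub>R a) = c *\<^sub>R h a"
begin

lemma sum: "h (\<Sum>i\<in>A. f i) = (\<Sum>i\<in>A. h (f i))"
  by (induction A rule: infinite_finite_induct) (auto simp: zero add)

lemma power: "h (a ^ n) = h a ^ n"
  by (induction n) (auto simp: one mult)

lemma prod: "h (\<Prod>i\<in>A. f i) = (\<Prod>i\<in>A. h (f i))"
  by (induction A rule: infinite_finite_induct) (auto simp: one mult)

lemma algebra_hull:
  assumes "a \<in> algebra_hull X" "finite X"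
  shows "h a \<in> algebra_hull (h ` X)"
proof -
  obtain D where "a \<in> span (bounded_monomials X D)"
    using assms(1) by (auto simp: algebra_hull_def bounded_hull_def)
  then show ?thesis
  proof (induction a rule: span_induct_alt)
    case base
    then show ?case by (simp add: zero algebra_hull_closed)
  next
    case (step c x y)
    obtain e where "x = (\<Prod>x\<in>X. x ^ e x)" using step(1) by (auto simp: bounded_monomials_def)
    then have "h x \<in> algebra_hull (h ` X)"
      using assms(2) by (auto simp: prod power intro!: algebra_hull_prod algebra_hull_closed(9) algebra_hull_base)
    then show ?case using step(2) by (simp add: add scale algebra_hull_closed)
  qed
qed

lemma ring_prime_vimage:
  assumes P: "ring_prime P"
  shows "ring_prime (h -` P)"
  unfolding ring_prime_def ring_ideal_def
  using ring_primeD(2,3)[OF P] ring_idealD[OF ring_primeD(1)[OF P]]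
  by (auto simp: zero one add mult)

text \<open>A relation modulo the preimage of P is mapped to a relation modulo P. This brings
  independence on a product back to one factor.\<close>

lemma transcendental_over_vimage:
  assumes "transcendental_over (algebra_hull (h ` X)) P (h f)" "finite X"
  shows "transcendental_over (algebra_hull X) (h -` P) f"
  unfolding transcendental_over_def
proof (intro allI impI; elim conjE)
  fix n c i assume c: "\<forall>i\<le>n. c i \<in> algebra_hull X" "(\<Sum>i\<le>n. c i * f ^ i) \<in> h -` P" "i \<le> n"
  have "(\<Sum>i\<le>n. h (c i) * h f ^ i) \<in> P" using c(2) by (simp add: sum mult power)
  then have "h (c i) \<in> P"
    using transcendental_overD[OF assms(1), where c = "\<lambda>i. h (c i)" and n = n]
      algebra_hull[OF _ assms(2)] c(1,3) by blast
  then show "c i \<in> h -` P" by simp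
qed

lemma independent_mod_vimage:
  "independent_mod P (map h fs) \<Longrightarrow> independent_mod (h -` P) fs"
  by (induction fs) (auto intro: transcendental_over_vimage)

end

lemma algebra_hom_pullback: "polynomial_function \<phi> \<Longrightarrow> algebra_hom (pullback \<phi>)"
  by unfold_locales (auto simp: pullback_hom)

lemma not_transcendental_over_mono:
  "\<not> transcendental_over A P y \<Longrightarrow> A \<subseteq> A' \<Longrightarrow> \<not> transcendental_over A' P y"
proof (erule contrapos_nn)
  assume "transcendental_over A' P y" "A \<subseteq> A'"
  then show "transcendental_over A P y"
    unfolding transcendental_over_def by (intro allI impI) (elim allE impE, auto)
qed

text \<open>Greedy choice: x joins the list exactly when it is transcendental over the algebra of
  the elements chosen before.\<close>

lemma transcendence_basis_exists:
  fixes P X :: "'r::{comm_ring_1,real_algebra_1} set"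
  assumes P: "ring_prime P" and "finite X"
  shows "\<exists>fs. set fs \<subseteq> X \<and> independent_mod P fs \<and>
    (\<forall>y\<in>X. \<not> transcendental_over (algebra_hull (set fs)) P y)"
  using assms(2)
proof (induction X rule: finite_induct)
  case empty
  then show ?case by (intro exI[of _ "[]"]) simp
next
  case (insert x X)
  then obtain fs where fs: "set fs \<subseteq> X" "independent_mod P fs"
    "\<forall>y\<in>X. \<not> transcendental_over (algebra_hull (set fs)) P y" by blast
  show ?case
  proof (cases "transcendental_over (algebra_hull (set fs)) P x")
    case False
    then show ?thesis using fs by (intro exI[of _ fs]) auto
  next
    case True
    have "\<not> transcendental_over (algebra_hull (set (x # fs))) P x"
    proof
      assume *: "transcendental_over (algebra_hull (set (x # fs))) P x"
      \<comment> \<open>The coefficients of X - x, a relation for x over any algebra containing x;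
        its leading coefficient 1 is not in P.\<close>
      define c where "c = (\<lambda>i :: nat. if i = 0 then - x else 1 :: 'r)"
      have "x \<in> algebra_hull (set (x # fs))" by (rule algebra_hull_base) auto
      then have "c i \<in> algebra_hull (set (x # fs))" for i
        unfolding c_def by (auto intro: algebra_hull_closed(2,7))
      moreover have "(\<Sum>i\<le>1. c i * x ^ i) \<in> P"
        using ring_idealD(1)[OF ring_primeD(1)[OF P]] by (simp add: c_def)
      ultimately have "c 1 \<in> P" using transcendental_overD[OF *, where c = c and n = 1] by blast
      then show False using ring_primeD(2)[OF P] by (simp add: c_def)
    qed
    moreover have "\<not> transcendental_over (algebra_hull (set (x # fs))) P y" if "y \<in> X" for y
    proof (rule not_transcendental_over_mono)
      show "\<not> transcendental_over (algebra_hull (set fs)) P y" using fs(3) that by blast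
      show "algebra_hull (set fs) \<subseteq> algebra_hull (set (x # fs))"
        by (rule algebra_hull_mono) auto
    qed
    moreover have "independent_mod P (x # fs)" "set (x # fs) \<subseteq> insert x X"
      using True fs(1,2) by auto
    ultimately show ?thesis by blast
  qed
qed

section \<open>Primes over a vanishing ideal and the Krull dimension\<close>

definition vanishing :: "'a::euclidean_space set \<Rightarrow> 'a rpoly set" where
  "vanishing A = {f. \<forall>x\<in>A. rpoly_eval f x = 0}"

definition restrictions :: "'a::euclidean_space set \<Rightarrow> 'a rpoly set \<Rightarrow> ('a \<Rightarrow> real) set" where
  "restrictions A P = (\<lambda>f. restrict (rpoly_eval f) A) ` P"

text \<open>Polynomials that agree on A differ by an element of \<open>vanishing A\<close>, hence of
  P. So a prime over \<open>vanishing A\<close> is recovered from its restrictions, and strict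
  inclusions survive the passage to \<open>poly_ring_on A\<close>.\<close>

lemma restrict_in_restrictions_iff:
  assumes "ring_ideal P" "vanishing A \<subseteq> P"
  shows "restrict (rpoly_eval f) A \<in> restrictions A P \<longleftrightarrow> f \<in> P"
proof
  assume "restrict (rpoly_eval f) A \<in> restrictions A P"
  then obtain g where g: "g \<in> P" "restrict (rpoly_eval f) A = restrict (rpoly_eval g) A"
    by (auto simp: restrictions_def)
  have "rpoly_eval f x = rpoly_eval g x" if "x \<in> A" for x
    using fun_cong[OF g(2), of x] that by simp
  then have "f - g \<in> vanishing A" by (simp add: vanishing_def)
  then show "f \<in> P" using ring_ideal_cong[OF assms(1), of f g] g(1) assms(2) by blast
qed (auto simp: restrictions_def)

lemma carrier_poly_ring_on: "f \<in> carrier (poly_ring_on A) \<longleftrightarrow> (\<exists>g. f = restrict (rpoly_eval g) A)"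
  unfolding poly_ring_on_def
  by (auto intro: rpoly_eval_polynomial) (metis rpoly_eval_Abs)

lemma primeideal_restrictions:
  assumes P: "ring_prime P" and A: "vanishing A \<subseteq> P"
  shows "primeideal (restrictions A P) (poly_ring_on A)"
proof -
  have id: "ring_ideal P" using P by (rule ring_primeD)
  note iff = restrict_in_restrictions_iff[OF id A]
  have rel: "f \<in> restrictions A P \<longleftrightarrow> (\<exists>g\<in>P. f = restrict (rpoly_eval g) A)" for f
    by (auto simp: restrictions_def)
  interpret cring "poly_ring_on A" by (rule cring_poly_ring_on)
  have mult: "restrict (rpoly_eval f) A \<otimes>\<^bsub>poly_ring_on A\<^esub> restrict (rpoly_eval g) A
      = restrict (rpoly_eval (f * g)) A" for f g
    by (auto simp: poly_ring_on_def fun_eq_iff)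
  have add: "restrict (rpoly_eval f) A \<oplus>\<^bsub>poly_ring_on A\<^esub> restrict (rpoly_eval g) A
      = restrict (rpoly_eval (f + g)) A" for f g
    by (auto simp: poly_ring_on_def fun_eq_iff)
  have "ideal (restrictions A P) (poly_ring_on A)"
  proof (rule idealI)
    show "ring (poly_ring_on A)" by (rule ring_axioms)
    show "subgroup (restrictions A P) (add_monoid (poly_ring_on A))"
    proof (rule add.subgroupI)
      show "restrictions A P \<subseteq> carrier (poly_ring_on A)"
        by (auto simp: rel carrier_poly_ring_on)
      show "restrictions A P \<noteq> {}" using ring_idealD(1)[OF id] by (auto simp: restrictions_def)
    next
      fix f assume "f \<in> restrictions A P"
      then obtain g where g: "g \<in> P" "f = restrict (rpoly_eval g) A" by (auto simp: rel)
      have "restrict (rpoly_eval (- g)) A \<oplus>\<^bsub>poly_ring_on A\<^esub> f = \<zero>\<^bsub>poly_ring_on A\<^esub>"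
        unfolding g(2) add by (auto simp: poly_ring_on_def fun_eq_iff)
      moreover have "restrict (rpoly_eval (- g)) A \<in> carrier (poly_ring_on A)"
          "f \<in> carrier (poly_ring_on A)"
        using g(2) by (auto simp only: carrier_poly_ring_on)
      ultimately have "\<ominus>\<^bsub>poly_ring_on A\<^esub> f = restrict (rpoly_eval (- g)) A"
        by (intro minus_equality) auto
      then show "\<ominus>\<^bsub>poly_ring_on A\<^esub> f \<in> restrictions A P"
        using iff[of "- g"] ring_idealD(5)[OF id g(1)] by simp
    next
      fix f g assume "f \<in> restrictions A P" "g \<in> restrictions A P"
      then show "f \<oplus>\<^bsub>poly_ring_on A\<^esub> g \<in> restrictions A P"
        using ring_idealD(2)[OF id] by (auto simp: rel add)
    qed
  next
    fix f g assume "f \<in> restrictions A P" "g \<in> carrier (poly_ring_on A)"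
    then obtain f' g' where "f' \<in> P" "f = restrict (rpoly_eval f') A" "g = restrict (rpoly_eval g') A"
      by (auto simp: rel carrier_poly_ring_on)
    then show "g \<otimes>\<^bsub>poly_ring_on A\<^esub> f \<in> restrictions A P" "f \<otimes>\<^bsub>poly_ring_on A\<^esub> g \<in> restrictions A P"
      using ring_idealD(3,4)[OF id] by (simp_all add: mult iff)
  qed
  then show ?thesis
  proof (rule primeidealI[OF _ is_cring])
    have "restrict (rpoly_eval 1) A \<notin> restrictions A P" using iff ring_primeD(2)[OF P] by blast
    moreover have "restrict (rpoly_eval 1) A \<in> carrier (poly_ring_on A)"
      unfolding carrier_poly_ring_on by blast
    ultimately show "carrier (poly_ring_on A) \<noteq> restrictions A P" by blast
  next
    fix f g assume fg: "f \<in> carrier (poly_ring_on A)" "g \<in> carrier (poly_ring_on A)"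
      "f \<otimes>\<^bsub>poly_ring_on A\<^esub> g \<in> restrictions A P"
    then obtain f' g' where "f = restrict (rpoly_eval f') A" "g = restrict (rpoly_eval g') A"
      by (auto simp: carrier_poly_ring_on)
    then show "f \<in> restrictions A P \<or> g \<in> restrictions A P"
      using fg(3) ring_primeD(3)[OF P] by (simp add: mult iff)
  qed
qed

theorem semialg_dim_ge_independent:
  assumes P: "ring_prime P" and A: "vanishing A \<subseteq> P" and fs: "independent_mod P fs"
  shows "semialg_dim A \<ge> ereal (real (length fs))"
proof -
  obtain \<P> where \<P>: "\<P> 0 = P" "\<And>i. i \<le> length fs \<Longrightarrow> ring_prime (\<P> i)"
    "\<And>i. i < length fs \<Longrightarrow> \<P> i \<subset> \<P> (Suc i)"
    using prime_chain_of_independent[OF P finite_coordinates algebra_hull_coordinates fs] by blast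
  have sub: "vanishing A \<subseteq> \<P> i" if "i \<le> length fs" for i
    using that
  proof (induction i)
    case (Suc i)
    then show ?case using \<P>(3)[of i] by auto
  qed (use A \<P>(1) in auto)
  have "restrictions A (\<P> i) \<subset> restrictions A (\<P> (Suc i))" if i: "i < length fs" for i
  proof -
    obtain f where f: "f \<in> \<P> (Suc i)" "f \<notin> \<P> i" using \<P>(3)[OF i] by blast
    have "restrict (rpoly_eval f) A \<notin> restrictions A (\<P> i)"
      using restrict_in_restrictions_iff[of "\<P> i" A f] ring_primeD(1)[OF \<P>(2)[of i]] sub[of i] i f(2)
      by simp
    moreover have "restrictions A (\<P> i) \<subseteq> restrictions A (\<P> (Suc i))"
      using \<P>(3)[OF i] unfolding restrictions_def by blast
    ultimately show ?thesis using f(1) unfolding restrictions_def by blast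
  qed
  then have "prime_chain (poly_ring_on A) (\<lambda>i. restrictions A (\<P> i)) (length fs)"
    unfolding prime_chain_def using primeideal_restrictions[OF \<P>(2) sub] by blast
  then show ?thesis
    unfolding semialg_dim_def krull_dim_def by (intro Sup_upper) blast
qed

section \<open>Polynomial functions on Euclidean spaces\<close>

text \<open>Along the line F is a polynomial in t that does not vanish at t = 0.\<close>

lemma real_polynomial_function_line_zeros:
  assumes "real_polynomial_function F" and "F x \<noteq> 0"
  shows "finite {t :: real. F (x + t *\<^sub>R (y - x)) = 0}"
proof -
  have "polynomial_function (\<lambda>t :: real. x + t *\<^sub>R (y - x))"
    by (intro polynomial_function_add polynomial_function_mult polynomial_function_const
        polynomial_function_id)
  then have "real_polynomial_function (F \<circ> (\<lambda>t. x + t *\<^sub>R (y - x)))"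
    by (rule real_polynomial_function_compose[OF _ assms(1)])
  then obtain a n where a: "F \<circ> (\<lambda>t. x + t *\<^sub>R (y - x)) = (\<lambda>t. \<Sum>i\<le>n. a i * t ^ i)"
    by (rule real_polynomial_function_imp_sum[THEN exE]) (elim exE)
  have at: "F (x + t *\<^sub>R (y - x)) = (\<Sum>i\<le>n. a i * t ^ i)" for t
    using fun_cong[OF a, of t] by (simp only: o_apply)
  have "\<exists>i\<le>n. a i \<noteq> 0"
  proof (rule ccontr)
    assume "\<not> ?thesis"
    then have "(\<Sum>i\<le>n. a i * 0 ^ i) = 0" by (intro sum.neutral) simp
    then show False using at[of 0] assms(2) by simp
  qed
  then show ?thesis unfolding at polyfun_finite_roots by blast
qed

text \<open>An affine set is irreducible: on the line through x and y, which stays in M, each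
  function has finitely many zeros. For G the line is traversed from y, so its parameter is 1 -
  t.\<close>

lemma real_polynomial_functions_common_nonzero:
  assumes F: "real_polynomial_function F" "F x \<noteq> 0" "x \<in> M"
    and G: "real_polynomial_function G" "G y \<noteq> 0" "y \<in> M" and M: "affine M"
  shows "\<exists>z\<in>M. F z \<noteq> 0 \<and> G z \<noteq> 0"
proof -
  have eq: "x + t *\<^sub>R (y - x) = y + (1 - t) *\<^sub>R (x - y)" for t :: real
    by (simp add: algebra_simps)
  have "finite ((\<lambda>t. 1 - t) -` {t :: real. G (y + t *\<^sub>R (x - y)) = 0})"
    by (intro finite_vimageI real_polynomial_function_line_zeros[OF G(1,2)]) (simp add: inj_def)
  then have "finite {t :: real. G (x + t *\<^sub>R (y - x)) = 0}"
    unfolding eq by (simp add: vimage_def)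
  then have "finite ({t. F (x + t *\<^sub>R (y - x)) = 0} \<union> {t. G (x + t *\<^sub>R (y - x)) = 0})"
    using real_polynomial_function_line_zeros[OF F(1,2)] by simp
  then obtain t where t: "F (x + t *\<^sub>R (y - x)) \<noteq> 0" "G (x + t *\<^sub>R (y - x)) \<noteq> 0"
    using ex_new_if_finite[OF infinite_UNIV_char_0, of "{t. F (x + t *\<^sub>R (y - x)) = 0} \<union>
      {t. G (x + t *\<^sub>R (y - x)) = 0}"] by auto
  have "(1 - t) *\<^sub>R x + t *\<^sub>R y \<in> M"
    using M F(3) G(3) unfolding affine_alt by simp
  then have "x + t *\<^sub>R (y - x) \<in> M" by (simp add: algebra_simps)
  then show ?thesis using t by blast
qed

text \<open>Induction on the variables: with the others fixed, the sum is a polynomial in the value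
  t of the new variable b that vanishes for all t, so the coefficient of each power of t vanishes as
  well.\<close>

lemma monomials_eq_0_imp_coeffs_eq_0:
  fixes c :: "('a \<Rightarrow> nat) \<Rightarrow> real"
  assumes "finite B" and "\<And>x. (\<Sum>\<alpha>\<in>B \<rightarrow>\<^sub>E {..D}. c \<alpha> * (\<Prod>b\<in>B. x b ^ \<alpha> b)) = 0"
  shows "\<forall>\<alpha>\<in>B \<rightarrow>\<^sub>E {..D}. c \<alpha> = 0"
  using assms
proof (induction B arbitrary: c rule: finite_induct)
  case empty
  then show ?case by simp
next
  case (insert b B)
  have "c (\<alpha>(b := k)) = 0" if k: "k \<le> D" and \<alpha>: "\<alpha> \<in> B \<rightarrow>\<^sub>E {..D}" for k \<alpha>
  proof -
    have "(\<Sum>\<alpha>\<in>B \<rightarrow>\<^sub>E {..D}. c (\<alpha>(b := k)) * (\<Prod>a\<in>B. x a ^ \<alpha> a)) = 0" for x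
    proof -
      have "\<forall>t. (\<Sum>k\<le>D. (\<Sum>\<alpha>\<in>B \<rightarrow>\<^sub>E {..D}. c (\<alpha>(b := k)) * (\<Prod>a\<in>B. x a ^ \<alpha> a)) * t ^ k) = 0"
      proof
        fix t
        have "0 = (\<Sum>\<alpha>\<in>insert b B \<rightarrow>\<^sub>E {..D}. c \<alpha> * (\<Prod>a\<in>insert b B. (x(b := t)) a ^ \<alpha> a))"
          using insert.prems[of "x(b := t)"] by simp
        also have "\<dots> = (\<Sum>(k, \<alpha>)\<in>{..D} \<times> (B \<rightarrow>\<^sub>E {..D}).
            c (\<alpha>(b := k)) * (\<Prod>a\<in>insert b B. (x(b := t)) a ^ (\<alpha>(b := k)) a))"
          unfolding PiE_insert_eq
          by (subst sum.reindex[OF inj_combinator[OF insert.hyps(2)]]) (simp add: case_prod_unfold)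
        also have "\<dots> = (\<Sum>(k, \<alpha>)\<in>{..D} \<times> (B \<rightarrow>\<^sub>E {..D}).
            c (\<alpha>(b := k)) * (\<Prod>a\<in>B. x a ^ \<alpha> a) * t ^ k)"
        proof (intro sum.cong refl, clarify)
          fix k \<alpha>
          have "(\<Prod>a\<in>insert b B. (x(b := t)) a ^ (\<alpha>(b := k)) a)
              = t ^ k * (\<Prod>a\<in>B. (x(b := t)) a ^ (\<alpha>(b := k)) a)"
            using insert.hyps by simp
          also have "(\<Prod>a\<in>B. (x(b := t)) a ^ (\<alpha>(b := k)) a) = (\<Prod>a\<in>B. x a ^ \<alpha> a)"
            using insert.hyps(2) by (intro prod.cong) auto
          finally show "c (\<alpha>(b := k)) * (\<Prod>a\<in>insert b B. (x(b := t)) a ^ (\<alpha>(b := k)) a)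
              = c (\<alpha>(b := k)) * (\<Prod>a\<in>B. x a ^ \<alpha> a) * t ^ k"
            by simp
        qed
        finally show "(\<Sum>k\<le>D. (\<Sum>\<alpha>\<in>B \<rightarrow>\<^sub>E {..D}. c (\<alpha>(b := k)) * (\<Prod>a\<in>B. x a ^ \<alpha> a)) * t ^ k) = 0"
          by (simp add: sum.cartesian_product[symmetric] sum_distrib_right)
      qed
      then have "\<forall>k\<le>D. (\<Sum>\<alpha>\<in>B \<rightarrow>\<^sub>E {..D}. c (\<alpha>(b := k)) * (\<Prod>a\<in>B. x a ^ \<alpha> a)) = 0"
        by (rule polyfun_eq_0[THEN iffD1])
      then show ?thesis using k by simp
    qed
    then show ?thesis using insert.IH[of "\<lambda>\<alpha>. c (\<alpha>(b := k))"] \<alpha> by simp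
  qed
  then show ?case unfolding PiE_insert_eq by auto
qed

lemma polynomial_function_Pair:
  fixes f :: "'a::euclidean_space \<Rightarrow> 'b::euclidean_space" and g :: "'a \<Rightarrow> 'c::euclidean_space"
  assumes "polynomial_function f" "polynomial_function g"
  shows "polynomial_function (\<lambda>x. (f x, g x))"
  using assms unfolding polynomial_function_iff_Basis_inner by (auto simp: Basis_prod_def)

lemma real_polynomial_function_inner:
  fixes f g :: "'a::euclidean_space \<Rightarrow> 'b::euclidean_space"
  assumes "polynomial_function f" "polynomial_function g"
  shows "real_polynomial_function (\<lambda>x. f x \<bullet> g x)"
proof -
  have "real_polynomial_function (\<lambda>x. \<Sum>b\<in>Basis. (f x \<bullet> b) * (g x \<bullet> b))"
    using assms unfolding polynomial_function_iff_Basis_inner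
    by (intro real_polynomial_function_sum real_polynomial_function.intros(4)) auto
  then show ?thesis by (simp add: euclidean_inner[symmetric])
qed

lemma polynomial_function_scaleR:
  assumes "real_polynomial_function f" "polynomial_function g"
  shows "polynomial_function (\<lambda>x. f x *\<^sub>R g x)"
  using assms by (intro polynomial_function_mult) (simp_all add: real_polynomial_function_eq)

lemma polynomial_function_compose:
  fixes f :: "'a::euclidean_space \<Rightarrow> 'b::euclidean_space" and g :: "'b \<Rightarrow> 'c::euclidean_space"
  assumes "polynomial_function f" "polynomial_function g"
  shows "polynomial_function (\<lambda>x. g (f x))"
  using assms real_polynomial_function_compose[OF assms(1)]
  unfolding polynomial_function_iff_Basis_inner[of g] polynomial_function_iff_Basis_inner[of "\<lambda>x. g (f x)"]
  by (auto simp: o_def)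

lemma polynomial_function_fst: "polynomial_function (fst :: 'a::euclidean_space \<times> 'b::euclidean_space \<Rightarrow> 'a)"
  and polynomial_function_snd: "polynomial_function (snd :: 'a::euclidean_space \<times> 'b::euclidean_space \<Rightarrow> 'b)"
  by (intro polynomial_function_bounded_linear bounded_linear_fst bounded_linear_snd)+

lemma coordinates_prod:
  "(coordinates :: ('a::euclidean_space \<times> 'b::euclidean_space) rpoly set)
     = pullback fst ` coordinates \<union> pullback snd ` coordinates"
proof -
  have "pullback fst (Abs_rpoly (\<lambda>x. x \<bullet> b)) = (Abs_rpoly (\<lambda>x. x \<bullet> (b, 0)) :: ('a \<times> 'b) rpoly)" for b
    using real_polynomial_function_inner_const[of "(b, 0) :: 'a \<times> 'b"]
    by (intro rpoly_eqI)
      (simp add: polynomial_function_fst real_polynomial_function_inner_const inner_prod_def)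
  moreover have "pullback snd (Abs_rpoly (\<lambda>x. x \<bullet> b)) = (Abs_rpoly (\<lambda>x. x \<bullet> (0, b)) :: ('a \<times> 'b) rpoly)" for b
    using real_polynomial_function_inner_const[of "(0, b) :: 'a \<times> 'b"]
    by (intro rpoly_eqI)
      (simp add: polynomial_function_snd real_polynomial_function_inner_const inner_prod_def)
  ultimately show ?thesis
    by (simp add: coordinates_def Basis_prod_def image_Un image_image)
qed

lemma algebra_hull_eq_UNIV_bounded:
  assumes "finite F" "algebra_hull X = UNIV"
  obtains d where "F \<subseteq> bounded_hull X d"
  using assms(1)
proof (induction F arbitrary: thesis rule: finite_induct)
  case empty
  then show ?case by simp
next
  case (insert f F)
  obtain d where d: "F \<subseteq> bounded_hull X d" using insert.IH .
  obtain e where e: "f \<in> bounded_hull X e" using assms(2) unfolding algebra_hull_def by blast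
  have "insert f F \<subseteq> bounded_hull X (max d e)"
    using d e bounded_hull_mono[of d "max d e" X] bounded_hull_mono[of e "max d e" X]
    by (simp add: subset_iff)
  then show ?case by (rule insert.prems)
qed

section \<open>Dense families of orthogonal complements\<close>

text \<open>Gram-Schmidt without division. The f k are polynomial and mutually orthogonal at every
  s; independence of the e k at s is needed only for them to be nonzero there.\<close>

lemma polynomial_orthogonalization:
  fixes e :: "nat \<Rightarrow> 's::euclidean_space \<Rightarrow> 'e::euclidean_space"
  assumes "\<forall>k<Q. polynomial_function (e k)"
  shows "\<exists>f :: nat \<Rightarrow> 's \<Rightarrow> 'e. (\<forall>k<Q. polynomial_function (f k)) \<and>
    (\<forall>k<Q. \<forall>s. f k s \<in> span ((\<lambda>j. e j s) ` {..k})) \<and>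
    (\<forall>k<Q. \<forall>j<k. \<forall>s. f k s \<bullet> f j s = 0) \<and>
    (\<forall>s. (\<forall>k<Q. e k s \<notin> span ((\<lambda>j. e j s) ` {..<k})) \<longrightarrow> (\<forall>k<Q. f k s \<noteq> 0))"
  using assms
proof (induction Q)
  case 0
  then show ?case by simp
next
  case (Suc Q)
  have "\<forall>k<Q. polynomial_function (e k)" and polyQ: "polynomial_function (e Q)"
    using Suc.prems by simp_all
  from Suc.IH[OF this(1)] obtain f :: "nat \<Rightarrow> 's \<Rightarrow> 'e"
    where f: "\<forall>k<Q. polynomial_function (f k)"
      "\<forall>k<Q. \<forall>s. f k s \<in> span ((\<lambda>j. e j s) ` {..k})"
      "\<forall>k<Q. \<forall>j<k. \<forall>s. f k s \<bullet> f j s = 0"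
      "\<forall>s. (\<forall>k<Q. e k s \<notin> span ((\<lambda>j. e j s) ` {..<k})) \<longrightarrow> (\<forall>k<Q. f k s \<noteq> 0)"
    by (elim exE conjE)
  note poly = f(1)[rule_format] and span = f(2)[rule_format] and orth = f(3)[rule_format]
  \<comment> \<open>Products of squared norms. The full product is the common denominator of the
    projection coefficients, and omitting the factor j leaves what remains of it after division by
    \<open>f j s \<bullet> f j s\<close>.\<close>
  define p where "p = (\<lambda>J s. \<Prod>i\<in>J. f i s \<bullet> f i s)"
  define g where "g = (\<lambda>s. p {..<Q} s *\<^sub>R e Q s - (\<Sum>j<Q. ((e Q s \<bullet> f j s) * p ({..<Q} - {j}) s) *\<^sub>R f j s))"
  have polyp: "real_polynomial_function (p J)" if "J \<subseteq> {..<Q}" for J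
    unfolding p_def using that finite_subset[OF that]
    by (intro real_polynomial_function_prod real_polynomial_function_inner poly) auto
  have polyg: "polynomial_function g"
    unfolding g_def
    by (intro polynomial_function_diff polynomial_function_sum polynomial_function_scaleR
        real_polynomial_function.intros(4) real_polynomial_function_inner polyp poly polyQ) auto
  have orth': "f i s \<bullet> f j s = 0" if "i < Q" "j < Q" "i \<noteq> j" for i j s
    using orth[of i j s] orth[of j i s] that by (metis inner_commute nat_neq_iff)
  have fspan: "f j s \<in> span ((\<lambda>j. e j s) ` {..<Q})" if "j < Q" for j s
  proof -
    have "(\<lambda>j. e j s) ` {..j} \<subseteq> (\<lambda>j. e j s) ` {..<Q}" using that by auto
    then show ?thesis using span[OF that] span_mono by blast
  qed
  have gorth: "g s \<bullet> f i s = 0" if i: "i < Q" for i s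
  proof -
    have "(\<Sum>j<Q. ((e Q s \<bullet> f j s) * p ({..<Q} - {j}) s) *\<^sub>R f j s) \<bullet> f i s
        = (\<Sum>j<Q. ((e Q s \<bullet> f j s) * p ({..<Q} - {j}) s) * (f j s \<bullet> f i s))"
      by (simp add: inner_sum_left)
    also have "\<dots> = (\<Sum>j<Q. if j = i then (e Q s \<bullet> f i s) * (p ({..<Q} - {i}) s * (f i s \<bullet> f i s)) else 0)"
      using orth'[OF _ i] by (intro sum.cong) auto
    also have "\<dots> = (e Q s \<bullet> f i s) * (p ({..<Q} - {i}) s * (f i s \<bullet> f i s))"
      using i by simp
    also have "p ({..<Q} - {i}) s * (f i s \<bullet> f i s) = p {..<Q} s"
      unfolding p_def using i by (subst (2) prod.remove[of _ i]) auto
    finally show ?thesis by (simp add: g_def inner_diff_left)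
  qed
  have gnz: "g s \<noteq> 0" if ind: "\<forall>k<Suc Q. e k s \<notin> span ((\<lambda>j. e j s) ` {..<k})" for s
  proof
    assume "g s = 0"
    then have eq: "p {..<Q} s *\<^sub>R e Q s = (\<Sum>j<Q. ((e Q s \<bullet> f j s) * p ({..<Q} - {j}) s) *\<^sub>R f j s)"
      by (simp add: g_def)
    have "p {..<Q} s \<noteq> 0" using f(4) ind by (auto simp: p_def)
    moreover have "p {..<Q} s *\<^sub>R e Q s \<in> span ((\<lambda>j. e j s) ` {..<Q})"
      unfolding eq by (intro span_sum span_scale fspan) simp
    ultimately have "e Q s \<in> span ((\<lambda>j. e j s) ` {..<Q})"
      using span_scale[of "p {..<Q} s *\<^sub>R e Q s" _ "inverse (p {..<Q} s)"] by simp
    then show False using ind by blast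
  qed
  have gspan: "g s \<in> span ((\<lambda>j. e j s) ` {..Q})" for s
  proof -
    have "(\<lambda>j. e j s) ` {..<Q} \<subseteq> (\<lambda>j. e j s) ` {..Q}" by auto
    then have "span ((\<lambda>j. e j s) ` {..<Q}) \<subseteq> span ((\<lambda>j. e j s) ` {..Q})" by (rule span_mono)
    then have "f j s \<in> span ((\<lambda>j. e j s) ` {..Q})" if "j < Q" for j using fspan[OF that] by blast
    then show ?thesis
      unfolding g_def by (intro span_diff span_scale span_sum) (auto intro: span_base)
  qed
  show ?case
  proof (intro exI[of _ "f(Q := g)"] conjI allI impI)
    fix k assume "k < Suc Q"
    then show "polynomial_function ((f(Q := g)) k)" using poly polyg by simp
    fix s show "(f(Q := g)) k s \<in> span ((\<lambda>j. e j s) ` {..k})"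
      using \<open>k < Suc Q\<close> span gspan by (cases "k = Q") auto
  next
    fix k j s assume "k < Suc Q" "j < k"
    then show "(f(Q := g)) k s \<bullet> (f(Q := g)) j s = 0"
      using orth gorth by (cases "k = Q") auto
  next
    fix s k assume "\<forall>k<Suc Q. e k s \<notin> span ((\<lambda>j. e j s) ` {..<k})" "k < Suc Q"
    then show "(f(Q := g)) k s \<noteq> 0"
      using f(4) gnz by (cases "k = Q") auto
  qed
qed

text \<open>A point s of A stands for the orthogonal complement of the \<open>f k s\<close>. By
  \<open>dense_W\<close> these complements have a Zariski dense union; by \<open>move\<close>, a w
  in one of them stays in a complement when u is given any value in N, so w and u vary
  independently. N is kept apart from M because u may reach only a dense part of M, such as positive
  radii.\<close>

locale dense_incidence =
  fixes A :: "'s::euclidean_space set" and f :: "nat \<Rightarrow> 's \<Rightarrow> 'e::euclidean_space" and Q :: nat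
    and u :: "'s \<Rightarrow> 'u::euclidean_space" and M N :: "'u set"
  assumes poly_f: "\<And>k. k < Q \<Longrightarrow> polynomial_function (f k)"
    and orth: "\<And>s j k. s \<in> A \<Longrightarrow> j < Q \<Longrightarrow> k < Q \<Longrightarrow> j \<noteq> k \<Longrightarrow> f j s \<bullet> f k s = 0"
    and nonzero: "\<And>s k. s \<in> A \<Longrightarrow> k < Q \<Longrightarrow> f k s \<noteq> 0"
    and poly_u: "polynomial_function u" and M: "subspace M"
    and dense_N: "\<And>F. real_polynomial_function F \<Longrightarrow> (\<forall>x\<in>N. F x = 0) \<Longrightarrow> (\<forall>x\<in>M. F x = 0)"
    and move: "\<And>s v w. s \<in> A \<Longrightarrow> v \<in> N \<Longrightarrow> (\<forall>k<Q. w \<bullet> f k s = 0) \<Longrightarrow>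
      \<exists>s'\<in>A. u s' = v \<and> (\<forall>k<Q. w \<bullet> f k s' = 0)"
    and dense_W: "\<And>F. real_polynomial_function F \<Longrightarrow>
      (\<And>w s. s \<in> A \<Longrightarrow> \<forall>k<Q. w \<bullet> f k s = 0 \<Longrightarrow> F w = 0) \<Longrightarrow> (\<forall>w. F w = 0)"
begin

text \<open>The common denominator of \<open>chart\<close>, nonzero on A.\<close>

definition delta :: "'s \<Rightarrow> real" where "delta s = (\<Prod>k<Q. f k s \<bullet> f k s)"

lemma delta_nonzero: "s \<in> A \<Longrightarrow> delta s \<noteq> 0"
  using nonzero by (simp add: delta_def)

lemma A_nonempty: "A \<noteq> {}"
  using dense_W[of "\<lambda>_. 1"] by (auto intro: real_polynomial_function.intros(2))

lemma Q_le: "Q \<le> DIM('e)"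
proof -
  obtain s where s: "s \<in> A" using A_nonempty by blast
  have "inj_on (\<lambda>k. f k s) {..<Q}"
    using orth[OF s] nonzero[OF s] unfolding inj_on_def by (metis inner_eq_zero_iff lessThan_iff)
  then have card: "card ((\<lambda>k. f k s) ` {..<Q}) = Q" by (simp add: card_image)
  have "pairwise orthogonal ((\<lambda>k. f k s) ` {..<Q})"
    unfolding pairwise_def orthogonal_def using orth[OF s] by force
  then have "independent ((\<lambda>k. f k s) ` {..<Q})"
    using nonzero[OF s] by (intro pairwise_orthogonal_independent) auto
  then show ?thesis using independent_card_le card by metis
qed

text \<open>The Q coefficients in \<open>chart\<close> are stored as one vector of \<open>'e\<close>
  along Q distinct basis vectors; \<open>Q_le\<close> guarantees that there are enough.\<close>

definition axes :: "nat \<Rightarrow> 'e" where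
  "axes = (SOME \<beta>. inj_on \<beta> {..<Q} \<and> \<beta> ` {..<Q} \<subseteq> Basis)"

lemma axes: "inj_on axes {..<Q}" "axes ` {..<Q} \<subseteq> Basis"
proof -
  have "\<exists>\<beta> :: nat \<Rightarrow> 'e. inj_on \<beta> {..<Q} \<and> \<beta> ` {..<Q} \<subseteq> Basis"
    using card_le_inj[of "{..<Q}" "Basis :: 'e set"] Q_le by auto
  from someI_ex[OF this] show "inj_on axes {..<Q}" "axes ` {..<Q} \<subseteq> Basis"
    unfolding axes_def by auto
qed

lemma axes_inner: "j < Q \<Longrightarrow> k < Q \<Longrightarrow> axes j \<bullet> axes k = (if j = k then 1 else 0)"
  using inner_Basis[of "axes j" "axes k"] axes(2) inj_onD[OF axes(1), of j k]
  by (auto simp: image_subset_iff)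

definition frame :: "('e \<times> 'e \<times> 'u) set" where
  "frame = UNIV \<times> span (axes ` {..<Q}) \<times> M"

text \<open>A pair \<open>(s, z)\<close> with \<open>s \<in> A\<close> is recorded by the component \<open>w\<close> of \<open>z\<close> orthogonal to all
  \<open>f k s\<close>, the coefficients of \<open>z - w\<close> in the \<open>f k s\<close>, and \<open>u s\<close>.\<close>

definition chart :: "'s \<Rightarrow> 'e \<Rightarrow> 'e \<times> 'e \<times> 'u" where
  "chart s z = (let c = (\<lambda>k. (z \<bullet> f k s) / (f k s \<bullet> f k s)) in
     (z - (\<Sum>k<Q. c k *\<^sub>R f k s), (\<Sum>k<Q. c k *\<^sub>R axes k), u s))"

text \<open>On A this is \<open>delta s\<close> times \<open>chart\<close>, but it is polynomial in
  s and z everywhere.\<close>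

definition cleared_chart :: "'s \<times> 'e \<Rightarrow> 'e \<times> 'e \<times> 'u" where
  "cleared_chart p = (let s = fst p; z = snd p;
       c = (\<lambda>k. (z \<bullet> f k s) * (\<Prod>j\<in>{..<Q} - {k}. f j s \<bullet> f j s)) in
     (delta s *\<^sub>R z - (\<Sum>k<Q. c k *\<^sub>R f k s), (\<Sum>k<Q. c k *\<^sub>R axes k), delta s *\<^sub>R u s))"

lemma cleared_chart:
  assumes "s \<in> A"
  shows "cleared_chart (s, z) = delta s *\<^sub>R chart s z"
proof -
  have c: "(z \<bullet> f k s) * (\<Prod>j\<in>{..<Q} - {k}. f j s \<bullet> f j s)
      = delta s * ((z \<bullet> f k s) / (f k s \<bullet> f k s))" if "k < Q" for k
  proof -
    have "delta s = (f k s \<bullet> f k s) * (\<Prod>j\<in>{..<Q} - {k}. f j s \<bullet> f j s)"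
      unfolding delta_def using that by (intro prod.remove) auto
    then show ?thesis using nonzero[OF assms that] by simp
  qed
  show ?thesis
    unfolding cleared_chart_def chart_def Let_def fst_conv snd_conv scaleR_Pair
    by (simp add: scaleR_diff_right scaleR_sum_right c)
qed

lemma polynomial_cleared_chart: "polynomial_function cleared_chart"
proof -
  have f: "polynomial_function (\<lambda>p :: 's \<times> 'e. f k (fst p))" if "k < Q" for k
    by (rule polynomial_function_compose[OF polynomial_function_fst poly_f[OF that]])
  have u: "polynomial_function (\<lambda>p :: 's \<times> 'e. u (fst p))"
    by (rule polynomial_function_compose[OF polynomial_function_fst poly_u])
  have delta: "real_polynomial_function (\<lambda>p :: 's \<times> 'e. delta (fst p))"
    unfolding delta_def
    by (intro real_polynomial_function_prod real_polynomial_function_inner f) auto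
  have c: "real_polynomial_function (\<lambda>p. (snd p \<bullet> f k (fst p)) * (\<Prod>j\<in>{..<Q} - {k}. f j (fst p) \<bullet> f j (fst p)))"
    if "k < Q" for k
    using that by (intro real_polynomial_function.intros(4) real_polynomial_function_prod
        real_polynomial_function_inner f polynomial_function_snd) auto
  show ?thesis
    unfolding cleared_chart_def Let_def
    by (intro polynomial_function_Pair polynomial_function_diff polynomial_function_sum
        polynomial_function_scaleR f u c delta polynomial_function_snd polynomial_function_const) auto
qed

text \<open>A triple (w, c, v) is a value of the chart when w is orthogonal at some point of A and v
  is in N. \<open>dense_N\<close> then frees v and \<open>dense_W\<close> frees w, one variable at a
  time.\<close>

lemma chart_dense:
  assumes F: "real_polynomial_function F" and zero: "\<And>s z. s \<in> A \<Longrightarrow> F (chart s z) = 0"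
    and y: "y \<in> frame"
  shows "F y = 0"
proof -
  obtain w c v where wcv: "y = (w, c, v)" "c \<in> span (axes ` {..<Q})" "v \<in> M"
    using y by (auto simp: frame_def)
  have inN: "F (w, c, v) = 0" if s: "s \<in> A" and w: "\<forall>k<Q. w \<bullet> f k s = 0" and v: "v \<in> N" for s w v
  proof -
    obtain s' where s': "s' \<in> A" "u s' = v" "\<forall>k<Q. w \<bullet> f k s' = 0" using move[OF s v w] by blast
    \<comment> \<open>The vector with orthogonal part w and coefficients c at the moved point
      \<open>s'\<close>, where u has the value v.\<close>
    define z where "z = w + (\<Sum>k<Q. (c \<bullet> axes k) *\<^sub>R f k s')"
    have "(\<Sum>j<Q. (c \<bullet> axes j) * (f j s' \<bullet> f k s')) = (c \<bullet> axes k) * (f k s' \<bullet> f k s')" if "k < Q" for k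
    proof -
      have "(\<Sum>j<Q. (c \<bullet> axes j) * (f j s' \<bullet> f k s'))
          = (\<Sum>j<Q. if j = k then (c \<bullet> axes k) * (f k s' \<bullet> f k s') else 0)"
        using orth[OF s'(1)] that by (intro sum.cong) auto
      then show ?thesis using that by simp
    qed
    then have coeff: "(z \<bullet> f k s') / (f k s' \<bullet> f k s') = c \<bullet> axes k" if "k < Q" for k
      using that s'(3) nonzero[OF s'(1) that] by (simp add: z_def inner_add_left inner_sum_left)
    have "(\<Sum>k<Q. (x \<bullet> axes k) *\<^sub>R axes k) = x" if "x \<in> span (axes ` {..<Q})" for x
      using that
    proof (induction x rule: span_induct_alt)
      case (step a x y)
      then obtain i where i: "i < Q" "x = axes i" by auto
      have "(\<Sum>k<Q. (x \<bullet> axes k) *\<^sub>R axes k) = (\<Sum>k<Q. if k = i then axes i else 0)"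
        unfolding i(2) using axes_inner[OF i(1)] by (intro sum.cong) auto
      also have "\<dots> = x" using i by simp
      finally have "(\<Sum>k<Q. (x \<bullet> axes k) *\<^sub>R axes k) = x" .
      moreover have "(\<Sum>k<Q. ((a *\<^sub>R x + y) \<bullet> axes k) *\<^sub>R axes k)
          = a *\<^sub>R (\<Sum>k<Q. (x \<bullet> axes k) *\<^sub>R axes k) + (\<Sum>k<Q. (y \<bullet> axes k) *\<^sub>R axes k)"
        by (simp add: inner_add_left scaleR_add_left sum.distrib scaleR_sum_right)
      ultimately show ?case using step by simp
    qed simp
    from this[OF wcv(2)] have "chart s' z = (w, c, v)"
      unfolding chart_def Let_def s'(2) using coeff by (simp add: z_def)
    then show ?thesis using zero[OF s'(1), of z] by simp
  qed
  have inM: "F (w, c, v) = 0" if s: "s \<in> A" and w: "\<forall>k<Q. w \<bullet> f k s = 0" and v: "v \<in> M" for s w v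
  proof -
    have "polynomial_function (\<lambda>v :: 'u. (w, c, v))"
      by (intro polynomial_function_Pair polynomial_function_const polynomial_function_id)
    from real_polynomial_function_compose[OF this F]
    have "real_polynomial_function (\<lambda>v. F (w, c, v))" by (simp add: o_def)
    from dense_N[OF this] show ?thesis using inN[OF s w] v by blast
  qed
  have "polynomial_function (\<lambda>w :: 'e. (w, c, v))"
    by (intro polynomial_function_Pair polynomial_function_const polynomial_function_id)
  from real_polynomial_function_compose[OF this F]
  have "real_polynomial_function (\<lambda>w. F (w, c, v))" by (simp add: o_def)
  from dense_W[OF this] inM[OF _ _ wcv(3)] show ?thesis unfolding wcv(1) by blast
qed


lemma subspace_frame: "subspace frame"
  unfolding frame_def using M by (intro subspace_Times) auto

lemma dim_frame: "dim frame = DIM('e) + Q + dim M"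
proof -
  have "independent (axes ` {..<Q})"
    using axes(2) independent_Basis independent_mono by blast
  then have "dim (span (axes ` {..<Q})) = Q"
    using dim_span_eq_card_independent[of "axes ` {..<Q}"] card_image[OF axes(1)] by simp
  then show ?thesis
    unfolding frame_def using M by (simp add: dim_Times subspace_Times dim_UNIV)
qed

lemma frame_basis_exists:
  obtains bs where "finite bs" "bs \<subseteq> frame" "card bs = DIM('e) + Q + dim M"
    "\<And>a b. a \<in> bs \<Longrightarrow> b \<in> bs \<Longrightarrow> a \<bullet> b = (if a = b then 1 else 0)"
proof -
  obtain bs where bs: "bs \<subseteq> frame" "pairwise orthogonal bs" "\<And>x. x \<in> bs \<Longrightarrow> norm x = 1"
      "independent bs" "card bs = dim frame"
    using orthonormal_basis_subspace[OF subspace_frame] by metis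
  have "a \<bullet> b = (if a = b then 1 else 0)" if "a \<in> bs" "b \<in> bs" for a b
    using bs(2) bs(3)[OF that(1)] that by (auto simp: pairwise_def orthogonal_def norm_eq_1)
  then show ?thesis
    using that[of bs] bs(1,5) independent_bound[OF bs(4)] dim_frame by simp
qed

lemma affine_frame: "affine frame"
  by (rule subspace_imp_affine[OF subspace_frame])

text \<open>The multiplicative set that the prime has to avoid. It consists of nonzero polynomials
  in the chart, up to powers of \<open>delta\<close>, so modulo such a prime the coordinates of the
  chart satisfy no algebraic relation.\<close>

definition numerators :: "('s \<times> 'e) rpoly set" where
  "numerators = {g. \<exists>n F. real_polynomial_function F \<and> (\<exists>y\<in>frame. F y \<noteq> 0) \<and>
     (\<forall>s\<in>A. \<forall>z. rpoly_eval g (s, z) = delta s ^ n * F (chart s z))}"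

lemma one_in_numerators: "1 \<in> numerators"
proof -
  have "\<exists>y\<in>frame. (1 :: real) \<noteq> 0" using subspace_0[OF subspace_frame] by (intro bexI) simp
  then show ?thesis
    unfolding numerators_def
    by (intro CollectI exI[of _ 0] exI[of _ "\<lambda>_. 1"]) (auto intro: real_polynomial_function.intros(2))
qed

lemma numerators_mult:
  assumes "g \<in> numerators" "h \<in> numerators"
  shows "g * h \<in> numerators"
proof -
  obtain n F x where F: "real_polynomial_function F" "x \<in> frame" "F x \<noteq> 0"
      "\<And>s z. s \<in> A \<Longrightarrow> rpoly_eval g (s, z) = delta s ^ n * F (chart s z)"
    using assms(1) unfolding numerators_def by blast
  obtain m G y where G: "real_polynomial_function G" "y \<in> frame" "G y \<noteq> 0"
      "\<And>s z. s \<in> A \<Longrightarrow> rpoly_eval h (s, z) = delta s ^ m * G (chart s z)"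
    using assms(2) unfolding numerators_def by blast
  obtain z where z: "z \<in> frame" "F z \<noteq> 0" "G z \<noteq> 0"
    using real_polynomial_functions_common_nonzero[OF F(1,3,2) G(1,3,2) affine_frame] by blast
  have "real_polynomial_function (\<lambda>y. F y * G y)"
    using F(1) G(1) by (rule real_polynomial_function.intros(4))
  moreover have "F z * G z \<noteq> 0" using z by simp
  moreover have "rpoly_eval (g * h) (s, z) = delta s ^ (n + m) * (F (chart s z) * G (chart s z))"
    if "s \<in> A" for s z
    using F(4)[OF that] G(4)[OF that] by (simp add: power_add)
  ultimately show ?thesis
    unfolding numerators_def using z(1)
    by (intro CollectI exI[of _ "n + m"] exI[of _ "\<lambda>y. F y * G y"]) blast
qed

lemma vanishing_disjoint_numerators: "vanishing (A \<times> UNIV) \<inter> numerators = {}"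
proof (rule ccontr)
  assume "\<not> ?thesis"
  then obtain g where g: "g \<in> vanishing (A \<times> UNIV)" "g \<in> numerators" by blast
  then obtain n F y where F: "real_polynomial_function F" "y \<in> frame" "F y \<noteq> 0"
      "\<And>s z. s \<in> A \<Longrightarrow> rpoly_eval g (s, z) = delta s ^ n * F (chart s z)"
    unfolding numerators_def by blast
  have "F (chart s z) = 0" if "s \<in> A" for s z
    using F(4)[OF that, of z] g(1) that delta_nonzero[OF that] by (simp add: vanishing_def)
  then show False using chart_dense[OF F(1) _ F(2)] F(3) by blast
qed

text \<open>The chart has DIM('e) + Q + dim M independent coordinates on
  \<open>A \<times> UNIV\<close>, while all functions there are algebraic over a transcendence basis
  of those pulled back from A together with the DIM('e) coordinates of z. So that basis has at least
  Q + dim M elements, and it is independent modulo the contraction of the prime to A.\<close>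

theorem independent_functions_exist:
  "\<exists>P fs. ring_prime P \<and> vanishing A \<subseteq> P \<and> independent_mod P fs \<and> Q + dim M \<le> length fs"
proof -
  have "ring_ideal (vanishing (A \<times> (UNIV :: 'e set)))"
    by (auto simp: ring_ideal_def vanishing_def)
  from prime_avoiding_exists[OF this vanishing_disjoint_numerators one_in_numerators numerators_mult]
  obtain P where P: "ring_prime P" "vanishing (A \<times> UNIV) \<subseteq> P" "P \<inter> numerators = {}" .
  define \<psi> :: "'s rpoly \<Rightarrow> ('s \<times> 'e) rpoly" where "\<psi> = pullback fst"
  interpret \<psi>: algebra_hom \<psi>
    unfolding \<psi>_def by (rule algebra_hom_pullback[OF polynomial_function_fst])
  define Y where "Y = \<psi> ` coordinates"
  have finY: "finite Y" by (simp add: Y_def finite_coordinates)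
  obtain gs where gs: "set gs \<subseteq> Y" "independent_mod P gs"
      "\<And>y. y \<in> Y \<Longrightarrow> \<not> transcendental_over (algebra_hull (set gs)) P y"
    using transcendence_basis_exists[OF P(1) finY] by blast
  obtain fs where fs: "gs = map \<psi> fs"
    using gs(1) unfolding Y_def by (metis ex_map_conv image_iff subset_iff)
  define B where "B = set gs \<union> pullback snd ` coordinates"
  have finB: "finite B" by (simp add: B_def finite_coordinates)
  have alg: "\<not> transcendental_over (algebra_hull B) P y" if "y \<in> Y" for y
    by (rule not_transcendental_over_mono[OF gs(3)[OF that]])
      (rule algebra_hull_mono[OF _ finB], simp add: B_def)
  have hull: "algebra_hull (B \<union> Y) = UNIV"
  proof -
    have "coordinates \<subseteq> B \<union> Y" unfolding coordinates_prod by (auto simp: B_def Y_def \<psi>_def)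
    then have "algebra_hull coordinates \<subseteq> algebra_hull (B \<union> Y)"
      using finB finY by (intro algebra_hull_mono) auto
    then show ?thesis unfolding algebra_hull_coordinates by blast
  qed
  obtain bs where bs: "finite bs" "bs \<subseteq> frame" "card bs = DIM('e) + Q + dim M"
      "\<And>a b. a \<in> bs \<Longrightarrow> b \<in> bs \<Longrightarrow> a \<bullet> b = (if a = b then 1 else 0)"
    using frame_basis_exists by metis
  define num where "num = (\<lambda>b. Abs_rpoly (\<lambda>p. cleared_chart p \<bullet> b))"
  define den where "den = (Abs_rpoly (\<lambda>p. delta (fst p)) :: ('s \<times> 'e) rpoly)"
  have num: "rpoly_eval (num b) (s, z) = delta s * (chart s z \<bullet> b)" if "s \<in> A" for b s z
    using real_polynomial_function_inner[OF polynomial_cleared_chart polynomial_function_const]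
      cleared_chart[OF that] by (simp add: num_def)
  have "real_polynomial_function (\<lambda>p :: 's \<times> 'e. delta (fst p))"
    unfolding delta_def
    by (intro real_polynomial_function_prod real_polynomial_function_inner
        polynomial_function_compose[OF polynomial_function_fst poly_f]) auto
  then have den: "rpoly_eval den (s, z) = delta s" for s z
    by (simp add: den_def)
  obtain d where d: "insert den (num ` bs) \<subseteq> bounded_hull (B \<union> Y) d"
    using algebra_hull_eq_UNIV_bounded[OF _ hull, of "insert den (num ` bs)"] bs(1) by blast
  \<comment> \<open>Monomials in the numerators of the chart coordinates, filled up with
    \<open>den\<close> so that all carry the same power \<open>delta s ^ (card bs * D)\<close>. A
    combination of them is then this power times a single polynomial in the chart.\<close>
  define g where "g = (\<lambda>D \<alpha>. \<Prod>b\<in>bs. num b ^ \<alpha> b * den ^ (D - \<alpha> b))"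
  have "card bs \<le> card B"
  proof (rule independent_count[OF P(1) finB finY alg, where I = "\<lambda>D. bs \<rightarrow>\<^sub>E {..D}" and g = g
        and k = "card bs * d"])
    fix D :: nat
    show "finite (bs \<rightarrow>\<^sub>E {..D})" using bs(1) by (intro finite_PiE) auto
    show "(D + 1) ^ card bs \<le> card (bs \<rightarrow>\<^sub>E {..D})" using bs(1) by (simp add: card_PiE)
    fix \<alpha> assume \<alpha>: "\<alpha> \<in> bs \<rightarrow>\<^sub>E {..D}"
    have factor: "num b ^ \<alpha> b * den ^ (D - \<alpha> b) \<in> bounded_hull (B \<union> Y) (D * d)" if b: "b \<in> bs" for b
    proof -
      have "num b ^ \<alpha> b * den ^ (D - \<alpha> b) \<in> bounded_hull (B \<union> Y) (\<alpha> b * d + (D - \<alpha> b) * d)"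
        using d b by (intro bounded_hull_mult bounded_hull_power) auto
      moreover have "\<alpha> b \<le> D" using \<alpha> b by (auto simp: PiE_iff)
      ultimately show ?thesis by (simp add: add_mult_distrib[symmetric])
    qed
    have "(\<Prod>b\<in>bs. num b ^ \<alpha> b * den ^ (D - \<alpha> b)) \<in> bounded_hull (B \<union> Y) (card bs * (D * d))"
      by (rule bounded_hull_prod[OF bs(1)]) (rule factor)
    then show "g D \<alpha> \<in> bounded_hull (B \<union> Y) (card bs * d * D)" by (simp add: g_def ac_simps)
  next
    fix D :: nat and c assume in_P: "(\<Sum>\<alpha>\<in>bs \<rightarrow>\<^sub>E {..D}. c \<alpha> *\<^sub>R g D \<alpha>) \<in> P"
    define F where "F = (\<lambda>y. \<Sum>\<alpha>\<in>bs \<rightarrow>\<^sub>E {..D}. c \<alpha> * (\<Prod>b\<in>bs. (y \<bullet> b) ^ \<alpha> b))"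
    have polyF: "real_polynomial_function F"
      unfolding F_def
      by (intro real_polynomial_function_sum real_polynomial_function.intros(2,4)
          real_polynomial_function_prod real_polynomial_function_power
          real_polynomial_function_inner_const finite_PiE bs(1) finite_atMost)
    have g: "rpoly_eval (g D \<alpha>) (s, z) = delta s ^ (card bs * D) * (\<Prod>b\<in>bs. (chart s z \<bullet> b) ^ \<alpha> b)"
      if \<alpha>: "\<alpha> \<in> bs \<rightarrow>\<^sub>E {..D}" and s: "s \<in> A" for \<alpha> s z
    proof -
      have "rpoly_eval (g D \<alpha>) (s, z) = (\<Prod>b\<in>bs. delta s ^ D * (chart s z \<bullet> b) ^ \<alpha> b)"
        unfolding g_def rpoly_eval_prod
      proof (intro prod.cong refl)
        fix b assume "b \<in> bs"
        then have "\<alpha> b \<le> D" using \<alpha> by (auto simp: PiE_iff)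
        then have "delta s ^ D = delta s ^ \<alpha> b * delta s ^ (D - \<alpha> b)" by (simp add: power_add[symmetric])
        then show "rpoly_eval (num b ^ \<alpha> b * den ^ (D - \<alpha> b)) (s, z)
            = delta s ^ D * (chart s z \<bullet> b) ^ \<alpha> b"
          by (simp add: num[OF s] den power_mult_distrib)
      qed
      then show ?thesis by (simp add: prod.distrib power_mult[symmetric] mult.commute)
    qed
    have "rpoly_eval (\<Sum>\<alpha>\<in>bs \<rightarrow>\<^sub>E {..D}. c \<alpha> *\<^sub>R g D \<alpha>) (s, z) = delta s ^ (card bs * D) * F (chart s z)"
      if s: "s \<in> A" for s z
      unfolding F_def sum_distrib_left rpoly_eval_sum
      by (intro sum.cong refl) (simp add: g[OF _ s])
    \<comment> \<open>If F were nonzero somewhere on \<open>frame\<close>, the combination would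
      belong to \<open>numerators\<close>, which P avoids.\<close>
    then have zeroF: "F y = 0" if "y \<in> frame" for y
      using in_P P(3) polyF that unfolding numerators_def by blast
    have "(\<Sum>\<alpha>\<in>bs \<rightarrow>\<^sub>E {..D}. c \<alpha> * (\<Prod>b\<in>bs. x b ^ \<alpha> b)) = 0" for x
    proof -
      define y where "y = (\<Sum>b\<in>bs. x b *\<^sub>R b)"
      have "y \<in> frame" unfolding y_def using bs(2) subspace_frame by (intro subspace_sum subspace_scale) auto
      moreover have "y \<bullet> b = x b" if "b \<in> bs" for b
      proof -
        have "y \<bullet> b = (\<Sum>a\<in>bs. if a = b then x b else 0)"
          unfolding y_def inner_sum_left using bs(4)[OF _ that] by (intro sum.cong) auto
        then show ?thesis using that bs(1) by simp
      qed
      ultimately show ?thesis using zeroF[of y] unfolding F_def by simp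
    qed
    then show "\<forall>\<alpha>\<in>bs \<rightarrow>\<^sub>E {..D}. c \<alpha> = 0"
      by (rule monomials_eq_0_imp_coeffs_eq_0[OF bs(1)])
  qed
  also have "card B \<le> length gs + DIM('e)"
  proof -
    have "card (pullback snd ` coordinates :: ('s \<times> 'e) rpoly set) \<le> card (coordinates :: 'e rpoly set)"
      by (rule card_image_le[OF finite_coordinates])
    also have "\<dots> \<le> DIM('e)" unfolding coordinates_def by (rule card_image_le) simp
    finally show ?thesis
      unfolding B_def using card_Un_le[of "set gs" "pullback snd ` coordinates"] card_length[of gs]
      by linarith
  qed
  finally have "Q + dim M \<le> length fs" using bs(3) fs by simp
  moreover have "vanishing A \<subseteq> \<psi> -` P"
  proof
    fix f assume "f \<in> vanishing A"
    then have "\<psi> f \<in> vanishing (A \<times> UNIV)"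
      by (auto simp: vanishing_def \<psi>_def polynomial_function_fst)
    then show "f \<in> \<psi> -` P" using P(2) by blast
  qed
  moreover have "independent_mod (\<psi> -` P) fs" using gs(2) fs \<psi>.independent_mod_vimage by simp
  ultimately show ?thesis using \<psi>.ring_prime_vimage[OF P(1)] by blast
qed

end

lemma vanishing_antimono: "A \<subseteq> B \<Longrightarrow> vanishing B \<subseteq> vanishing A"
  by (auto simp: vanishing_def)

lemma orthogonal_span_zero:
  assumes "x \<in> span S" "\<And>y. y \<in> S \<Longrightarrow> w \<bullet> y = 0"
  shows "w \<bullet> x = 0"
  using assms(1)
  by (induction x rule: span_induct_alt) (simp_all add: inner_add_right assms(2))

text \<open>Replaces the orthogonal system of the locale by one that is merely independent on A.
  After orthogonalization both systems have the same span at each point of A, hence the same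
  orthogonal complement.\<close>

theorem semialg_dim_ge_of_dense:
  fixes A B :: "'s::euclidean_space set" and e :: "nat \<Rightarrow> 's \<Rightarrow> 'e::euclidean_space"
    and u :: "'s \<Rightarrow> 'u::euclidean_space" and M N :: "'u set"
  assumes poly_e: "\<forall>k<Q. polynomial_function (e k)"
    and indep: "\<And>s k. s \<in> A \<Longrightarrow> k < Q \<Longrightarrow> e k s \<notin> span ((\<lambda>j. e j s) ` {..<k})"
    and u: "polynomial_function u" and M: "subspace M"
    and dense_N: "\<And>F. real_polynomial_function F \<Longrightarrow> (\<forall>x\<in>N. F x = 0) \<Longrightarrow> (\<forall>x\<in>M. F x = 0)"
    and move: "\<And>s v. s \<in> A \<Longrightarrow> v \<in> N \<Longrightarrow>
      \<exists>s'\<in>A. u s' = v \<and> (\<forall>k<Q. e k s' \<in> span ((\<lambda>j. e j s) ` {..<Q}))"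
    and dense_W: "\<And>F. real_polynomial_function F \<Longrightarrow>
      (\<And>w s. s \<in> A \<Longrightarrow> \<forall>k<Q. w \<bullet> e k s = 0 \<Longrightarrow> F w = 0) \<Longrightarrow> (\<forall>w. F w = 0)"
    and AB: "A \<subseteq> B"
  shows "semialg_dim B \<ge> ereal (real (Q + dim M))"
proof -
  obtain f :: "nat \<Rightarrow> 's \<Rightarrow> 'e"
    where f: "\<forall>k<Q. polynomial_function (f k)"
      "\<forall>k<Q. \<forall>s. f k s \<in> span ((\<lambda>j. e j s) ` {..k})"
      "\<forall>k<Q. \<forall>j<k. \<forall>s. f k s \<bullet> f j s = 0"
      "\<forall>s. (\<forall>k<Q. e k s \<notin> span ((\<lambda>j. e j s) ` {..<k})) \<longrightarrow> (\<forall>k<Q. f k s \<noteq> 0)"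
    using polynomial_orthogonalization[OF poly_e] by (elim exE conjE)
  have perp: "w \<bullet> f k s = 0" if w: "\<forall>k<Q. w \<bullet> e k s = 0" and k: "k < Q" for w k s
    using w k by (intro orthogonal_span_zero[OF f(2)[rule_format, OF k]]) auto
  have nz: "f k s \<noteq> 0" if "s \<in> A" "k < Q" for k s
    using f(4) indep[OF that(1)] that(2) by blast
  have orth: "f j s \<bullet> f k s = 0" if "j < Q" "k < Q" "j \<noteq> k" for j k s
    using f(3) that by (metis inner_commute nat_neq_iff)
  have eq: "(\<forall>k<Q. w \<bullet> f k s = 0) \<longleftrightarrow> (\<forall>k<Q. w \<bullet> e k s = 0)" if s: "s \<in> A" for w s
  proof
    assume *: "\<forall>k<Q. w \<bullet> f k s = 0"
    have inj: "inj_on (\<lambda>k. f k s) {..<Q}"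
      using orth nz[OF s] unfolding inj_on_def by (metis inner_eq_zero_iff lessThan_iff)
    have "pairwise orthogonal ((\<lambda>k. f k s) ` {..<Q})"
      unfolding pairwise_def orthogonal_def using orth by force
    then have ind: "independent ((\<lambda>k. f k s) ` {..<Q})"
      using nz[OF s] by (intro pairwise_orthogonal_independent) auto
    have sub: "(\<lambda>k. f k s) ` {..<Q} \<subseteq> span ((\<lambda>k. e k s) ` {..<Q})"
    proof clarify
      fix k assume "k < Q"
      then have "span ((\<lambda>j. e j s) ` {..k}) \<subseteq> span ((\<lambda>j. e j s) ` {..<Q})"
        by (intro span_mono) auto
      then show "f k s \<in> span ((\<lambda>k. e k s) ` {..<Q})" using f(2) \<open>k < Q\<close> by blast
    qed
    \<comment> \<open>The f k are Q independent vectors in a space of dimension at most Q, so they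
      span it.\<close>
    have "dim (span ((\<lambda>k. e k s) ` {..<Q})) \<le> card ((\<lambda>k. f k s) ` {..<Q})"
      using dim_le_card'[of "(\<lambda>k. e k s) ` {..<Q}"] card_image_le[of "{..<Q}" "\<lambda>k. e k s"] inj
      by (simp add: card_image)
    from card_ge_dim_independent[OF sub ind this]
    have e_span: "e k s \<in> span ((\<lambda>k. f k s) ` {..<Q})" if "k < Q" for k
      using that by (auto intro: span_base)
    show "\<forall>k<Q. w \<bullet> e k s = 0"
    proof (intro allI impI)
      fix k assume "k < Q"
      then show "w \<bullet> e k s = 0" using * by (intro orthogonal_span_zero[OF e_span]) auto
    qed
  qed (use perp in blast)
  interpret dense_incidence A f Q u M N
  proof
    fix s v w assume s: "s \<in> A" and v: "v \<in> N" and w: "\<forall>k<Q. w \<bullet> f k s = 0"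
    obtain s' where s': "s' \<in> A" "u s' = v" "\<forall>k<Q. e k s' \<in> span ((\<lambda>j. e j s) ` {..<Q})"
      using move[OF s v] by blast
    have "\<forall>k<Q. w \<bullet> e k s = 0" using w eq[OF s] by blast
    then have "w \<bullet> e k s' = 0" if "k < Q" for k
      using s'(3) that by (intro orthogonal_span_zero[of "e k s'" "(\<lambda>j. e j s) ` {..<Q}"]) auto
    then have "\<forall>k<Q. w \<bullet> f k s' = 0" using eq[OF s'(1)] by blast
    then show "\<exists>s'\<in>A. u s' = v \<and> (\<forall>k<Q. w \<bullet> f k s' = 0)" using s' by blast
  next
    fix F :: "'e \<Rightarrow> real" assume "real_polynomial_function F"
      and "\<And>w s. s \<in> A \<Longrightarrow> \<forall>k<Q. w \<bullet> f k s = 0 \<Longrightarrow> F w = 0"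
    then show "\<forall>w. F w = 0" using eq by (intro dense_W) simp_all
  qed (use f(1) orth nz u M dense_N in auto)
  obtain P fs where "ring_prime P" "vanishing A \<subseteq> P" "independent_mod P fs" "Q + dim M \<le> length fs"
    using independent_functions_exist by blast
  moreover from this vanishing_antimono[OF AB]
  have "semialg_dim B \<ge> ereal (real (length fs))" by (intro semialg_dim_ge_independent) auto
  ultimately show ?thesis
    by (meson ereal_less_eq(3) of_nat_le_iff order_trans)
qed

section \<open>Isometric actions of finite groups\<close>

lemma finite_common_nonzero:
  assumes "finite T" "\<And>t. t \<in> T \<Longrightarrow> real_polynomial_function (F t)" "\<And>t. t \<in> T \<Longrightarrow> \<exists>x. F t x \<noteq> 0"
  shows "\<exists>x. (\<Prod>t\<in>T. F t x) \<noteq> 0"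
  using assms
proof (induction T rule: finite_induct)
  case (insert t T)
  obtain x where "(\<Prod>t\<in>T. F t x) \<noteq> 0" using insert by auto
  moreover obtain y where "F t y \<noteq> 0" using insert.prems by auto
  moreover have "real_polynomial_function (\<lambda>x. \<Prod>t\<in>T. F t x)"
    using insert by (intro real_polynomial_function_prod) auto
  ultimately obtain z where "F t z \<noteq> 0" "(\<Prod>t\<in>T. F t z) \<noteq> 0"
    using real_polynomial_functions_common_nonzero[where M = UNIV and F = "F t" and x = y
        and G = "\<lambda>x. \<Prod>t\<in>T. F t x" and y = x] insert.prems(1)[of t] by auto
  then show ?case using insert.hyps by (intro exI[of _ z]) auto
qed simp

text \<open>The exceptional sets \<open>W t\<close> may be arbitrary as long as each lies in a
  proper zero set. The product of the finitely many polynomials is nonzero somewhere, and where it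
  is nonzero Q holds.\<close>

lemma zariski_generic_finite_cover:
  fixes Q :: "'a::euclidean_space \<Rightarrow> bool"
  assumes T: "finite T" and cover: "\<And>w. \<not> Q w \<Longrightarrow> \<exists>t\<in>T. w \<in> W t"
    and F: "\<And>t. t \<in> T \<Longrightarrow> \<exists>F. real_polynomial_function F \<and> (\<forall>w\<in>W t. F w = 0) \<and> (\<exists>w. F w \<noteq> 0)"
  shows "zariski_generic Q"
proof -
  obtain F where F: "\<And>t. t \<in> T \<Longrightarrow> real_polynomial_function (F t)"
      "\<And>t w. t \<in> T \<Longrightarrow> w \<in> W t \<Longrightarrow> F t w = 0" "\<And>t. t \<in> T \<Longrightarrow> \<exists>w. F t w \<noteq> 0"
    using F by metis
  define P where "P = (\<lambda>w. \<Prod>t\<in>T. F t w)"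
  have "real_polynomial_function P"
    unfolding P_def using T F(1) by (intro real_polynomial_function_prod) auto
  then have "zariski_open {w. P w \<noteq> 0}"
    unfolding zariski_open_def zariski_closed_def by (intro exI[of _ "{P}"]) auto
  moreover have "{w. P w \<noteq> 0} \<noteq> {}"
    using finite_common_nonzero[of T F] T F(1,3) by (auto simp: P_def)
  moreover have "Q w" if "P w \<noteq> 0" for w
  proof (rule ccontr)
    assume "\<not> Q w"
    then obtain t where "t \<in> T" "w \<in> W t" using cover by blast
    then show False using F(2) T that by (auto simp: P_def)
  qed
  ultimately show ?thesis unfolding zariski_generic_def by (intro exI[of _ "{w. P w \<noteq> 0}"]) auto
qed

lemma linear_imp_polynomial_function:
  fixes f :: "'a::euclidean_space \<Rightarrow> 'b::euclidean_space"
  shows "linear f \<Longrightarrow> polynomial_function f"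
  by (simp add: polynomial_function_bounded_linear linear_conv_bounded_linear)

text \<open>Choosing indices instead of vectors leaves finitely many possibilities that do not
  depend on the point at which the vectors are evaluated.\<close>

lemma spanning_index_subset:
  fixes v :: "'i \<Rightarrow> 'v::euclidean_space"
  obtains K where "K \<subseteq> I" "inj_on v K" "independent (v ` K)" "span (v ` K) = span (v ` I)"
proof -
  obtain B where B: "B \<subseteq> v ` I" "independent B" "v ` I \<subseteq> span B"
    using maximal_independent_subset by metis
  then obtain K where "K \<subseteq> I" "inj_on v K" "B = v ` K" unfolding subset_image_inj by blast
  moreover have "span B = span (v ` I)" using B(1,3) by (simp add: span_eq span_superset subset_trans)
  ultimately show ?thesis using that B(2) by blast
qed

section \<open>Pairs of points with prescribed bases of differences, and their motions\<close>

locale isometric_action =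
  fixes G :: "('g, 'm) monoid_scheme" and U :: "'g \<Rightarrow> 'v::euclidean_space \<Rightarrow> 'v"
  assumes fin: "finite (carrier G)" and act: "group_action G UNIV U"
    and isometry: "\<forall>g\<in>carrier G. orthogonal_transformation (U g)"
begin

lemma linear_U: "g \<in> carrier G \<Longrightarrow> linear (U g)"
  using isometry by (simp add: orthogonal_transformation_def)

lemma subspace_fixed_space: "subspace (fixed_space G U)"
  unfolding subspace_def fixed_space_def
  using linear_0[OF linear_U] linear_add[OF linear_U] linear_scale[OF linear_U] by auto

text \<open>A linear retraction onto the fixed space; it reads off the translation parameter of a
  pair.\<close>

definition fixed_proj :: "'v \<Rightarrow> 'v" where
  "fixed_proj = (SOME P. range P \<subseteq> fixed_space G U \<and> linear P \<and> (\<forall>v\<in>fixed_space G U. P v = v))"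

lemma fixed_proj:
  "fixed_proj x \<in> fixed_space G U" "linear fixed_proj" "v \<in> fixed_space G U \<Longrightarrow> fixed_proj v = v"
proof -
  have "\<exists>P. range P \<subseteq> fixed_space G U \<and> linear P \<and> (\<forall>v\<in>fixed_space G U. P (id v) = v)"
    by (rule linear_exists_left_inverse_on) (simp_all add: subspace_fixed_space linear_ident)
  from someI_ex[OF this] show "fixed_proj x \<in> fixed_space G U" "linear fixed_proj"
    "v \<in> fixed_space G U \<Longrightarrow> fixed_proj v = v"
    unfolding fixed_proj_def by auto
qed

definition tuple_diff :: "'g list \<Rightarrow> 'g list \<Rightarrow> nat \<Rightarrow> 'v \<times> 'v \<Rightarrow> 'v" where
  "tuple_diff g h k s = U (g ! k) (fst s) - U (h ! k) (snd s)"

lemma Gamma_set_eq: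
  "Gamma_set U n g h q = {s. dim (span ((\<lambda>k. tuple_diff g h k s) ` {..<n})) = q}"
proof -
  have "{U (g ! k) x - U (h ! k) y | k. k < n} = (\<lambda>k. tuple_diff g h k (x, y)) ` {..<n}" for x y
    by (auto simp: tuple_diff_def)
  then show ?thesis by (auto simp: Gamma_set_def)
qed

lemma distinct_tuples_nth: "g \<in> distinct_tuples G n \<Longrightarrow> k < n \<Longrightarrow> g ! k \<in> carrier G"
  by (auto simp: distinct_tuples_def subset_iff)

lemma linear_tuple_diff:
  assumes "g \<in> distinct_tuples G n" "h \<in> distinct_tuples G n" "k < n"
  shows "linear (tuple_diff g h k)"
proof -
  have "linear (U (g ! k) \<circ> fst)" "linear (U (h ! k) \<circ> snd)"
    using linear_U[OF distinct_tuples_nth] assms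
    by (auto intro!: linear_compose linear_fst linear_snd)
  from linear_compose_sub[OF this] show ?thesis by (simp add: tuple_diff_def[abs_def])
qed

lemma tuple_diff_fixed:
  assumes "g \<in> distinct_tuples G n" "h \<in> distinct_tuples G n" "k < n" "v \<in> fixed_space G U"
  shows "tuple_diff g h k (v, v) = 0"
  using assms distinct_tuples_nth by (auto simp: tuple_diff_def fixed_space_def)

text \<open>The part of the intersection of the \<Gamma> sets on which the differences with indices
  in \<open>K i\<close> form a basis of the i-th span. Fixing the indices makes these bases
  polynomial in the pair.\<close>

definition piece :: "('p \<Rightarrow> nat) \<Rightarrow> ('p \<Rightarrow> 'g list) \<Rightarrow> ('p \<Rightarrow> 'g list) \<Rightarrow> ('p \<Rightarrow> nat set) \<Rightarrow> ('v \<times> 'v) set" where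
  "piece n g h K = {s. \<forall>i. inj_on (\<lambda>k. tuple_diff (g i) (h i) k s) (K i) \<and>
     independent ((\<lambda>k. tuple_diff (g i) (h i) k s) ` K i) \<and>
     span ((\<lambda>k. tuple_diff (g i) (h i) k s) ` K i) = span ((\<lambda>k. tuple_diff (g i) (h i) k s) ` {..<n i})}"

lemma piece_subset_Gamma: "piece n g h K \<subseteq> Gamma_set U (n i) (g i) (h i) (card (K i))"
proof
  fix s assume "s \<in> piece n g h K"
  then have "dim (span ((\<lambda>k. tuple_diff (g i) (h i) k s) ` {..<n i})) = card (K i)"
    unfolding piece_def mem_Collect_eq by (metis card_image dim_span_eq_card_independent)
  then show "s \<in> Gamma_set U (n i) (g i) (h i) (card (K i))" by (simp add: Gamma_set_eq)
qed

lemma piece_scale: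
  assumes s: "s \<in> piece n g h K" and t: "t \<noteq> 0" and K: "\<And>i. K i \<subseteq> {..<n i}"
    and eq: "\<And>i k. k < n i \<Longrightarrow> tuple_diff (g i) (h i) k s' = t *\<^sub>R tuple_diff (g i) (h i) k s"
  shows "s' \<in> piece n g h K"
  unfolding piece_def
proof (intro CollectI allI conjI)
  fix i
  let ?v = "\<lambda>s k. tuple_diff (g i) (h i) k s"
  have v: "inj_on (?v s) (K i)" "independent (?v s ` K i)" "span (?v s ` K i) = span (?v s ` {..<n i})"
    using s unfolding piece_def by auto
  have inj: "inj ((*\<^sub>R) t :: 'v \<Rightarrow> 'v)" using t by (simp add: inj_on_def)
  have lin: "linear ((*\<^sub>R) t :: 'v \<Rightarrow> 'v)" by (rule linear_scale_self)
  have img: "?v s' ` J = (*\<^sub>R) t ` (?v s ` J)" if "J \<subseteq> {..<n i}" for J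
    unfolding image_image using eq that by (intro image_cong) auto
  show "inj_on (?v s') (K i)"
    using v(1) eq K[of i] t unfolding inj_on_def by (metis lessThan_iff scaleR_cancel_left subset_iff)
  show "independent (?v s' ` K i)"
    unfolding img[OF K] using linear_independent_injective_image[OF lin v(2)] inj
    by (metis inj_on_subset subset_UNIV)
  show "span (?v s' ` K i) = span (?v s' ` {..<n i})"
    unfolding img[OF K] img[OF subset_refl] linear_span_image[OF lin] v(3) ..
qed

text \<open>The squared distance of s from the diagonal point (m, m) with
  \<open>m = fixed_proj (fst s)\<close>. It is invariant under translation by (v, v) with v fixed
  and quadratic under scaling, and thus gives the one parameter beyond d_G.\<close>

definition slice_norm :: "'v \<times> 'v \<Rightarrow> real" where
  "slice_norm s = (fst s - fixed_proj (fst s)) \<bullet> (fst s - fixed_proj (fst s))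
     + (snd s - fixed_proj (fst s)) \<bullet> (snd s - fixed_proj (fst s))"

text \<open>At value 0 the pair is (m, m) with m fixed, so all differences vanish; but a nonempty
  independent family does not contain 0.\<close>

lemma slice_norm_pos:
  assumes s: "s \<in> piece n g h K" and gh: "\<And>i. g i \<in> distinct_tuples G (n i)" "\<And>i. h i \<in> distinct_tuples G (n i)"
    and K: "K i \<subseteq> {..<n i}" "K i \<noteq> {}"
  shows "slice_norm s > 0"
proof (rule ccontr)
  assume "\<not> ?thesis"
  then have "slice_norm s = 0"
    using inner_ge_zero[of "fst s - fixed_proj (fst s)"] inner_ge_zero[of "snd s - fixed_proj (fst s)"]
    unfolding slice_norm_def by linarith
  then have "fst s = fixed_proj (fst s)" "snd s = fixed_proj (fst s)"
    by (auto simp: slice_norm_def add_nonneg_eq_0_iff)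
  then have "s = (fixed_proj (fst s), fixed_proj (fst s))" by (metis prod.collapse)
  moreover obtain k where k: "k \<in> K i" using K(2) by blast
  ultimately have "tuple_diff (g i) (h i) k s = 0"
    using tuple_diff_fixed[OF gh[of i] _ fixed_proj(1)] K(1) by (metis lessThan_iff subsetD)
  then have "0 \<in> (\<lambda>k. tuple_diff (g i) (h i) k s) ` K i" using k by force
  then have "dependent ((\<lambda>k. tuple_diff (g i) (h i) k s) ` K i)" by (rule dependent_zero)
  then show False using s by (simp add: piece_def)
qed

lemma piece_move:
  assumes s: "s \<in> piece n g h K" and gh: "\<And>i. g i \<in> distinct_tuples G (n i)" "\<And>i. h i \<in> distinct_tuples G (n i)"
    and K: "\<And>i. K i \<subseteq> {..<n i}" and pos: "slice_norm s > 0" and v: "v \<in> fixed_space G U" and r: "r > 0"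
  obtains s' t where "s' \<in> piece n g h K" "fixed_proj (fst s') = v" "slice_norm s' = r"
    "\<And>i k. k < n i \<Longrightarrow> tuple_diff (g i) (h i) k s' = t *\<^sub>R tuple_diff (g i) (h i) k s"
proof -
  \<comment> \<open>\<open>slice_norm\<close> scales by the square of t. The translation in
    \<open>s'\<close> afterwards corrects the projection from \<open>t *\<^sub>R m\<close> to v
    without changing the norm or the differences.\<close>
  define t where "t = sqrt (r / slice_norm s)"
  have t: "t \<noteq> 0" "t * t = r / slice_norm s" using pos r by (auto simp: t_def)
  define m where "m = fixed_proj (fst s)"
  define s' where "s' = t *\<^sub>R s + (v - t *\<^sub>R m, v - t *\<^sub>R m)"
  have m: "m \<in> fixed_space G U" unfolding m_def by (rule fixed_proj)
  have vm: "v - t *\<^sub>R m \<in> fixed_space G U"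
    using subspace_fixed_space v m by (intro subspace_diff subspace_scale)
  have eq: "tuple_diff (g i) (h i) k s' = t *\<^sub>R tuple_diff (g i) (h i) k s" if "k < n i" for i k
    unfolding s'_def using linear_tuple_diff[OF gh[of i] that] tuple_diff_fixed[OF gh[of i] that vm]
    by (simp add: linear_add linear_scale)
  have fst: "fst s' = t *\<^sub>R fst s + (v - t *\<^sub>R m)" and snd: "snd s' = t *\<^sub>R snd s + (v - t *\<^sub>R m)"
    by (simp_all add: s'_def)
  have proj: "fixed_proj (fst s') = v"
    unfolding fst linear_add[OF fixed_proj(2)] linear_scale[OF fixed_proj(2)] fixed_proj(3)[OF vm]
    by (simp add: m_def)
  have "slice_norm s' = (t *\<^sub>R (fst s - m)) \<bullet> (t *\<^sub>R (fst s - m)) + (t *\<^sub>R (snd s - m)) \<bullet> (t *\<^sub>R (snd s - m))"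
    unfolding slice_norm_def proj unfolding fst snd by (simp add: scaleR_diff_right)
  also have "\<dots> = (t * t) * slice_norm s"
    by (simp only: inner_scaleR_left inner_scaleR_right slice_norm_def m_def distrib_left mult.assoc)
  also have "\<dots> = r" using t(2) pos by simp
  finally show ?thesis using that[of s' t] piece_scale[OF s t(1) K eq] proj eq by blast
qed

lemma polynomial_slice: "polynomial_function (\<lambda>s. (fixed_proj (fst s), slice_norm s))"
proof -
  have P: "polynomial_function (\<lambda>s :: 'v \<times> 'v. fixed_proj (fst s))"
    using linear_compose[OF linear_fst fixed_proj(2)]
    by (intro linear_imp_polynomial_function) (simp add: o_def)
  have "real_polynomial_function slice_norm"
    unfolding slice_norm_def
    by (intro real_polynomial_function.intros(3) real_polynomial_function_inner
        polynomial_function_diff P polynomial_function_fst polynomial_function_snd)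
  then show ?thesis
    using P by (intro polynomial_function_Pair) (simp_all add: real_polynomial_function_eq)
qed

text \<open>\<open>slice_norm\<close> takes only positive values on the pieces considered, but a
  polynomial that vanishes on a ray vanishes on its line.\<close>

lemma half_space_dense:
  assumes F: "real_polynomial_function (F :: 'v \<times> real \<Rightarrow> real)"
    and zero: "\<forall>x\<in>V \<times> {0<..}. F x = 0"
  shows "\<forall>x\<in>V \<times> UNIV. F x = 0"
proof (rule ccontr)
  assume "\<not> ?thesis"
  then obtain v r where v: "v \<in> V" and "F (v, r) \<noteq> 0" by auto
  from real_polynomial_function_line_zeros[OF F this(2), of "(v, r + 1)"]
  have "finite {t. F (v, r + t) = 0}" by simp
  moreover have "{- r<..} \<subseteq> {t. F (v, r + t) = 0}" using zero v by auto
  ultimately have "finite {- r<..}" by (rule rev_finite_subset)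
  then show False using infinite_Ioi by blast
qed

text \<open>The parameter map consists of \<open>fixed_proj\<close> and \<open>slice_norm\<close>,
  with values in the fixed space times the reals; this target has dimension d_G + 1. Since
  \<open>piece\<close> lies in the \<Gamma> sets of all i at once, the bound holds for each
  i.\<close>

theorem semialg_dim_Gamma_ge:
  fixes n :: "'p::finite \<Rightarrow> nat"
  assumes gh: "\<And>i. g i \<in> distinct_tuples G (n i)" "\<And>i. h i \<in> distinct_tuples G (n i)"
    and K: "\<And>i. K i \<subseteq> {..<n i}" "\<And>i. K i \<noteq> {}"
    and dense: "\<And>F :: 'v ^ 'p \<Rightarrow> real. real_polynomial_function F \<Longrightarrow>
      (\<And>w s. s \<in> piece n g h K \<Longrightarrow> \<forall>i. \<forall>k\<in>K i. w $ i \<bullet> tuple_diff (g i) (h i) k s = 0 \<Longrightarrow> F w = 0) \<Longrightarrow>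
      (\<forall>w. F w = 0)"
  shows "semialg_dim (Gamma_set U (n i) (g i) (h i) (card (K i)))
    \<ge> ereal (real ((\<Sum>i\<in>UNIV. card (K i)) + (dim (fixed_space G U) + 1)))"
proof -
  define Q where "Q = (\<Sum>i\<in>UNIV. card (K i))"
  have finK: "finite (K i)" for i using K(1)[of i] finite_subset by blast
  have "card (SIGMA i:UNIV. K i) = Q" using finK by (simp add: Q_def)
  moreover have "finite (SIGMA i:UNIV. K i)" using finK by (intro finite_SigmaI) auto
  ultimately obtain \<phi> where \<phi>: "bij_betw \<phi> {..<Q} (SIGMA i:UNIV. K i)"
    using ex_bij_betw_nat_finite[of "SIGMA i:UNIV. K i"] by (auto simp: atLeast0LessThan)
  have \<phi>_in: "snd (\<phi> k) \<in> K (fst (\<phi> k))" if "k < Q" for k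
  proof -
    have "\<phi> k \<in> (SIGMA i:UNIV. K i)" using bij_betwE[OF \<phi>] that by simp
    then show ?thesis by (auto simp: mem_Sigma_iff split: prod.splits)
  qed
  \<comment> \<open>The conditions on all components of w become Q conditions on w as a whole: each
    difference is placed in its component of \<open>'v ^ 'p\<close>, zero elsewhere.\<close>
  define e :: "nat \<Rightarrow> 'v \<times> 'v \<Rightarrow> 'v ^ 'p" where
    "e = (\<lambda>k s. axis (fst (\<phi> k)) (tuple_diff (g (fst (\<phi> k))) (h (fst (\<phi> k))) (snd (\<phi> k)) s))"
  have lin_axis: "linear (axis i :: 'v \<Rightarrow> 'v ^ 'p)" for i
    by (rule linearI) (auto simp: axis_def vec_eq_iff)
  have e_perp: "(\<forall>k<Q. w \<bullet> e k s = 0) \<longleftrightarrow> (\<forall>i. \<forall>k\<in>K i. w $ i \<bullet> tuple_diff (g i) (h i) k s = 0)" for w s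
  proof -
    have "(\<forall>k<Q. w \<bullet> e k s = 0)
        \<longleftrightarrow> (\<forall>p\<in>\<phi> ` {..<Q}. w $ fst p \<bullet> tuple_diff (g (fst p)) (h (fst p)) (snd p) s = 0)"
      unfolding ball_simps(9) by (auto simp: e_def inner_axis)
    then show ?thesis unfolding bij_betw_imp_surj_on[OF \<phi>] by auto
  qed
  have "semialg_dim (Gamma_set U (n i) (g i) (h i) (card (K i)))
      \<ge> ereal (real (Q + dim (fixed_space G U \<times> (UNIV :: real set))))"
  proof (rule semialg_dim_ge_of_dense[where A = "piece n g h K" and e = e
        and u = "\<lambda>s. (fixed_proj (fst s), slice_norm s)" and N = "fixed_space G U \<times> {0<..}"])
    show "\<forall>k<Q. polynomial_function (e k)"
    proof (intro allI impI)
      fix k assume "k < Q"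
      then have "linear (tuple_diff (g (fst (\<phi> k))) (h (fst (\<phi> k))) (snd (\<phi> k)))"
        using \<phi>_in K(1) by (intro linear_tuple_diff[OF gh]) blast
      from linear_compose[OF this lin_axis] show "polynomial_function (e k)"
        by (intro linear_imp_polynomial_function) (simp add: e_def o_def)
    qed
  next
    fix s k assume s: "s \<in> piece n g h K" and k: "k < Q"
    define i where "i = fst (\<phi> k)"
    define v where "v = (\<lambda>k. tuple_diff (g i) (h i) k s)"
    have v: "inj_on v (K i)" "independent (v ` K i)" using s unfolding piece_def v_def by auto
    have lin: "linear (\<lambda>w :: 'v ^ 'p. w $ i)" by (rule linearI) auto
    show "e k s \<notin> span ((\<lambda>j. e j s) ` {..<k})"
    proof
      assume "e k s \<in> span ((\<lambda>j. e j s) ` {..<k})"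
      then have "e k s $ i \<in> (\<lambda>w. w $ i) ` span ((\<lambda>j. e j s) ` {..<k})" by blast
      also have "\<dots> = span ((\<lambda>w. w $ i) ` (\<lambda>j. e j s) ` {..<k})"
        by (rule linear_span_image[OF lin, symmetric])
      finally have in_span: "e k s $ i \<in> span ((\<lambda>w. w $ i) ` (\<lambda>j. e j s) ` {..<k})" .
      \<comment> \<open>In component i the vectors placed in other components become 0, and those of
        the same component are basis vectors different from the k-th, by injectivity on
        \<open>K i\<close>.\<close>
      have "(\<lambda>w. w $ i) ` (\<lambda>j. e j s) ` {..<k} \<subseteq> insert 0 (v ` K i - {v (snd (\<phi> k))})"
      proof clarify
        fix j assume j: "j < k" "e j s $ i \<notin> v ` K i - {v (snd (\<phi> k))}"
        show "e j s $ i = 0"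
        proof (rule ccontr)
          assume "e j s $ i \<noteq> 0"
          then have i: "fst (\<phi> j) = i" by (auto simp: e_def axis_def split: if_splits)
          then have ej: "e j s $ i = v (snd (\<phi> j))" by (simp add: e_def v_def axis_def)
          have "\<phi> j \<noteq> \<phi> k" using \<phi> j(1) k unfolding bij_betw_def inj_on_def by auto
          then have "snd (\<phi> j) \<noteq> snd (\<phi> k)" using i by (auto simp: i_def prod_eq_iff)
          moreover have "snd (\<phi> j) \<in> K i" "snd (\<phi> k) \<in> K i"
            using \<phi>_in[of j] \<phi>_in[of k] i j(1) k by (auto simp: i_def)
          ultimately show False using j(2) v(1) unfolding ej inj_on_def by blast
        qed
      qed
      from span_mono[OF this] in_span have "e k s $ i \<in> span (v ` K i - {v (snd (\<phi> k))})"
        unfolding span_insert_0 by blast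
      moreover have "e k s $ i = v (snd (\<phi> k))" by (simp add: e_def v_def i_def axis_def)
      ultimately show False
        using v(2) \<phi>_in[OF k] unfolding dependent_def i_def by auto
    qed
  next
    show "polynomial_function (\<lambda>s. (fixed_proj (fst s), slice_norm s))" by (rule polynomial_slice)
    show "subspace (fixed_space G U \<times> (UNIV :: real set))"
      by (intro subspace_Times subspace_fixed_space) auto
    show "piece n g h K \<subseteq> Gamma_set U (n i) (g i) (h i) (card (K i))" by (rule piece_subset_Gamma)
  next
    fix F :: "'v \<times> real \<Rightarrow> real"
    assume "real_polynomial_function F" "\<forall>x\<in>fixed_space G U \<times> {0<..}. F x = 0"
    then show "\<forall>x\<in>fixed_space G U \<times> UNIV. F x = 0" by (rule half_space_dense)
  next
    fix s v assume s: "s \<in> piece n g h K" and v: "v \<in> fixed_space G U \<times> {0 :: real<..}"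
    obtain v1 r where vr: "v = (v1, r)" "v1 \<in> fixed_space G U" "r > 0" using v by auto
    obtain s' t where s': "s' \<in> piece n g h K" "fixed_proj (fst s') = v1" "slice_norm s' = r"
      "\<And>i k. k < n i \<Longrightarrow> tuple_diff (g i) (h i) k s' = t *\<^sub>R tuple_diff (g i) (h i) k s"
      using piece_move[OF s gh K(1) slice_norm_pos[OF s gh K] vr(2,3)] by blast
    have "e k s' \<in> span ((\<lambda>j. e j s) ` {..<Q})" if k: "k < Q" for k
    proof -
      have "snd (\<phi> k) < n (fst (\<phi> k))" using \<phi>_in[OF k] K(1) by blast
      then have "e k s' = t *\<^sub>R e k s" by (simp add: e_def s'(4) linear_scale[OF lin_axis])
      then show ?thesis using k by (auto intro: span_scale span_base)
    qed
    then show "\<exists>s'\<in>piece n g h K. (fixed_proj (fst s'), slice_norm s') = v \<and>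
        (\<forall>k<Q. e k s' \<in> span ((\<lambda>j. e j s) ` {..<Q}))"
      using s'(1-3) vr(1) by blast
  next
    fix F :: "'v ^ 'p \<Rightarrow> real"
    assume "real_polynomial_function F"
      "\<And>w s. s \<in> piece n g h K \<Longrightarrow> \<forall>k<Q. w \<bullet> e k s = 0 \<Longrightarrow> F w = 0"
    then show "\<forall>w. F w = 0" unfolding e_perp by (rule dense)
  qed
  also have "dim (fixed_space G U \<times> (UNIV :: real set)) = dim (fixed_space G U) + 1"
    using subspace_fixed_space by (simp add: dim_Times dim_UNIV)
  finally show ?thesis by (simp add: Q_def)
qed


section \<open>Orbits and sorted inner products\<close>

sublocale group_action G UNIV U by (rule act)

sublocale group G by (rule group_hom.axioms(1)[OF group_hom])

lemma U_one: "U \<one>\<^bsub>G\<^esub> x = x"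
  using id_eq_one by (metis UNIV_I restrict_apply')

lemma U_mult: "a \<in> carrier G \<Longrightarrow> b \<in> carrier G \<Longrightarrow> U (a \<otimes>\<^bsub>G\<^esub> b) x = U a (U b x)"
  using composition_rule[of x a b] by simp

lemma U_inv: "a \<in> carrier G \<Longrightarrow> U a (U (inv\<^bsub>G\<^esub> a) x) = x" "a \<in> carrier G \<Longrightarrow> U (inv\<^bsub>G\<^esub> a) (U a x) = x"
  by (simp_all add: U_mult[symmetric] U_one)

lemma inner_U_inv: "a \<in> carrier G \<Longrightarrow> w \<bullet> U (inv\<^bsub>G\<^esub> a) x = U a w \<bullet> x"
  using isometry U_inv(1)[of a x] unfolding orthogonal_transformation_def by metis

lemma orbit_eqI:
  assumes ab: "a \<in> carrier G" "b \<in> carrier G" and eq: "U a x = U b y"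
  shows "orbit G U x = orbit G U y"
proof -
  have sub: "orbit G U x \<subseteq> orbit G U y"
    if ab: "a \<in> carrier G" "b \<in> carrier G" and eq: "U a x = U b y" for a b x y
  proof
    fix z assume "z \<in> orbit G U x"
    then obtain c where c: "c \<in> carrier G" "z = U c x" by (auto simp: orbit_def)
    have "z = U c (U (inv\<^bsub>G\<^esub> a) (U b y))" using c U_inv(2)[OF ab(1)] eq by metis
    also have "\<dots> = U (c \<otimes>\<^bsub>G\<^esub> inv\<^bsub>G\<^esub> a \<otimes>\<^bsub>G\<^esub> b) y" using c ab by (simp add: U_mult)
    finally show "z \<in> orbit G U y" using c ab unfolding orbit_def by blast
  qed
  show ?thesis using sub[OF ab eq] sub[OF ab(2,1) eq[symmetric]] by blast
qed

text \<open>Sorting the group by the value of the inner product assigns to each position a group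
  element, with ties broken by the initial list. Positions count from 1 and list indices from
  0.\<close>

lemma coorbit_entry_enumeration:
  "\<exists>gs. distinct gs \<and> set gs = carrier G \<and>
     (\<forall>j\<in>{1..order G}. coorbit_entry G U w j x = U (gs ! (j - 1)) w \<bullet> x)"
proof -
  obtain l where l: "set l = carrier G" "distinct l" using finite_distinct_list[OF fin] by blast
  define \<phi> where "\<phi> = (\<lambda>g. U g w \<bullet> x)"
  define gs where "gs = rev (sort_key \<phi> l)"
  have "sort (map \<phi> l) = map \<phi> (sort_key \<phi> l)"
    by (rule properties_for_sort) simp_all
  moreover have "image_mset \<phi> (mset_set (carrier G)) = mset (map \<phi> l)"
    using l by (simp add: mset_set_set[symmetric])
  ultimately have list: "rev (sorted_list_of_multiset (image_mset \<phi> (mset_set (carrier G)))) = map \<phi> gs"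
    by (simp add: gs_def rev_map del: mset_map)
  have gs: "distinct gs" "set gs = carrier G" using l by (simp_all add: gs_def)
  then have "length gs = order G" by (metis distinct_card order_def)
  then have "coorbit_entry G U w j x = U (gs ! (j - 1)) w \<bullet> x" if "j \<in> {1..order G}" for j
  proof -
    have "j - 1 < length gs" using that \<open>length gs = order G\<close> by auto
    then show ?thesis
      using list unfolding coorbit_entry_def \<phi>_def by (metis (no_types, lifting) nth_map)
  qed
  then show ?thesis using gs by blast
qed

lemma distinct_tuples_inv_nth:
  assumes gs: "distinct gs" "set gs = carrier G" and js: "distinct js" "set js \<subseteq> {1..order G}"
  shows "map (\<lambda>j. inv\<^bsub>G\<^esub> (gs ! (j - 1))) js \<in> distinct_tuples G (length js)"
proof -
  have len: "length gs = order G" using gs by (metis distinct_card order_def)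
  have in_G: "gs ! (j - 1) \<in> carrier G" if "j \<in> set js" for j
  proof -
    have "j - 1 < length gs" using js(2) that len by fastforce
    then show ?thesis using gs(2) nth_mem by blast
  qed
  have "inj_on (\<lambda>j. inv\<^bsub>G\<^esub> (gs ! (j - 1))) (set js)"
  proof (rule inj_onI)
    fix i j assume ij: "i \<in> set js" "j \<in> set js" "inv\<^bsub>G\<^esub> (gs ! (i - 1)) = inv\<^bsub>G\<^esub> (gs ! (j - 1))"
    then have "gs ! (i - 1) = gs ! (j - 1)" using in_G by (metis inv_inv)
    moreover have "1 \<le> i" "1 \<le> j" "i - 1 < length gs" "j - 1 < length gs"
      using ij js(2) len by fastforce+
    ultimately show "i = j" using nth_eq_iff_index_eq[OF gs(1)] by (metis le_add_diff_inverse)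
  qed
  then show ?thesis using js(1) in_G by (auto simp: distinct_tuples_def distinct_map)
qed

text \<open>Since \<open>U g w \<bullet> x = w \<bullet> U (inv g) x\<close>, the j-th entries at x
  and y are inner products of the same w with translates of x and y. Their equality makes w
  orthogonal to the difference, and distinct positions give distinct group elements.\<close>

lemma equal_entries_imp_tuples:
  assumes J: "J \<subseteq> {1..order G}" "card J \<ge> m"
    and eq: "\<And>j. j \<in> J \<Longrightarrow> coorbit_entry G U w j x = coorbit_entry G U w j y"
  shows "\<exists>g\<in>distinct_tuples G m. \<exists>h\<in>distinct_tuples G m. \<forall>k<m. w \<bullet> tuple_diff g h k (x, y) = 0"
proof -
  obtain gs where gs: "distinct gs" "set gs = carrier G"
    "\<And>j. j \<in> {1..order G} \<Longrightarrow> coorbit_entry G U w j x = U (gs ! (j - 1)) w \<bullet> x"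
    using coorbit_entry_enumeration[of w x] by blast
  obtain hs where hs: "distinct hs" "set hs = carrier G"
    "\<And>j. j \<in> {1..order G} \<Longrightarrow> coorbit_entry G U w j y = U (hs ! (j - 1)) w \<bullet> y"
    using coorbit_entry_enumeration[of w y] by blast
  have finJ: "finite J" using J(1) finite_subset by blast
  \<comment> \<open>J may have more than m elements, whereas the tuples have length exactly
    m.\<close>
  define js where "js = take m (sorted_list_of_set J)"
  have "set js \<subseteq> set (sorted_list_of_set J)" unfolding js_def by (rule set_take_subset)
  then have js: "distinct js" "set js \<subseteq> J" "length js = m" using finJ J(2) by (auto simp: js_def)
  define g where "g = map (\<lambda>j. inv\<^bsub>G\<^esub> (gs ! (j - 1))) js"
  define h where "h = map (\<lambda>j. inv\<^bsub>G\<^esub> (hs ! (j - 1))) js"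
  have js_sub: "set js \<subseteq> {1..order G}" using js(2) J(1) by blast
  have gh: "g \<in> distinct_tuples G m" "h \<in> distinct_tuples G m"
    using distinct_tuples_inv_nth[OF gs(1,2) js(1) js_sub] distinct_tuples_inv_nth[OF hs(1,2) js(1) js_sub]
      js(3) by (simp_all add: g_def h_def)
  have "w \<bullet> tuple_diff g h k (x, y) = 0" if k: "k < m" for k
  proof -
    have j: "js ! k \<in> J" using js(2,3) k nth_mem by blast
    then have jN: "js ! k \<in> {1..order G}" using J(1) by blast
    have len: "length gs = order G" "length hs = order G"
      using gs(1,2) hs(1,2) by (metis distinct_card order_def)+
    have "js ! k - 1 < order G" using jN by auto
    then have in_G: "gs ! (js ! k - 1) \<in> carrier G" "hs ! (js ! k - 1) \<in> carrier G"
      using gs(2) hs(2) len nth_mem by metis+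
    have "w \<bullet> U (g ! k) x = coorbit_entry G U w (js ! k) x"
      using js(3) k by (simp add: g_def inner_U_inv[OF in_G(1)] gs(3)[OF jN] del: One_nat_def)
    moreover have "w \<bullet> U (h ! k) y = coorbit_entry G U w (js ! k) y"
      using js(3) k by (simp add: h_def inner_U_inv[OF in_G(2)] hs(3)[OF jN] del: One_nat_def)
    ultimately show ?thesis using eq[OF j] by (simp add: tuple_diff_def inner_diff_right)
  qed
  then show ?thesis using gh by blast
qed

lemma not_injective_imp_piece:
  fixes w :: "'v ^ 'p" and n :: "'p::finite \<Rightarrow> nat"
  assumes S: "S \<subseteq> {1..order G} \<times> UNIV" "\<And>i. card (section_at S i) \<ge> n i" and n: "\<And>i. n i \<ge> 1"
    and not_inj: "\<not> inj_on (coorbit_map_quot G U w S) (orbits G UNIV U)"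
  shows "\<exists>g h K s. (\<forall>i. g i \<in> distinct_tuples G (n i)) \<and> (\<forall>i. h i \<in> distinct_tuples G (n i)) \<and>
    (\<forall>i. K i \<subseteq> {..<n i} \<and> K i \<noteq> {}) \<and> s \<in> piece n g h K \<and>
    (\<forall>i. \<forall>k\<in>K i. w $ i \<bullet> tuple_diff (g i) (h i) k s = 0)"
proof -
  obtain x y where neq: "orbit G U x \<noteq> orbit G U y"
    and "coorbit_map_quot G U w S (orbit G U x) = coorbit_map_quot G U w S (orbit G U y)"
    using not_inj unfolding inj_on_def orbits_def by blast
  then have map_eq: "coorbit_map G U w S x = coorbit_map G U w S y"
    by (simp add: coorbit_map_quot_orbit[OF act isometry])
  have entry_eq: "coorbit_entry G U (w $ i) j x = coorbit_entry G U (w $ i) j y"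
    if "j \<in> section_at S i" for i j
    using fun_cong[OF map_eq, of "(j, i)"] that by (simp add: coorbit_map_def section_at_def)
  have "section_at S i \<subseteq> {1..order G}" for i using S(1) by (auto simp: section_at_def)
  from equal_entries_imp_tuples[OF this S(2) entry_eq]
  have "\<exists>g\<in>distinct_tuples G (n i). \<exists>h\<in>distinct_tuples G (n i). \<forall>k<n i. w $ i \<bullet> tuple_diff g h k (x, y) = 0"
    for i by blast
  then obtain g h where gh: "\<And>i. g i \<in> distinct_tuples G (n i)" "\<And>i. h i \<in> distinct_tuples G (n i)"
    "\<And>i k. k < n i \<Longrightarrow> w $ i \<bullet> tuple_diff (g i) (h i) k (x, y) = 0"
    by metis
  have "\<exists>K. K \<subseteq> {..<n i} \<and> inj_on (\<lambda>k. tuple_diff (g i) (h i) k (x, y)) K \<and>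
      independent ((\<lambda>k. tuple_diff (g i) (h i) k (x, y)) ` K) \<and>
      span ((\<lambda>k. tuple_diff (g i) (h i) k (x, y)) ` K)
        = span ((\<lambda>k. tuple_diff (g i) (h i) k (x, y)) ` {..<n i})" for i
    using spanning_index_subset by metis
  then obtain K where K: "\<And>i. K i \<subseteq> {..<n i}" "\<And>i. inj_on (\<lambda>k. tuple_diff (g i) (h i) k (x, y)) (K i)"
    "\<And>i. independent ((\<lambda>k. tuple_diff (g i) (h i) k (x, y)) ` K i)"
    "\<And>i. span ((\<lambda>k. tuple_diff (g i) (h i) k (x, y)) ` K i)
        = span ((\<lambda>k. tuple_diff (g i) (h i) k (x, y)) ` {..<n i})"
    by metis
  \<comment> \<open>An empty \<open>K i\<close> would make all differences zero. As
    \<open>n i \<ge> 1\<close>, there is at least one, and its vanishing would put x and y into the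
    same orbit.\<close>
  have "K i \<noteq> {}" for i
  proof
    assume "K i = {}"
    then have span: "span ((\<lambda>k. tuple_diff (g i) (h i) k (x, y)) ` {..<n i}) = {0}"
      using K(4)[of i] by simp
    have "0 < n i" using n[of i] by simp
    then have "tuple_diff (g i) (h i) 0 (x, y) \<in> span ((\<lambda>k. tuple_diff (g i) (h i) k (x, y)) ` {..<n i})"
      by (intro span_base imageI) simp
    then have "tuple_diff (g i) (h i) 0 (x, y) = 0" unfolding span by simp
    then have "U (g i ! 0) x = U (h i ! 0) y" by (simp add: tuple_diff_def)
    then show False
      using neq orbit_eqI distinct_tuples_nth[OF gh(1) \<open>0 < n i\<close>] distinct_tuples_nth[OF gh(2) \<open>0 < n i\<close>]
      by blast
  qed
  moreover have "(x, y) \<in> piece n g h K" using K(2-4) by (simp add: piece_def)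
  moreover have "w $ i \<bullet> tuple_diff (g i) (h i) k (x, y) = 0" if "k \<in> K i" for i k
    using gh(3) K(1) that by blast
  ultimately show ?thesis
    using gh(1,2) K(1)
    by (intro exI[of _ g] exI[of _ h] exI[of _ K] exI[of _ "(x, y)"] conjI allI ballI)
qed

section \<open>Generic injectivity\<close>

lemma finite_distinct_tuples: "finite (distinct_tuples G n)"
  unfolding distinct_tuples_def using finite_lists_length_eq[OF fin, of n]
  by (rule rev_finite_subset) auto

lemma semialg_dim_le_rho:
  assumes "g \<in> distinct_tuples G n" "h \<in> distinct_tuples G n"
  shows "semialg_dim (Gamma_set U n g h q) \<le> rho G U n q"
  unfolding rho_def using assms finite_distinct_tuples
  by (intro Max_ge) (auto intro!: image_eqI[of _ _ "(g, h)"])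

text \<open>The exceptional w are indexed by tuples g, h and index sets K, a finite collection that
  does not involve S; so one open set serves all S. The assumption \<open>small\<close> contradicts
  the dimension bound with q_i = \<open>card (K i)\<close>, which is at least 1 as K i is
  nonempty.\<close>

theorem generic_injective:
  fixes n :: "'p::finite \<Rightarrow> nat"
  assumes n: "\<And>i. n i \<ge> 1"
    and small: "\<And>q :: 'p \<Rightarrow> nat. (\<And>i. q i \<in> {1..n i}) \<Longrightarrow>
      \<exists>i. rho G U (n i) (q i) < ereal (real ((\<Sum>i\<in>UNIV. q i) + (dim (fixed_space G U) + 1)))"
  shows "zariski_generic (\<lambda>w :: 'v ^ 'p. \<forall>S \<subseteq> {1..order G} \<times> UNIV.
    (\<forall>i. card (section_at S i) \<ge> n i) \<longrightarrow> inj_on (coorbit_map_quot G U w S) (orbits G UNIV U))"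
proof -
  define T where "T = PiE UNIV (\<lambda>i. distinct_tuples G (n i)) \<times> PiE UNIV (\<lambda>i. distinct_tuples G (n i)) \<times>
    PiE UNIV (\<lambda>i. Pow {..<n i} - {{}})"
  define W :: "('p \<Rightarrow> 'g list) \<times> ('p \<Rightarrow> 'g list) \<times> ('p \<Rightarrow> nat set) \<Rightarrow> ('v ^ 'p) set" where
    "W = (\<lambda>(g, h, K). {w. \<exists>s\<in>piece n g h K. \<forall>i. \<forall>k\<in>K i. w $ i \<bullet> tuple_diff (g i) (h i) k s = 0})"
  show ?thesis
  proof (rule zariski_generic_finite_cover)
    show "finite T"
      unfolding T_def by (intro finite_cartesian_product finite_PiE finite_distinct_tuples) auto
  next
    fix w :: "'v ^ 'p"
    assume "\<not> (\<forall>S \<subseteq> {1..order G} \<times> UNIV. (\<forall>i. card (section_at S i) \<ge> n i) \<longrightarrow>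
      inj_on (coorbit_map_quot G U w S) (orbits G UNIV U))"
    then obtain S where "S \<subseteq> {1..order G} \<times> UNIV" "\<And>i. card (section_at S i) \<ge> n i"
      "\<not> inj_on (coorbit_map_quot G U w S) (orbits G UNIV U)" by blast
    from not_injective_imp_piece[OF this(1,2) n this(3)] obtain g h K s where ghK:
      "\<And>i. g i \<in> distinct_tuples G (n i)" "\<And>i. h i \<in> distinct_tuples G (n i)"
      "\<And>i. K i \<subseteq> {..<n i} \<and> K i \<noteq> {}" "s \<in> piece n g h K"
      "\<And>i k. k \<in> K i \<Longrightarrow> w $ i \<bullet> tuple_diff (g i) (h i) k s = 0" by blast
    have "(g, h, K) \<in> T" using ghK(1-3) by (simp add: T_def PiE_iff)
    moreover have "w \<in> W (g, h, K)"
      unfolding W_def using ghK(4,5) by (auto intro!: bexI[of _ s])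
    ultimately show "\<exists>t\<in>T. w \<in> W t" by blast
  next
    fix t assume t: "t \<in> T"
    show "\<exists>F. real_polynomial_function F \<and> (\<forall>w\<in>W t. F w = 0) \<and> (\<exists>w. F w \<noteq> 0)"
    proof (rule ccontr)
      assume no: "\<not> ?thesis"
      obtain g h K where ghK: "t = (g, h, K)" by (cases t)
      have gh: "g i \<in> distinct_tuples G (n i)" "h i \<in> distinct_tuples G (n i)"
        and K: "K i \<subseteq> {..<n i}" "K i \<noteq> {}" for i
        using t by (auto simp: T_def ghK PiE_iff)
      \<comment> \<open>By \<open>no\<close>, only the zero polynomial vanishes on
        \<open>W t\<close>, which is the density that the dimension bound requires.\<close>
      have dense: "\<forall>w. F w = 0" if "real_polynomial_function F"
        "\<And>w s. s \<in> piece n g h K \<Longrightarrow> \<forall>i. \<forall>k\<in>K i. w $ i \<bullet> tuple_diff (g i) (h i) k s = 0 \<Longrightarrow> F w = 0"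
        for F :: "'v ^ 'p \<Rightarrow> real"
      proof -
        have "\<forall>w\<in>W t. F w = 0" using that(2) by (auto simp: W_def ghK)
        then show ?thesis using no that(1) by blast
      qed
      have "card (K i) \<in> {1..n i}" for i
      proof -
        have "finite (K i)" using K(1)[of i] finite_subset by blast
        then have "0 < card (K i)" using K(2)[of i] by (simp add: card_gt_0_iff)
        moreover have "card (K i) \<le> card {..<n i}" using K(1)[of i] by (intro card_mono) auto
        ultimately show ?thesis by simp
      qed
      then obtain i where "rho G U (n i) (card (K i))
          < ereal (real ((\<Sum>i\<in>UNIV. card (K i)) + (dim (fixed_space G U) + 1)))"
        using small[of "\<lambda>i. card (K i)"] by blast
      moreover have "semialg_dim (Gamma_set U (n i) (g i) (h i) (card (K i)))
          \<ge> ereal (real ((\<Sum>i\<in>UNIV. card (K i)) + (dim (fixed_space G U) + 1)))"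
        by (rule semialg_dim_Gamma_ge[OF gh K dense])
      ultimately show False
        using semialg_dim_le_rho[OF gh, of i "card (K i)"] by (meson leD order_trans)
    qed
  qed
qed

end

theorem theorem2p6:
  fixes G :: "('g, 'm) monoid_scheme"
    and U :: "'g \<Rightarrow> 'v::euclidean_space \<Rightarrow> 'v"
  assumes "DIM('v) \<ge> 2"
    and "finite (carrier G)"
    and "group_action G UNIV U"
    and "\<forall>g\<in>carrier G. orthogonal_transformation (U g)"
  shows
    "(\<forall>n :: 'p::finite \<Rightarrow> nat.
        (\<forall>i. n i \<in> {1..order G}) \<longrightarrow>
        (MAX q \<in> {q :: 'p \<Rightarrow> nat. \<forall>i. q i \<in> {1..n i}}.
            (MIN i. rho G U (n i) (q i)) - ereal (real (\<Sum>i\<in>UNIV. q i)))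
          \<le> ereal (real (dim (fixed_space G U))) \<longrightarrow>
        zariski_generic (\<lambda>w :: 'v ^ 'p.
          \<forall>S \<subseteq> {1..order G} \<times> UNIV.
            (\<forall>i. card (section_at S i) \<ge> n i) \<longrightarrow>
            inj_on (coorbit_map_quot G U w S) (orbits G UNIV U)))
     \<and>
     (\<forall>n :: nat.
        n \<in> {1..order G} \<longrightarrow>
        ereal (real CARD('p)) >
          (MAX q \<in> {1..n}. ereal (1 / real q) *
             (rho G U n q - ereal (real (dim (fixed_space G U))) - 1)) \<longrightarrow>
        zariski_generic (\<lambda>w :: 'v ^ 'p.
          \<forall>S \<subseteq> {1..order G} \<times> UNIV.
            (\<forall>i. card (section_at S i) \<ge> n) \<longrightarrow>
            inj_on (coorbit_map_quot G U w S) (orbits G UNIV U)))"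
proof -
  interpret isometric_action G U by (rule isometric_action.intro) fact+
  let ?d = "dim (fixed_space G U)"
  show ?thesis
  proof (intro conjI allI impI)
    fix n :: "'p \<Rightarrow> nat"
    assume n: "\<forall>i. n i \<in> {1..order G}"
      and max: "(MAX q \<in> {q :: 'p \<Rightarrow> nat. \<forall>i. q i \<in> {1..n i}}.
            (MIN i. rho G U (n i) (q i)) - ereal (real (\<Sum>i\<in>UNIV. q i))) \<le> ereal (real ?d)"
    show "zariski_generic (\<lambda>w :: 'v ^ 'p. \<forall>S \<subseteq> {1..order G} \<times> UNIV.
            (\<forall>i. card (section_at S i) \<ge> n i) \<longrightarrow>
            inj_on (coorbit_map_quot G U w S) (orbits G UNIV U))"
    proof (rule generic_injective)
      show "n i \<ge> 1" for i using n by simp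
      fix q :: "'p \<Rightarrow> nat" assume q: "\<And>i. q i \<in> {1..n i}"
      have "{q :: 'p \<Rightarrow> nat. \<forall>i. q i \<in> {1..n i}} = PiE UNIV (\<lambda>i. {1..n i})" by (auto simp: PiE_iff)
      moreover have "finite (PiE (UNIV :: 'p set) (\<lambda>i. {1..n i}))" by (intro finite_PiE) auto
      ultimately have fin_q: "finite {q :: 'p \<Rightarrow> nat. \<forall>i. q i \<in> {1..n i}}" by simp
      let ?f = "\<lambda>q. (MIN i. rho G U (n i) (q i)) - ereal (real (\<Sum>i\<in>UNIV. q i))"
      have "?f q \<le> (MAX q \<in> {q :: 'p \<Rightarrow> nat. \<forall>i. q i \<in> {1..n i}}. ?f q)"
        using fin_q q by (intro Max_ge) auto
      with max have le: "?f q \<le> ereal (real ?d)" by (rule order_trans[rotated])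
      have "(MIN i. rho G U (n i) (q i)) \<in> range (\<lambda>i. rho G U (n i) (q i))"
        by (intro Min_in) auto
      then obtain i where i: "(MIN i. rho G U (n i) (q i)) = rho G U (n i) (q i)" by blast
      \<comment> \<open>The minimum is attained at i, and a bound by d_G is weakened to a strict one
        by d_G + 1. The infinite values are settled by \<open>le\<close> or are trivial.\<close>
      have "rho G U (n i) (q i) < ereal (real ((\<Sum>i\<in>UNIV. q i) + (?d + 1)))"
        using le unfolding i by (cases "rho G U (n i) (q i)") auto
      then show "\<exists>i. rho G U (n i) (q i) < ereal (real ((\<Sum>i\<in>UNIV. q i) + (?d + 1)))" by blast
    qed
  next
    fix n :: nat
    assume n: "n \<in> {1..order G}"
      and max: "ereal (real CARD('p)) >
          (MAX q \<in> {1..n}. ereal (1 / real q) * (rho G U n q - ereal (real ?d) - 1))"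
    show "zariski_generic (\<lambda>w :: 'v ^ 'p. \<forall>S \<subseteq> {1..order G} \<times> UNIV.
            (\<forall>i. card (section_at S i) \<ge> n) \<longrightarrow>
            inj_on (coorbit_map_quot G U w S) (orbits G UNIV U))"
    proof (rule generic_injective)
      show "n \<ge> 1" using n by simp
      fix q :: "'p \<Rightarrow> nat" assume q: "\<And>i. q i \<in> {1..n}"
      \<comment> \<open>At an index i with the smallest value, p * q_i is at most the sum of all
        q_j. Multiplying the hypothesis by q_i therefore bounds \<rho> strictly by p * q_i + d_G +
        1, hence by the sum plus d_G + 1.\<close>
      have "Min (range q) \<in> range q" by (intro Min_in) auto
      then obtain i where i: "q i = Min (range q)" by (metis rangeE)
      have "CARD('p) * q i \<le> (\<Sum>j\<in>UNIV. q j)"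
        using sum_bounded_below[of UNIV "q i" q] by (simp add: i)
      then have sum: "real CARD('p) * real (q i) \<le> real (\<Sum>j\<in>UNIV. q j)"
        unfolding of_nat_mult[symmetric] of_nat_le_iff .
      have "ereal (1 / real (q i)) * (rho G U n (q i) - ereal (real ?d) - 1)
          \<le> (MAX q \<in> {1..n}. ereal (1 / real q) * (rho G U n q - ereal (real ?d) - 1))"
        using q[of i] by (intro Max_ge) auto
      with max have lt: "ereal (1 / real (q i)) * (rho G U n (q i) - ereal (real ?d) - 1)
          < ereal (real CARD('p))" by (rule order_le_less_trans[rotated])
      have pos: "real (q i) > 0" using q[of i] by simp
      have "rho G U n (q i) < ereal (real ((\<Sum>i\<in>UNIV. q i) + (?d + 1)))"
      proof (cases "rho G U n (q i)")
        case (real r)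
        then have "1 / real (q i) * (r - real ?d - 1) < real CARD('p)"
          using lt by (simp add: one_ereal_def)
        then have "r - real ?d - 1 < real CARD('p) * real (q i)"
          using pos by (simp add: divide_simps)
        then show ?thesis using sum real by simp
      next
        case PInf
        then show ?thesis using lt pos by (simp add: one_ereal_def)
      qed simp
      then show "\<exists>i. rho G U n (q i) < ereal (real ((\<Sum>i\<in>UNIV. q i) + (?d + 1)))" by blast
    qed
  qed
qed

end
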